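(* Let $D\subset\mathbb R^2$ be a bounded simply connected domain with smooth boundary, let $k\ge 1$ be an integer, let $\alpha$ be a given positive number, and let $x_1,\dots,x_k\in\overline{D}$ be $k$ different points. Suppose that for each $\vec{\kappa}\in\mathbb K^{\alpha}$ with $|\vec{\kappa}|\ll 1$ (that is, $|\vec\kappa|<\delta$ for some $\delta>0$) there exists a steady vortex patch solution $\omega^{\vec{\kappa}}$ (a weak solution of the vorticity equation in $D$) of the form $$\omega^{\vec{\kappa}}=1-I_{\cup_{i=1}^kA_i^{\vec{\kappa}}},\qquad |A_i^{\vec{\kappa}}|=\kappa_i,\quad A_i^{\vec{\kappa}}\subset B_{o(1)}(x_i)\quad (i=1,\dots,k),$$ where $o(1)\to 0$ as $|\vec{\kappa}|\to 0$. Then each $x_i$ belongs to $D$ and must be a critical point of $\psi_0$.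
   Context: $\psi_0$ is the solution of $-\Delta\psi_0=1$ in $D$, $\psi_0=0$ on $\partial D$. For a given positive number $\alpha$, $\mathbb K^{\alpha}$ is the set of $\vec{\kappa}=(\kappa_1,\dots,\kappa_k)\in\mathbb R^k$ with all $\kappa_i>0$ and $\max_{i,j}\kappa_i/\kappa_j\le\alpha$; $|\vec{\kappa}|:=\sum_{i=1}^k\kappa_i$. $I_A$ is the characteristic function of the set $A$, the sets $A_i^{\vec\kappa}\subset D$ are measurable, $|A|$ is the two-dimensional Lebesgue measure of $A$, and $B_r(x)$ is the open disc of radius $r$ centered at $x$. $G$ is the Green's function of $-\Delta$ in $D$ with zero Dirichlet boundary data and $G\omega(x):=\int_DG(x,y)\omega(y)\,dy$. For $\mathbf b=(b_1,b_2)$, $\mathbf b^\perp=(b_2,-b_1)$, and $\nabla^\perp f=(\nabla f)^\perp$. A function $\omega\in L^\infty(D)$ is a weak solution of the vorticity equation ($\nabla^\perp G\omega\cdot\nabla\omega=0$) if $\int_D\omega\,\nabla^\perp G\omega\cdot\nabla\phi\,dx=0$ for all $\phi\in C_c^\infty(D)$.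
   Formalization: The number α is assumed to be at least 1 instead of merely positive: for 0 < α < 1 the set K^α is empty (since κ_i/κ_i = 1), the existence hypothesis is vacuous and the conclusion fails. *)

theory Defs
  imports "HOL-Analysis.Analysis"
begin

definition partial :: "'a::euclidean_space \<Rightarrow> ('a \<Rightarrow> real) \<Rightarrow> 'a \<Rightarrow> real" where
  "partial b f x = frechet_derivative f (at x) b"

definition grad :: "('a::euclidean_space \<Rightarrow> real) \<Rightarrow> 'a \<Rightarrow> 'a" where
  "grad f x = (\<Sum>b\<in>Basis. partial b f x *\<^sub>R b)"

definition laplacian :: "('a::euclidean_space \<Rightarrow> real) \<Rightarrow> 'a \<Rightarrow> real" where
  "laplacian f x = (\<Sum>b\<in>Basis. partial b (partial b f) x)"

definition perp :: "real^2 \<Rightarrow> real^2" where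
  "perp b = vector [b $ 2, - (b $ 1)]"

text \<open>Intended for open sets: the derivatives are taken in the whole space.\<close>

primrec Ck_on :: "nat \<Rightarrow> ('a::euclidean_space \<Rightarrow> real) \<Rightarrow> 'a set \<Rightarrow> bool" where
  "Ck_on 0 f S \<longleftrightarrow> continuous_on S f"
| "Ck_on (Suc k) f S \<longleftrightarrow>
     (\<forall>x\<in>S. f differentiable (at x)) \<and> (\<forall>b\<in>Basis. Ck_on k (partial b f) S)"

definition smooth :: "('a::euclidean_space \<Rightarrow> real) \<Rightarrow> bool" where
  "smooth f \<longleftrightarrow> (\<forall>k. Ck_on k f UNIV)"

definition test_function :: "'a::euclidean_space set \<Rightarrow> ('a \<Rightarrow> real) \<Rightarrow> bool" where
  "test_function D \<phi> \<longleftrightarrow>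
     smooth \<phi> \<and> compact (closure {x. \<phi> x \<noteq> 0}) \<and> closure {x. \<phi> x \<noteq> 0} \<subseteq> D"

text \<open>Near each boundary point, after an orthogonal change of axes, the set is the region
  lying above the graph of a smooth function of one variable.\<close>

definition smooth_boundary :: "(real^2) set \<Rightarrow> bool" where
  "smooth_boundary D \<longleftrightarrow>
     (\<forall>p\<in>frontier D. \<exists>r>0. \<exists>(T :: real^2 \<Rightarrow> real^2) (g :: real \<Rightarrow> real).
        orthogonal_transformation T \<and> smooth g \<and>
        D \<inter> ball p r = {x \<in> ball p r. g (T x $ 1) < T x $ 2})"

definition smooth_sc_domain :: "(real^2) set \<Rightarrow> bool" where
  "smooth_sc_domain D \<longleftrightarrow>
     D \<noteq> {} \<and> open D \<and> connected D \<and> bounded D \<and> simply_connected D \<and> smooth_boundary D"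

definition torsion_function :: "(real^2) set \<Rightarrow> (real^2 \<Rightarrow> real) \<Rightarrow> bool" where
  "torsion_function D \<psi> \<longleftrightarrow>
     continuous_on (closure D) \<psi> \<and> Ck_on 2 \<psi> D \<and>
     (\<forall>x\<in>D. - laplacian \<psi> x = 1) \<and> (\<forall>x\<in>frontier D. \<psi> x = 0)"

text \<open>The pole \<open>y\<close> contributes the fundamental solution of \<open>-\<Delta>\<close> in the plane; \<open>h\<close> is the
  harmonic regular part.  The values \<open>G y y\<close> are left unspecified.\<close>

definition green_function :: "(real^2) set \<Rightarrow> (real^2 \<Rightarrow> real^2 \<Rightarrow> real) \<Rightarrow> bool" where
  "green_function D G \<longleftrightarrow>
     (\<forall>y\<in>D. (\<exists>h. continuous_on (closure D) h \<and> Ck_on 2 h D \<and> (\<forall>x\<in>D. laplacian h x = 0) \<and>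
                 (\<forall>x\<in>closure D - {y}. G x y = - (1 / (2 * pi)) * ln (dist x y) + h x)) \<and>
            (\<forall>x\<in>frontier D. G x y = 0))"

definition green_op ::
    "(real^2) set \<Rightarrow> (real^2 \<Rightarrow> real^2 \<Rightarrow> real) \<Rightarrow> (real^2 \<Rightarrow> real) \<Rightarrow> real^2 \<Rightarrow> real" where
  "green_op D G \<omega> x = (LINT y:D|lebesgue. G x y * \<omega> y)"

definition L_infinity :: "(real^2) set \<Rightarrow> (real^2 \<Rightarrow> real) \<Rightarrow> bool" where
  "L_infinity D \<omega> \<longleftrightarrow>
     \<omega> \<in> borel_measurable (lebesgue_on D) \<and> (\<exists>C. AE x in lebesgue_on D. \<bar>\<omega> x\<bar> \<le> C)"

definition weak_vorticity_solution ::
    "(real^2) set \<Rightarrow> (real^2 \<Rightarrow> real^2 \<Rightarrow> real) \<Rightarrow> (real^2 \<Rightarrow> real) \<Rightarrow> bool" where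
  "weak_vorticity_solution D G \<omega> \<longleftrightarrow>
     L_infinity D \<omega> \<and>
     (\<forall>\<phi>. test_function D \<phi> \<longrightarrow>
        (LINT x:D|lebesgue. \<omega> x * (perp (grad (green_op D G \<omega>) x) \<bullet> grad \<phi> x)) = 0)"

definition mass :: "real^'k \<Rightarrow> real" where
  "mass \<kappa> = (\<Sum>i\<in>UNIV. \<kappa> $ i)"

text \<open>Since the pairs \<open>i = j\<close> count in the maximum, this set is empty for \<open>\<alpha> < 1\<close>.\<close>

definition K_set :: "real \<Rightarrow> (real^'k) set" where
  "K_set \<alpha> = {\<kappa>. (\<forall>i. 0 < \<kappa> $ i) \<and> Max (range (\<lambda>(i, j). \<kappa> $ i / \<kappa> $ j)) \<le> \<alpha>}"

end

theory Submission
  imports Defs "HOL-Complex_Analysis.Cauchy_Integral_Formula" "HOL-Real_Asymp.Real_Asymp"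
begin

text \<open>Let \<open>u\<close> be the potential of \<open>1\<close> on \<open>D\<close>, a positive multiple of \<open>\<psi>\<^sub>0\<close>, and let \<open>v\<close> be the potential of the
  vortex patches \<open>A\<close>, so that \<open>\<psi> = u - v\<close> is the stream function. Comparison with discs touching \<open>D\<close> from
  outside gives \<open>G x y \<le> C d(x) / \<bar>x - y\<bar>\<close>, with \<open>d\<close> the distance to the boundary, and interior gradient
  estimates turn this into \<open>\<bar>\<nabla>G x y\<bar> \<le> C / \<bar>x - y\<bar>\<close> up to the boundary; hence \<open>\<bar>\<nabla>v\<bar> \<le> C sqrt \<bar>A\<bar>\<close>
  on all of \<open>D\<close>. If the derivative of \<open>\<psi>\<^sub>0\<close> in a fixed direction \<open>e\<close> is bounded below by a positive constant
  near \<open>x\<^sub>i\<close>, then for small \<open>\<bar>A\<bar>\<close> the derivative of \<open>\<psi>\<close> along \<open>e\<close> is positive there. The weak equation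
  holds without the factor \<open>1 - I\<^sub>A\<close> for every test function, so it also holds with the factor \<open>I\<^sub>A\<close>; testing with
  \<open>\<tau> \<chi>(\<psi>)\<close>, where \<open>\<tau>\<close> is a linear function with \<open>\<nabla>\<tau> = e\<^sup>\<bottom>\<close> cut off around \<open>x\<^sub>i\<close>, shows that the patch at
  \<open>x\<^sub>i\<close> has measure zero. Such an \<open>e\<close> exists at a noncritical interior point by continuity, and at a boundary point
  by the Hopf lemma, so every \<open>x\<^sub>i\<close> is an interior critical point.\<close>

text \<open>The obstacle is that an \<open>x i\<close> may lie on the boundary, so that its patch
  may accumulate at the frontier of \<open>D\<close>. Every estimate must hold uniformly up to the
  boundary, although the hypotheses give no more than continuity on \<open>closure D\<close>.
  Maximum principles against explicit barriers (logarithms centred in exterior discs, the torsion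
  function of inscribed discs) therefore take the place of boundary regularity theory. The same
  obstacle explains the cutoff in \<psi>: a test function has to vanish near the boundary, and a
  cutoff that is a function of the stream function adds to the gradient only a multiple of
  \<nabla>\<psi>, which the rotated field does not see. The square root of the area comes from the
  worst case for the kernel 1 / \<bar>x - y\<bar>, a disc centred at \<open>x\<close>; because it
  tends to 0 with the area, the patches cannot compete with a fixed lower bound for the derivative
  of \<open>\<psi>\<^sub>0\<close>. The contradiction needs one mass vector only, with equal and
  sufficiently small entries.\<close>

section \<open>Gradients as the vectors that represent derivatives\<close>

lemma GDERIV_grad:
  fixes f :: "'a::euclidean_space \<Rightarrow> real"
  assumes "f differentiable (at x)"
  shows "GDERIV f x :> grad f x"
proof -
  let ?D = "frechet_derivative f (at x)"
  have D: "(f has_derivative ?D) (at x)"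
    using assms frechet_derivative_works by blast
  then have lin: "linear ?D"
    using has_derivative_linear by blast
  have "?D h = h \<bullet> grad f x" for h
  proof -
    have "?D h = ?D (\<Sum>b\<in>Basis. (h \<bullet> b) *\<^sub>R b)"
      by (simp add: euclidean_representation)
    also have "\<dots> = (\<Sum>b\<in>Basis. (h \<bullet> b) * ?D b)"
      by (simp add: linear_sum[OF lin] linear_cmul[OF lin])
    finally show ?thesis
      by (simp add: grad_def partial_def inner_sum_right mult.commute)
  qed
  then show ?thesis
    using D unfolding gderiv_def by presburger
qed

lemma GDERIV_partial:
  assumes "GDERIV f x :> g"
  shows "partial b f x = b \<bullet> g"
proof -
  have "frechet_derivative f (at x) = (\<lambda>h. h \<bullet> g)"
    using assms frechet_derivative_at unfolding gderiv_def by metis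
  then show ?thesis by (simp add: partial_def)
qed

lemma GDERIV_imp_grad:
  assumes "GDERIV f x :> g"
  shows "grad f x = g"
  using euclidean_representation[of g]
  by (simp add: grad_def GDERIV_partial[OF assms] inner_commute)

lemma GDERIV_imp_differentiable: "GDERIV f x :> g \<Longrightarrow> f differentiable (at x)"
  unfolding gderiv_def differentiable_def by blast

lemma GDERIV_cong_open:
  assumes "GDERIV f x :> g" "open S" "x \<in> S" "\<And>y. y \<in> S \<Longrightarrow> f y = f' y"
  shows "GDERIV f' x :> g"
  using assms unfolding gderiv_def by (metis has_derivative_transform_within_open)

subsection \<open>Symmetry of second derivatives\<close>

lemma GDERIV_line:
  assumes "GDERIV f (x + t *\<^sub>R b) :> g"
  shows "((\<lambda>t. f (x + t *\<^sub>R b)) has_real_derivative b \<bullet> g) (at t)"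
proof -
  have "((\<lambda>t. x + t *\<^sub>R b) has_derivative (\<lambda>h. h *\<^sub>R b)) (at t)"
    by (auto intro!: derivative_eq_intros)
  from has_derivative_compose[OF this, of f "\<lambda>h. h \<bullet> g"] assms
  show ?thesis
    by (simp add: gderiv_def has_field_derivative_def mult_commute_abs)
qed

text \<open>The mean value theorem is applied along \<open>b\<close> to the difference of
  \<open>f\<close> and its shift in direction \<open>c\<close>, then along \<open>c\<close> to
  \<open>partial b f\<close>. The left-hand side is symmetric in \<open>b\<close> and
  \<open>c\<close>; this symmetry later forces the mixed derivatives to agree.\<close>

lemma double_difference:
  fixes f :: "'a::euclidean_space \<Rightarrow> real"
  assumes S: "ball x \<delta> \<subseteq> S" and s: "0 < s" "2 * s < \<delta>" and b: "b \<in> Basis" "c \<in> Basis"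
    and d1: "\<And>y. y \<in> S \<Longrightarrow> f differentiable (at y)"
    and d2: "\<And>y. y \<in> S \<Longrightarrow> partial b f differentiable (at y)"
  shows "\<exists>p. dist p x \<le> 2 * s \<and>
    f (x + s *\<^sub>R b + s *\<^sub>R c) - f (x + s *\<^sub>R b) - f (x + s *\<^sub>R c) + f x = s\<^sup>2 * partial c (partial b f) p"
proof -
  have inS: "x + t *\<^sub>R b + r *\<^sub>R c \<in> S" and near: "dist (x + t *\<^sub>R b + r *\<^sub>R c) x \<le> 2 * s"
    if "0 \<le> t" "t \<le> s" "0 \<le> r" "r \<le> s" for t r
  proof -
    have "dist (x + t *\<^sub>R b + r *\<^sub>R c) x = norm (t *\<^sub>R b + r *\<^sub>R c)"
      by (simp add: dist_norm algebra_simps)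
    also have "\<dots> \<le> t + r"
      using norm_triangle_ineq[of "t *\<^sub>R b" "r *\<^sub>R c"] that b by simp
    finally show "dist (x + t *\<^sub>R b + r *\<^sub>R c) x \<le> 2 * s"
      using that by linarith
    then show "x + t *\<^sub>R b + r *\<^sub>R c \<in> S"
      using S s by (auto simp: dist_commute)
  qed
  have D1: "((\<lambda>t. f (x + t *\<^sub>R b + r *\<^sub>R c)) has_real_derivative partial b f (x + t *\<^sub>R b + r *\<^sub>R c)) (at t)"
    if "0 \<le> t" "t \<le> s" "0 \<le> r" "r \<le> s" for t r
  proof -
    let ?y = "x + t *\<^sub>R b + r *\<^sub>R c"
    have g: "GDERIV f ?y :> grad f ?y"
      using d1[OF inS[OF that]] GDERIV_grad by blast
    have "GDERIV f ((x + r *\<^sub>R c) + t *\<^sub>R b) :> grad f ?y"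
      using g by (simp add: algebra_simps)
    from GDERIV_line[OF this] GDERIV_partial[OF g, of b] show ?thesis
      by (simp add: algebra_simps)
  qed
  have "\<exists>z>0. z < s \<and> (f (x + s *\<^sub>R b + s *\<^sub>R c) - f (x + s *\<^sub>R b)) - (f (x + 0 *\<^sub>R b + s *\<^sub>R c) - f (x + 0 *\<^sub>R b))
      = (s - 0) * (partial b f (x + z *\<^sub>R b + s *\<^sub>R c) - partial b f (x + z *\<^sub>R b))"
    apply (rule MVT2[where f="\<lambda>t. f (x + t *\<^sub>R b + s *\<^sub>R c) - f (x + t *\<^sub>R b)"])
    using s apply simp
    subgoal for t
      using D1[of t s] D1[of t 0] s by (auto intro!: derivative_eq_intros)
    done
  then obtain z where z: "0 < z" "z < s"
    "f (x + s *\<^sub>R b + s *\<^sub>R c) - f (x + s *\<^sub>R b) - f (x + s *\<^sub>R c) + f x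
     = s * (partial b f (x + z *\<^sub>R b + s *\<^sub>R c) - partial b f (x + z *\<^sub>R b))"
    by (auto simp: algebra_simps)
  have "\<exists>w>0. w < s \<and> partial b f (x + z *\<^sub>R b + s *\<^sub>R c) - partial b f (x + z *\<^sub>R b + 0 *\<^sub>R c)
      = (s - 0) * partial c (partial b f) (x + z *\<^sub>R b + w *\<^sub>R c)"
    apply (rule MVT2[where f="\<lambda>t. partial b f (x + z *\<^sub>R b + t *\<^sub>R c)"])
    using s apply simp
    subgoal for t
    proof -
      assume t: "0 \<le> t" "t \<le> s"
      let ?y = "x + z *\<^sub>R b + t *\<^sub>R c"
      have g: "GDERIV (partial b f) ?y :> grad (partial b f) ?y"
        using d2[OF inS[of z t]] t z GDERIV_grad by simp
      from GDERIV_line[OF g] GDERIV_partial[OF g, of c] show ?thesis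
        by simp
    qed
    done
  then obtain w where w: "0 < w" "w < s" 
    "partial b f (x + z *\<^sub>R b + s *\<^sub>R c) - partial b f (x + z *\<^sub>R b)
      = s * partial c (partial b f) (x + z *\<^sub>R b + w *\<^sub>R c)"
    by auto
  show ?thesis
    apply (rule exI[of _ "x + z *\<^sub>R b + w *\<^sub>R c"])
    using near[of z w] z w by (auto simp: power2_eq_square algebra_simps)
qed

lemma partial_commute:
  fixes f :: "'a::euclidean_space \<Rightarrow> real"
  assumes S: "open S" "x \<in> S" and b: "b \<in> Basis" "c \<in> Basis" and f: "Ck_on 2 f S"
  shows "partial b (partial c f) x = partial c (partial b f) x"
proof -
  have d1: "f differentiable (at y)" and d2: "d \<in> Basis \<Longrightarrow> partial d f differentiable (at y)" if "y \<in> S" for y d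
    using f that by (auto simp: numeral_2_eq_2)
  have cont: "continuous_on S (partial d (partial e f))" if "d \<in> Basis" "e \<in> Basis" for d e
    using f that by (auto simp: numeral_2_eq_2)
  obtain \<delta> where \<delta>: "\<delta> > 0" "ball x \<delta> \<subseteq> S"
    using S open_contains_ball by blast
  \<comment> \<open>The summand 3 keeps \<open>2 * s n\<close> below \<delta> already at
    \<open>n = 0\<close>.\<close>
  define s where "s n = \<delta> / (real n + 3)" for n
  have s: "0 < s n" "2 * s n < \<delta>" for n
    using \<delta> by (auto simp: s_def field_simps add_pos_nonneg)
  have s0: "s \<longlonglongrightarrow> 0"
    unfolding s_def by real_asymp
  \<comment> \<open>Both mixed derivatives are limits of this one sequence, since either direction
    may be chosen for the inner derivative.\<close>
  define DD where "DD n = (f (x + s n *\<^sub>R b + s n *\<^sub>R c) - f (x + s n *\<^sub>R b) - f (x + s n *\<^sub>R c) + f x) / (s n)\<^sup>2" for n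
  have lim: "DD \<longlonglongrightarrow> partial e (partial d f) x"
    if "d \<in> Basis" "e \<in> Basis" 
      and ex: "\<And>n. \<exists>p. dist p x \<le> 2 * s n \<and> DD n = partial e (partial d f) p" for d e
  proof -
    obtain p where p: "\<And>n. dist (p n) x \<le> 2 * s n" "\<And>n. DD n = partial e (partial d f) (p n)"
      using ex by metis
    have px: "p \<longlonglongrightarrow> x"
      unfolding tendsto_dist_iff[of p]
      by (rule tendsto_sandwich[OF _ _ tendsto_const tendsto_mult_right_zero[OF s0, of 2]]) (use p in auto)
    have "isCont (partial e (partial d f)) x"
      using cont that S continuous_on_eq_continuous_at by blast
    then have "(\<lambda>n. partial e (partial d f) (p n)) \<longlonglongrightarrow> partial e (partial d f) x"
      using px by (rule isCont_tendsto_compose)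
    moreover have "DD = (\<lambda>n. partial e (partial d f) (p n))" using p(2) by (rule ext)
    ultimately show ?thesis by simp
  qed
  have 1: "DD \<longlonglongrightarrow> partial c (partial b f) x"
    apply (rule lim)
    using b apply simp
    using b apply simp
    subgoal for n
      using double_difference[OF \<delta>(2) s(1)[of n] s(2)[of n] b d1 d2[OF _ b(1)]] s(1)[of n]
      by (force simp: DD_def)
    done
  have 2: "DD \<longlonglongrightarrow> partial b (partial c f) x"
    apply (rule lim)
    using b apply simp
    using b apply simp
    subgoal for n
      using double_difference[OF \<delta>(2) s(1)[of n] s(2)[of n] b(2) b(1) d1 d2[OF _ b(2)]] s(1)[of n]
      by (force simp: DD_def algebra_simps)
    done
  show ?thesis using 1 2 LIMSEQ_unique by blast
qed

subsection \<open>Harmonic functions in the plane\<close>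

definition cx :: "real^2 \<Rightarrow> complex" where "cx x = Complex (x$1) (x$2)"
definition vc :: "complex \<Rightarrow> real^2" where "vc z = vector [Re z, Im z]"

lemma cx_sel [simp]: "Re (cx x) = x $ 1" "Im (cx x) = x $ 2"
  by (simp_all add: cx_def)

lemma vc_nth [simp]: "vc z $ 1 = Re z" "vc z $ 2 = Im z"
  by (simp_all add: vc_def)

lemma cx_vc [simp]: "cx (vc z) = z" and vc_cx [simp]: "vc (cx x) = x"
  by (simp_all add: complex_eq_iff vec_eq_iff forall_2)

lemma linear_cx: "linear cx" and linear_vc: "linear vc"
  by (auto intro!: linearI simp: complex_eq_iff vec_eq_iff forall_2)

lemma cx_arith: "cx (x + y) = cx x + cx y" "cx (x - y) = cx x - cx y" "cx (a *\<^sub>R x) = a *\<^sub>R cx x" "cx 0 = 0"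
  by (simp_all add: complex_eq_iff)

lemma norm_vec2: "norm (x::real^2) = sqrt ((x$1)\<^sup>2 + (x$2)\<^sup>2)"
  by (simp add: norm_vec_def L2_set_def sum_2)

lemma inner_vec2: "(x::real^2) \<bullet> y = x$1 * y$1 + x$2 * y$2"
  by (simp add: inner_vec_def sum_2)

lemma norm_cx [simp]: "norm (cx x) = norm x"
  by (simp add: norm_vec2 cmod_def)

lemma norm_vc [simp]: "norm (vc z) = norm z"
  by (metis cx_vc norm_cx)

lemma dist_cx [simp]: "dist (cx x) (cx y) = dist x y"
  by (metis cx_arith(2) dist_norm norm_cx)

lemma dist_vc [simp]: "dist (vc x) (vc y) = dist x y"
  by (metis cx_vc dist_cx)

lemma bounded_linear_cx: "bounded_linear cx" and bounded_linear_vc: "bounded_linear vc"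
  by (simp_all add: linear_cx linear_vc linear_conv_bounded_linear[symmetric])

lemma has_derivative_cx: "(cx has_derivative cx) F" and has_derivative_vc: "(vc has_derivative vc) F'"
  using bounded_linear_cx bounded_linear_vc bounded_linear_imp_has_derivative by blast+

lemma Basis_vec2: "(Basis :: (real^2) set) = {axis 1 1, axis 2 1}"
  by (auto simp: Basis_vec_def UNIV_2)

text \<open>Harmonicity is encoded by local holomorphic representatives rather than by a vanishing
  Laplacian: regularity, mean values and gradient estimates then come from Cauchy theory, and
  logarithms of distances qualify directly.\<close>

definition harmonic_on :: "(real^2 \<Rightarrow> real) \<Rightarrow> (real^2) set \<Rightarrow> bool" where
  "harmonic_on h S \<longleftrightarrow> (\<forall>x\<in>S. \<exists>r>0. \<exists>F. F holomorphic_on ball (cx x) r \<and> (\<forall>y\<in>ball x r. h y = Re (F (cx y))))"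

lemma harmonic_on_subset: "harmonic_on h S \<Longrightarrow> T \<subseteq> S \<Longrightarrow> harmonic_on h T"
  unfolding harmonic_on_def by blast

lemma harmonic_on_const: "harmonic_on (\<lambda>x. c) S"
  unfolding harmonic_on_def
  by (auto intro!: exI[of _ 1] exI[of _ "\<lambda>z. complex_of_real c"])

lemma harmonic_on_cong:
  assumes "harmonic_on h S" "open S" "\<And>x. x \<in> S \<Longrightarrow> h x = h' x"
  shows "harmonic_on h' S"
  unfolding harmonic_on_def
proof
  fix x assume x: "x \<in> S"
  obtain r F where r: "r > 0" "F holomorphic_on ball (cx x) r" "\<And>y. y\<in>ball x r \<Longrightarrow> h y = Re (F (cx y))"
    using assms x unfolding harmonic_on_def by metis
  obtain e where e: "e > 0" "ball x e \<subseteq> S"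
    using assms x open_contains_ball by blast
  have "F holomorphic_on ball (cx x) (min r e)"
    using r(2) by (rule holomorphic_on_subset) auto
  then show "\<exists>r>0. \<exists>F. F holomorphic_on ball (cx x) r \<and> (\<forall>y\<in>ball x r. h' y = Re (F (cx y)))"
    using r e assms(3) by (intro exI[of _ "min r e"] exI[of _ F] conjI) (force simp: subset_eq)+
qed

lemma harmonic_on_add:
  assumes "harmonic_on h S" "harmonic_on k S"
  shows "harmonic_on (\<lambda>x. h x + k x) S"
  unfolding harmonic_on_def
proof
  fix x assume x: "x \<in> S"
  obtain r F where r: "r > 0" "F holomorphic_on ball (cx x) r" "\<And>y. y\<in>ball x r \<Longrightarrow> h y = Re (F (cx y))"
    using assms x unfolding harmonic_on_def by metis
  obtain s E where s: "s > 0" "E holomorphic_on ball (cx x) s" "\<And>y. y\<in>ball x s \<Longrightarrow> k y = Re (E (cx y))"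
    using assms x unfolding harmonic_on_def by metis
  have "F holomorphic_on ball (cx x) (min r s)" "E holomorphic_on ball (cx x) (min r s)"
    using r(2) s(2) by (auto elim!: holomorphic_on_subset)
  then show "\<exists>r>0. \<exists>F. F holomorphic_on ball (cx x) r \<and> (\<forall>y\<in>ball x r. h y + k y = Re (F (cx y)))"
    using r s by (intro exI[of _ "min r s"] exI[of _ "\<lambda>z. F z + E z"] conjI) (auto intro!: holomorphic_intros)
qed

lemma harmonic_on_cmult:
  assumes "harmonic_on h S"
  shows "harmonic_on (\<lambda>x. c * h x) S"
  unfolding harmonic_on_def
proof
  fix x assume x: "x \<in> S"
  obtain r F where r: "r > 0" "F holomorphic_on ball (cx x) r" "\<And>y. y\<in>ball x r \<Longrightarrow> h y = Re (F (cx y))"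
    using assms x unfolding harmonic_on_def by metis
  then show "\<exists>r>0. \<exists>F. F holomorphic_on ball (cx x) r \<and> (\<forall>y\<in>ball x r. c * h y = Re (F (cx y)))"
    by (intro exI[of _ r] exI[of _ "\<lambda>z. of_real c * F z"] conjI) (auto intro!: holomorphic_intros)
qed

lemma harmonic_on_diff: "harmonic_on h S \<Longrightarrow> harmonic_on k S \<Longrightarrow> harmonic_on (\<lambda>x. h x - k x) S"
  using harmonic_on_add[of h S "\<lambda>x. (-1) * k x"] harmonic_on_cmult[of k S "-1"] by simp

lemma harmonic_on_minus: "harmonic_on h S \<Longrightarrow> harmonic_on (\<lambda>x. - h x) S"
  using harmonic_on_cmult[of h S "-1"] by simp

lemma harmonic_on_translate:
  assumes "harmonic_on h S"
  shows "harmonic_on (\<lambda>x. h (x + a)) {x. x + a \<in> S}"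
  unfolding harmonic_on_def
proof
  fix x assume "x \<in> {x. x + a \<in> S}"
  then obtain r F where r: "r > 0" "F holomorphic_on ball (cx (x + a)) r" "\<And>y. y\<in>ball (x + a) r \<Longrightarrow> h y = Re (F (cx y))"
    using assms unfolding harmonic_on_def by blast
  have "(F \<circ> (\<lambda>z. z + cx a)) holomorphic_on ball (cx x) r"
    by (rule holomorphic_on_compose_gen[OF _ r(2)])
       (auto intro!: holomorphic_intros simp: cx_arith dist_norm)
  then show "\<exists>r>0. \<exists>F. F holomorphic_on ball (cx x) r \<and> (\<forall>y\<in>ball x r. h (y + a) = Re (F (cx y)))"
    using r by (intro exI[of _ r] exI[of _ "F \<circ> (\<lambda>z. z + cx a)"]) (auto simp: cx_arith dist_norm)
qed

text \<open>Rotating and scaling by \<open>w\<close>, the position of \<open>x\<close> relative to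
  \<open>a\<close>, moves the ball of radius \<open>dist x a\<close> into the right half-plane,
  where the principal logarithm is holomorphic.\<close>

lemma harmonic_on_ln_dist: "harmonic_on (\<lambda>x. ln (dist x a)) (- {a})"
  unfolding harmonic_on_def
proof
  fix x assume x: "x \<in> - {a}"
  define w where "w = cx x - cx a"
  have w: "w \<noteq> 0" "norm w = dist x a"
    using x by (auto simp: w_def dist_norm simp flip: cx_arith dist_cx) (metis eq_iff_diff_eq_0 vc_cx)
  define F where "F z = Ln ((z - cx a) / w) + of_real (ln (dist x a))" for z
  have pos: "Re ((z - cx a) / w) > 0" if "z \<in> ball (cx x) (dist x a)" for z
  proof -
    have "(z - cx a) / w = 1 + (z - cx x) / w"
      using w(1) by (simp add: w_def field_simps)
    moreover have "norm ((z - cx x) / w) < 1"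
      using that w x by (auto simp: norm_divide dist_norm norm_minus_commute)
    ultimately show ?thesis
      using abs_Re_le_cmod[of "(z - cx x) / w"] by simp
  qed
  show "\<exists>r>0. \<exists>F. F holomorphic_on ball (cx x) r \<and> (\<forall>y\<in>ball x r. ln (dist y a) = Re (F (cx y)))"
  proof (intro exI conjI ballI)
    show "dist x a > 0" using x by simp
    show "F holomorphic_on ball (cx x) (dist x a)"
      unfolding F_def
      by (intro holomorphic_intros) (use w pos complex_nonpos_Reals_iff in force)+
    fix y assume y: "y \<in> ball x (dist x a)"
    then have "y \<noteq> a" by auto
    then have ya: "norm (cx y - cx a) = dist y a" "cx y \<noteq> cx a"
      by (metis cx_arith(2) dist_norm norm_cx, metis vc_cx)
    have "Re (Ln ((cx y - cx a) / w)) = ln (dist y a / dist x a)"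
      using ya w by (simp add: norm_divide)
    then show "ln (dist y a) = Re (F (cx y))"
      using ya x \<open>y \<noteq> a\<close> by (simp add: F_def ln_div)
  qed
qed


text \<open>The Hessian is symmetric with trace \<open>c\<close>. Subtracting \<open>c / 2\<close>
  times the identity makes it trace-free, and a symmetric trace-free Jacobian is exactly the
  Cauchy-Riemann system for the conjugated field.\<close>

lemma holomorphic_on_cnj_gradient:
  assumes S: "open S" and h: "Ck_on 2 h S" and lap: "\<And>x. x \<in> S \<Longrightarrow> laplacian h x = c"
  shows "(\<lambda>z. cnj (cx (grad h (vc z) - (c / 2) *\<^sub>R vc z))) holomorphic_on cx ` S"
    (is "?f holomorphic_on _")
  unfolding holomorphic_on_def
proof
  fix z assume "z \<in> cx ` S"
  then obtain x where x: "x \<in> S" "z = cx x" by auto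
  let ?e1 = "axis 1 1 :: real^2" and ?e2 = "axis 2 1 :: real^2"
  have grad2: "grad h y $ 1 = partial ?e1 h y" "grad h y $ 2 = partial ?e2 h y" for y
    by (simp_all add: grad_def Basis_vec2 axis_eq_axis) (simp_all add: axis_def)
  have f_eq: "?f = (\<lambda>z. Complex (partial ?e1 h (vc z) - c / 2 * Re z) (- (partial ?e2 h (vc z) - c / 2 * Im z)))"
    by (auto simp: grad2 complex_eq_iff)
  have d: "GDERIV (partial b h) x :> grad (partial b h) x" if "b \<in> Basis" for b
    using h x that by (intro GDERIV_grad) (auto simp: numeral_2_eq_2)
  let ?a = "partial ?e1 (partial ?e1 h) x - c / 2" and ?b = "partial ?e2 (partial ?e1 h) x"
  have comm: "partial ?e1 (partial ?e2 h) x = ?b"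
    by (rule partial_commute[OF S x(1) _ _ h]) (auto simp: Basis_vec2)
  have lap': "partial ?e2 (partial ?e2 h) x = c - partial ?e1 (partial ?e1 h) x"
    using lap[OF x(1)] by (simp add: laplacian_def Basis_vec2 axis_eq_axis)
  have g: "v \<bullet> grad (partial b h) x = v$1 * partial ?e1 (partial b h) x + v$2 * partial ?e2 (partial b h) x" for v b
    by (simp add: grad_def Basis_vec2 axis_eq_axis inner_add_right inner_axis)
  have D: "((\<lambda>z. partial b h (vc z)) has_derivative (\<lambda>v. vc v \<bullet> grad (partial b h) x)) (at z)" if "b \<in> Basis" for b
    using has_derivative_compose[OF has_derivative_vc, of "partial b h" "\<lambda>v. v \<bullet> grad (partial b h) x" z] d[OF that] x(2)
    by (simp add: gderiv_def)
  have "(?f has_derivative (\<lambda>v. Complex (vc v \<bullet> grad (partial ?e1 h) x - c / 2 * Re v) (- (vc v \<bullet> grad (partial ?e2 h) x - c / 2 * Im v)))) (at z)"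
    unfolding f_eq Complex_eq
    by (auto intro!: derivative_eq_intros D simp: Basis_vec2)
  moreover have "(\<lambda>v. Complex (vc v \<bullet> grad (partial ?e1 h) x - c / 2 * Re v) (- (vc v \<bullet> grad (partial ?e2 h) x - c / 2 * Im v))) = (*) (Complex ?a (- ?b))"
    by (auto simp: fun_eq_iff complex_eq_iff g comm lap' algebra_simps)
  ultimately have "(?f has_field_derivative Complex ?a (- ?b)) (at z)"
    by (simp add: has_field_derivative_def)
  then show "?f field_differentiable at z within cx ` S"
    using field_differentiable_def field_differentiable_at_within by blast
qed

lemma image_cx_ball: "cx ` ball x r = ball (cx x) r"
proof -
  have "y \<in> cx ` ball x r" if "dist (cx x) y < r" for y
    using that by (intro image_eqI[of _ _ "vc y"]) (simp_all flip: dist_cx)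
  then show ?thesis by auto
qed

lemma inner_eq_Re_cnj: "v \<bullet> w = Re (cnj (cx w) * cx v)"
  by (simp add: inner_vec2 algebra_simps)

lemma GDERIV_Re_holomorphic:
  assumes "(F has_field_derivative F') (at (cx y))"
  shows "GDERIV (\<lambda>y. Re (F (cx y))) y :> vc (cnj F')"
proof -
  have "((\<lambda>y. F (cx y)) has_derivative (\<lambda>v. F' * cx v)) (at y)"
    using has_derivative_compose[OF has_derivative_cx, of F "(*) F'" y] assms
    by (simp add: has_field_derivative_def)
  then have "((\<lambda>y. Re (F (cx y))) has_derivative (\<lambda>v. Re (F' * cx v))) (at y)"
    by (rule has_derivative_Re)
  then show ?thesis
    by (simp add: gderiv_def inner_eq_Re_cnj)
qed

text \<open>The real part of a primitive of \<open>f\<close> has the same gradient as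
  \<open>k\<close> on a convex set, so the two differ by a real constant, which is absorbed into the
  primitive.\<close>

lemma holomorphic_gradient_primitive:
  assumes R: "R > 0" and f: "f holomorphic_on ball (cx x) R"
    and k: "\<And>y. y \<in> ball x R \<Longrightarrow> GDERIV k y :> vc (cnj (f (cx y)))"
  obtains F where "\<And>z. z \<in> ball (cx x) R \<Longrightarrow> (F has_field_derivative f z) (at z)"
    and "\<And>y. y \<in> ball x R \<Longrightarrow> k y = Re (F (cx y))"
proof -
  obtain g where g: "\<And>z. z \<in> ball (cx x) R \<Longrightarrow> (g has_field_derivative f z) (at z within ball (cx x) R)"
    using holomorphic_convex_primitive'[OF convex_ball open_ball f] by metis
  then have g': "\<And>z. z \<in> ball (cx x) R \<Longrightarrow> (g has_field_derivative f z) (at z)"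
    by (metis at_within_open open_ball)
  have "((\<lambda>y. k y - Re (g (cx y))) has_derivative (\<lambda>v. 0)) (at y within ball x R)" if "y \<in> ball x R" for y
  proof -
    have "GDERIV (\<lambda>y. Re (g (cx y))) y :> vc (cnj (f (cx y)))"
      by (rule GDERIV_Re_holomorphic) (use that g' in auto)
    then have "((\<lambda>y. k y - Re (g (cx y))) has_derivative (\<lambda>v. v \<bullet> vc (cnj (f (cx y))) - v \<bullet> vc (cnj (f (cx y))))) (at y)"
      using k[OF that] unfolding gderiv_def by (rule has_derivative_diff[rotated])
    then show ?thesis
      by (simp add: has_derivative_at_withinI)
  qed
  then have "\<exists>c. \<forall>y\<in>ball x R. k y - Re (g (cx y)) = c"
    by (intro has_derivative_zero_constant convex_ball)
  then obtain c where c: "\<And>y. y \<in> ball x R \<Longrightarrow> k y - Re (g (cx y)) = c"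
    by blast
  show thesis
  proof
    show "((\<lambda>z. g z + of_real c) has_field_derivative f z) (at z)" if "z \<in> ball (cx x) R" for z
      using g'[OF that] by (auto intro!: derivative_eq_intros)
    show "k y = Re (g (cx y) + of_real c)" if "y \<in> ball x R" for y
      using c[OF that] by simp
  qed
qed

text \<open>In the plane \<bar>x\<bar>^2 / 4 has Laplacian 1. The case \<open>c = 0\<close> serves
  the regular part of the Green function, \<open>c = -1\<close> the torsion function.\<close>

lemma harmonic_on_laplacian_const:
  assumes S: "open S" and h: "Ck_on 2 h S" and lap: "\<And>x. x \<in> S \<Longrightarrow> laplacian h x = c"
  shows "harmonic_on (\<lambda>x. h x - c / 4 * (norm x)\<^sup>2) S"
  unfolding harmonic_on_def
proof
  fix x assume "x \<in> S"
  then obtain r where r: "r > 0" "ball x r \<subseteq> S"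
    using S open_contains_ball by blast
  let ?f = "\<lambda>z. cnj (cx (grad h (vc z) - (c / 2) *\<^sub>R vc z))"
  have f: "?f holomorphic_on ball (cx x) r"
    using holomorphic_on_cnj_gradient[OF S h lap] by (rule holomorphic_on_subset) (use r in \<open>auto simp flip: image_cx_ball\<close>)
  have "GDERIV (\<lambda>x. h x - c / 4 * (norm x)\<^sup>2) y :> vc (cnj (?f (cx y)))" if "y \<in> ball x r" for y
  proof -
    have "GDERIV h y :> grad h y"
      using h that r(2) by (intro GDERIV_grad) (auto simp: numeral_2_eq_2)
    then show ?thesis
      unfolding gderiv_def power2_norm_eq_inner
      by (auto intro!: derivative_eq_intros simp: inner_diff_right inner_commute)
  qed
  from holomorphic_gradient_primitive[OF r(1) f this]
  obtain F where F: "\<And>z. z \<in> ball (cx x) r \<Longrightarrow> (F has_field_derivative ?f z) (at z)"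
    "\<And>y. y \<in> ball x r \<Longrightarrow> h y - c / 4 * (norm y)\<^sup>2 = Re (F (cx y))" by metis
  have "F holomorphic_on ball (cx x) r"
    using F(1) holomorphic_on_open by blast
  then show "\<exists>r>0. \<exists>F. F holomorphic_on ball (cx x) r \<and> (\<forall>y\<in>ball x r. h y - c / 4 * (norm y)\<^sup>2 = Re (F (cx y)))"
    using F(2) r(1) by blast
qed

lemma harmonic_on_local:
  assumes "harmonic_on h S" "x \<in> S"
  obtains r F where "r > 0" "F holomorphic_on ball (cx x) r" "\<And>y. y \<in> ball x r \<Longrightarrow> h y = Re (F (cx y))"
    "\<And>y. y \<in> ball x r \<Longrightarrow> GDERIV h y :> vc (cnj (deriv F (cx y)))"
proof -
  obtain r F where r: "r > 0" "F holomorphic_on ball (cx x) r" "\<And>y. y\<in>ball x r \<Longrightarrow> h y = Re (F (cx y))"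
    using assms unfolding harmonic_on_def by metis
  have "GDERIV h y :> vc (cnj (deriv F (cx y)))" if y: "y \<in> ball x r" for y
  proof (rule GDERIV_cong_open[OF _ open_ball y])
    show "GDERIV (\<lambda>y. Re (F (cx y))) y :> vc (cnj (deriv F (cx y)))"
      by (rule GDERIV_Re_holomorphic, rule holomorphic_derivI[OF r(2) open_ball]) (use y in auto)
  qed (use r in auto)
  with r that show thesis by blast
qed

lemma harmonic_on_GDERIV:
  assumes "harmonic_on h S" "x \<in> S"
  shows "GDERIV h x :> grad h x"
  using harmonic_on_local[OF assms] GDERIV_imp_grad by (metis centre_in_ball)

lemma harmonic_on_isCont: "harmonic_on h S \<Longrightarrow> x \<in> S \<Longrightarrow> isCont h x"
  using harmonic_on_GDERIV unfolding gderiv_def by (metis has_derivative_continuous)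

lemma harmonic_on_isCont_grad:
  assumes "harmonic_on h S" "x \<in> S"
  shows "isCont (grad h) x"
proof -
  obtain r F where r: "r > 0" "F holomorphic_on ball (cx x) r"
    "\<And>y. y \<in> ball x r \<Longrightarrow> GDERIV h y :> vc (cnj (deriv F (cx y)))"
    using harmonic_on_local[OF assms] by metis
  have eq: "grad h y = vc (cnj (deriv F (cx y)))" if "y \<in> ball x r" for y
    using r(3)[OF that] GDERIV_imp_grad by blast
  have "continuous_on (ball (cx x) r) (deriv F)"
    using r(2) by (intro holomorphic_on_imp_continuous_on holomorphic_deriv) auto
  then have c: "isCont (deriv F) (cx x)"
    using r(1) by (simp add: continuous_on_eq_continuous_at)
  have "isCont (\<lambda>y. vc (cnj (deriv F (cx y)))) x"
    by (intro bounded_linear.isCont[OF bounded_linear_vc] isCont_o2[where f=cx and g="deriv F"] c isCont_cnj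
         bounded_linear.isCont[OF bounded_linear_cx] continuous_ident)
  moreover have "eventually (\<lambda>y. grad h y = vc (cnj (deriv F (cx y)))) (nhds x)"
    using eventually_nhds_in_open[OF open_ball, of x x r] r(1)
    by (auto elim!: eventually_mono simp: eq)
  ultimately show ?thesis
    by (simp add: isCont_cong)
qed

section \<open>Holomorphic representatives on whole balls and the interior gradient estimate\<close>

text \<open>Local representatives need not fit together, but all their derivatives equal the
  conjugated gradient. That function is therefore holomorphic on the whole ball and has a primitive
  there.\<close>

lemma harmonic_on_ball_primitive:
  assumes R: "R > 0" and h: "harmonic_on h (ball x R)"
  obtains F where "F holomorphic_on ball (cx x) R" "\<And>y. y \<in> ball x R \<Longrightarrow> h y = Re (F (cx y))"
    "\<And>y. y \<in> ball x R \<Longrightarrow> grad h y = vc (cnj (deriv F (cx y)))"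
proof -
  let ?f = "\<lambda>z. cnj (cx (grad h (vc z)))"
  have f: "?f holomorphic_on ball (cx x) R"
    unfolding holomorphic_on_def
  proof
    fix z assume z: "z \<in> ball (cx x) R"
    let ?y = "vc z"
    have y: "?y \<in> ball x R" using z by (simp flip: dist_cx)
    obtain r F where r: "r > 0" "F holomorphic_on ball (cx ?y) r"
      "\<And>u. u \<in> ball ?y r \<Longrightarrow> GDERIV h u :> vc (cnj (deriv F (cx u)))"
      using harmonic_on_local[OF h y] by metis
    have eq: "?f w = deriv F w" if "w \<in> ball z r" for w
    proof -
      have "vc w \<in> ball ?y r" using that by simp
      then have "grad h (vc w) = vc (cnj (deriv F w))" using r(3)[of "vc w"] GDERIV_imp_grad by simp
      then show ?thesis by simp
    qed
    have "deriv F holomorphic_on ball z r"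
      using r(2) by (intro holomorphic_deriv) auto
    then have "?f holomorphic_on ball z r"
      by (rule holomorphic_transform) (simp add: eq)
    then show "?f field_differentiable at z within ball (cx x) R"
      using r(1) by (meson centre_in_ball field_differentiable_at_within holomorphic_on_imp_differentiable_at open_ball)
  qed
  have g: "GDERIV h y :> vc (cnj (?f (cx y)))" if "y \<in> ball x R" for y
    using harmonic_on_GDERIV[OF h that] by simp
  obtain F where F: "\<And>z. z \<in> ball (cx x) R \<Longrightarrow> (F has_field_derivative ?f z) (at z)"
    "\<And>y. y \<in> ball x R \<Longrightarrow> h y = Re (F (cx y))"
    using holomorphic_gradient_primitive[OF R f g] by metis
  show thesis
  proof
    show "F holomorphic_on ball (cx x) R" using F(1) holomorphic_on_open by blast
    show "h y = Re (F (cx y))" if "y \<in> ball x R" for y using F(2) that .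
    show "grad h y = vc (cnj (deriv F (cx y)))" if "y \<in> ball x R" for y
      using DERIV_imp_deriv[OF F(1)[of "cx y"]] that by simp
  qed
qed

text \<open>Only the real part of \<open>F\<close> is controlled, so the Cauchy inequality is
  applied to exp (F / M), whose modulus lies between 1 / e and e. Returning to \<open>F\<close>
  costs e twice and the radius \<open>R / 2\<close> costs a factor 2; with e^2 at most 8 this is the
  16.\<close>

lemma harmonic_gradient_estimate:
  assumes R: "R > 0" and M: "M > 0" and h: "harmonic_on h (ball x R)"
    and bnd: "\<And>y. y \<in> ball x R \<Longrightarrow> \<bar>h y\<bar> \<le> M"
  shows "norm (grad h x) \<le> 16 * M / R"
proof -
  obtain F where F: "F holomorphic_on ball (cx x) R" "\<And>y. y \<in> ball x R \<Longrightarrow> h y = Re (F (cx y))"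
    "\<And>y. y \<in> ball x R \<Longrightarrow> grad h y = vc (cnj (deriv F (cx y)))"
    using harmonic_on_ball_primitive[OF R h] by metis
  let ?z = "cx x"
  define g where "g z = exp (F z / of_real M)" for z
  have holg: "g holomorphic_on ball ?z R"
    unfolding g_def using F(1) M by (auto intro!: holomorphic_intros)
  have ReF: "\<bar>Re (F z)\<bar> \<le> M" if "z \<in> ball ?z R" for z
    using bnd[of "vc z"] F(2)[of "vc z"] that by (simp flip: dist_cx)
  have normg: "norm (g z) = exp (Re (F z) / M)" for z
    by (simp add: g_def)
  have "norm ((deriv ^^ 1) g ?z) \<le> fact 1 * exp 1 / (R / 2) ^ 1"
  proof (rule Cauchy_inequality)
    show "g holomorphic_on ball ?z (R / 2)"
      using holg by (rule holomorphic_on_subset) (use R in auto)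
    show "continuous_on (cball ?z (R / 2)) g"
      using holomorphic_on_imp_continuous_on[OF holg] by (rule continuous_on_subset) (use R in auto)
    show "0 < R / 2" using R by simp
    fix z assume "norm (?z - z) = R / 2"
    then have "Re (F z) \<le> M" using ReF[of z] R by (simp add: dist_norm)
    then show "norm (g z) \<le> exp 1" using M by (simp add: normg)
  qed
  then have 1: "norm (deriv g ?z) \<le> 2 * exp 1 / R"
    by (simp add: mult.commute)
  have "(F has_field_derivative deriv F ?z) (at ?z)"
    by (rule holomorphic_derivI[OF F(1) open_ball]) (use R in auto)
  then have "(g has_field_derivative g ?z * (deriv F ?z / of_real M)) (at ?z)"
    unfolding g_def using M by (auto intro!: derivative_eq_intros simp: field_simps)
  then have "deriv g ?z = g ?z * (deriv F ?z / of_real M)"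
    by (rule DERIV_imp_deriv)
  then have 2: "norm (deriv g ?z) = norm (g ?z) * (norm (deriv F ?z) / M)"
    using M by (simp add: norm_mult norm_divide)
  have "Re (F ?z) \<ge> - M" using ReF[of ?z] R by simp
  then have "exp (-1) \<le> norm (g ?z)"
    using M by (simp add: normg field_simps)
  then have "exp (-1) * (norm (deriv F ?z) / M) \<le> 2 * exp 1 / R"
    using 1 2 M by (smt (verit) divide_nonneg_pos mult_right_mono norm_ge_zero)
  then have 3: "norm (deriv F ?z) \<le> exp 1 * exp 1 * (2 * M / R)"
    using M R by (simp add: exp_minus field_simps)
  have "exp 1 * exp 1 \<le> (8::real)"
  proof -
    have "exp (1::real) \<le> 2.8"
      using e_less_272 by simp
    then have "exp (1::real) * exp 1 \<le> 2.8 * 2.8"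
      by (intro mult_mono) auto
    then show ?thesis by simp
  qed
  then have "exp 1 * exp 1 * (2 * M / R) \<le> 8 * (2 * M / R)"
    using M R by (intro mult_right_mono) auto
  with 3 have "norm (deriv F ?z) \<le> 16 * M / R"
    by simp
  moreover have "norm (grad h x) = norm (deriv F ?z)"
    using F(3)[of x] R by simp
  ultimately show ?thesis by simp
qed

subsection \<open>Circular means\<close>

definition circ :: "real^2 \<Rightarrow> real \<Rightarrow> real \<Rightarrow> real^2" where
  "circ x r t = x + r *\<^sub>R vc (cis (2 * pi * t))"

lemma cx_circ: "cx (circ x r t) = circlepath (cx x) r t"
  by (simp add: circ_def cx_arith circlepath cis_conv_exp mult_ac flip: scaleR_conv_of_real)

lemma dist_circ: "r \<ge> 0 \<Longrightarrow> dist x (circ x r t) = r"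
  by (simp add: circ_def dist_norm)

lemma continuous_circ [continuous_intros]: "continuous_on T (circ x r)"
  unfolding circ_def by (intro continuous_intros bounded_linear.continuous_on[OF bounded_linear_vc])

text \<open>A relation built on \<open>has_integral\<close>, not a function: existence of the mean
  is part of the claim, and sums or differences of means carry no integrability side
  conditions.\<close>

definition circ_mean :: "(real^2 \<Rightarrow> real) \<Rightarrow> real^2 \<Rightarrow> real \<Rightarrow> real \<Rightarrow> bool" where
  "circ_mean w x r m \<longleftrightarrow> ((\<lambda>t. w (circ x r t)) has_integral m) {0..1}"

text \<open>This is the real part of Cauchy's integral formula, whose contour integral becomes the
  average over the parameter interval after division by 2 pi i.\<close>

lemma harmonic_circ_mean:
  assumes r: "0 < r" "r < R" and h: "harmonic_on h (ball x R)"
  shows "circ_mean h x r (h x)"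
proof -
  obtain F where F: "F holomorphic_on ball (cx x) R" "\<And>y. y \<in> ball x R \<Longrightarrow> h y = Re (F (cx y))"
    using harmonic_on_ball_primitive[OF _ h] r by (metis less_trans)
  have "F holomorphic_on cball (cx x) r"
    using F(1) by (rule holomorphic_on_subset) (use r in auto)
  from Cauchy_integral_circlepath_simple[OF this, of "cx x"] r
  have "((\<lambda>u. F u / (u - cx x)) has_contour_integral 2 * of_real pi * \<i> * F (cx x)) (circlepath (cx x) r)"
    by simp
  then have "((\<lambda>t. F (circlepath (cx x) r t) / (circlepath (cx x) r t - cx x) * (2 * pi * \<i> * r * exp (2 * of_real pi * \<i> * t)))
      has_integral 2 * of_real pi * \<i> * F (cx x)) {0..1}"
    by (simp add: has_contour_integral vector_derivative_circlepath)
  then have "((\<lambda>t. F (circlepath (cx x) r t) * (2 * pi * \<i>)) has_integral 2 * of_real pi * \<i> * F (cx x)) {0..1}"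
    by (rule has_integral_eq[rotated]) (use r in \<open>simp add: circlepath\<close>)
  from has_integral_mult_left[OF this, of "1 / (2 * pi * \<i>)"]
  have "((\<lambda>t. F (circlepath (cx x) r t)) has_integral F (cx x)) {0..1}"
    by simp
  from has_integral_linear[OF this bounded_linear_Re]
  have "((\<lambda>t. Re (F (circlepath (cx x) r t))) has_integral Re (F (cx x))) {0..1}"
    by (simp add: o_def)
  moreover have "Re (F (circlepath (cx x) r t)) = h (circ x r t)" for t
    using F(2)[of "circ x r t"] dist_circ[of r x t] r by (simp add: cx_circ)
  ultimately show ?thesis
    using F(2)[of x] r by (simp add: circ_mean_def)
qed

lemma circ_mean_diff: "circ_mean v x r m \<Longrightarrow> circ_mean w x r k \<Longrightarrow> circ_mean (\<lambda>x. v x - w x) x r (m - k)"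
  unfolding circ_mean_def by (rule has_integral_diff)

lemma circ_mean_add: "circ_mean v x r m \<Longrightarrow> circ_mean w x r k \<Longrightarrow> circ_mean (\<lambda>x. v x + w x) x r (m + k)"
  unfolding circ_mean_def by (rule has_integral_add)

lemma circ_mean_cmult: "circ_mean v x r m \<Longrightarrow> circ_mean (\<lambda>x. c * v x) x r (c * m)"
  unfolding circ_mean_def by (rule has_integral_mult_right)

section \<open>Maximum and minimum principles\<close>

text \<open>Take a maximum point with the largest first coordinate. If the maximum exceeded
  \<open>M\<close> this point would lie in \<open>U\<close>, and its mean value property would make
  a small circle about it consist of maximum points, among them \<open>circ y r 0\<close>, which
  lies further right. Only means over small circles enter, so the principle applies to functions
  about whose second derivatives nothing is known.\<close>

lemma maximum_principle_circ_mean: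
  assumes U: "open U" "bounded U" and cont: "continuous_on (closure U) w"
    and mv: "\<And>x. x \<in> U \<Longrightarrow> \<exists>R>0. \<forall>r. 0 < r \<longrightarrow> r < R \<longrightarrow> circ_mean w x r (w x)"
    and bnd: "\<And>x. x \<in> frontier U \<Longrightarrow> w x \<le> M"
    and x: "x \<in> closure U"
  shows "w x \<le> M"
proof (rule ccontr)
  assume "\<not> w x \<le> M"
  have K: "compact (closure U)" using U by simp
  have "closure U \<noteq> {}" using x by force
  then obtain z where z: "z \<in> closure U" "\<And>y. y \<in> closure U \<Longrightarrow> w y \<le> w z"
    using continuous_attains_sup[OF K _ cont] by auto
  have wz: "w z > M" using z(2)[OF x] \<open>\<not> w x \<le> M\<close> by simp
  define K' where "K' = closure U \<inter> w -` {w z}"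
  have "closed K'"
    unfolding K'_def by (intro continuous_closed_preimage cont) auto
  then have K': "compact K'" 
    using K by (metis K'_def bounded_subset compact_eq_bounded_closed inf_le1)
  have "K' \<noteq> {}" using z(1) by (auto simp: K'_def)
  then obtain y where y: "y \<in> K'" "\<And>u. u \<in> K' \<Longrightarrow> u $ 1 \<le> y $ 1"
    using continuous_attains_sup[OF K' _ continuous_on_component[OF continuous_on_id], of 1] by auto
  then have "y \<in> closure U" "w y = w z" by (auto simp: K'_def)
  then have "y \<in> U"
    using bnd[of y] wz U by (auto simp: frontier_def interior_open)
  then obtain R s where R: "R > 0" "\<And>r. 0 < r \<Longrightarrow> r < R \<Longrightarrow> circ_mean w y r (w y)" and s: "s > 0" "ball y s \<subseteq> U"
    using mv U(1) open_contains_ball by metis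
  define r where "r = min R s / 2"
  have r: "0 < r" "r < R" "r < s" using R s by (auto simp: r_def)
  have inU: "circ y r t \<in> U" for t
    using dist_circ[of r y t] r s by (auto simp: subset_eq)
  have "((\<lambda>t. w y - w (circ y r t)) has_integral (w y - w y)) {0..1}"
    using has_integral_diff[OF has_integral_const_real[of "w y" 0 1]] R(2)[OF r(1,2)] unfolding circ_mean_def by force
  then have 0: "((\<lambda>t. w y - w (circ y r t)) has_integral 0) (cbox 0 1)"
    by simp
  have "w y - w (circ y r 0) = 0"
  proof (rule has_integral_0_cbox_imp_0[OF _ _ 0])
    show "continuous_on (cbox 0 1) (\<lambda>t. w y - w (circ y r t))"
      by (intro continuous_intros continuous_on_compose2[OF cont]) (use inU closure_subset in force)
    show "0 \<le> w y - w (circ y r t)" if "t \<in> box 0 1" for t :: real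
      using z(2)[of "circ y r t"] inU[of t] closure_subset[of U] \<open>w y = w z\<close> by auto
  qed auto
  then have "circ y r 0 \<in> K'"
    using inU[of 0] closure_subset[of U] \<open>w y = w z\<close> by (auto simp: K'_def)
  from y(2)[OF this] r(1) show False
    by (simp add: circ_def)
qed

lemma harmonic_circ_mean_local:
  assumes "open U" "harmonic_on h U" "x \<in> U"
  shows "\<exists>R>0. \<forall>r. 0 < r \<longrightarrow> r < R \<longrightarrow> circ_mean h x r (h x)"
proof -
  obtain R where "R > 0" "ball x R \<subseteq> U"
    using assms open_contains_ball by blast
  then show ?thesis
    using harmonic_circ_mean harmonic_on_subset[OF assms(2)] by blast
qed

lemma harmonic_maximum_principle:
  assumes "open U" "bounded U" "continuous_on (closure U) h" "harmonic_on h U"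
    and "\<And>x. x \<in> frontier U \<Longrightarrow> h x \<le> M" "x \<in> closure U"
  shows "h x \<le> M"
  using maximum_principle_circ_mean[OF assms(1-3) harmonic_circ_mean_local[OF assms(1,4)] assms(5,6)] .

lemma harmonic_minimum_principle:
  assumes "open U" "bounded U" "continuous_on (closure U) h" "harmonic_on h U"
    and "\<And>x. x \<in> frontier U \<Longrightarrow> M \<le> h x" "x \<in> closure U"
  shows "M \<le> h x"
  using harmonic_maximum_principle[OF assms(1,2) _ harmonic_on_minus[OF assms(4)], of "- M" x] assms
  by (auto intro!: continuous_intros)

subsection \<open>Tangent balls\<close>

lemma orthogonal_transformation_axes:
  fixes T :: "real^2 \<Rightarrow> real^2"
  assumes "orthogonal_transformation T"
  obtains e1 e2 where "norm e1 = 1" "norm e2 = 1" "e1 \<bullet> e2 = 0"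
    "\<And>x. T x $ 1 = x \<bullet> e1" "\<And>x. T x $ 2 = x \<bullet> e2"
proof -
  have surj: "surj T" 
    using assms orthogonal_transformation_surj by blast
  obtain e1 e2 where e: "T e1 = axis 1 1" "T e2 = axis 2 1"
    using surj by (metis surjD)
  have inner: "T x \<bullet> T y = x \<bullet> y" for x y
    using assms by (simp add: orthogonal_transformation_def)
  have x1: "T x $ 1 = x \<bullet> e1" and x2: "T x $ 2 = x \<bullet> e2" for x
    using inner[of x e1] inner[of x e2] e by (simp_all add: inner_axis)
  show thesis
  proof
    show "norm e1 = 1" "norm e2 = 1"
      using orthogonal_transformation_norm[OF assms] e by (metis norm_axis_1)+
    show "e1 \<bullet> e2 = 0"
      using inner[of e1 e2] e by (simp add: inner_axis_axis)
    show "T x $ 1 = x \<bullet> e1" "T x $ 2 = x \<bullet> e2" for x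
      using x1 x2 by blast+
  qed
qed

text \<open>A second-order Taylor estimate by two mean value steps, for \<open>g\<close> and for
  \<open>g'\<close>; \<open>M\<close> bounds the second derivative on the compact interval.\<close>

lemma smooth_imp_quadratic_bound:
  fixes g :: "real \<Rightarrow> real"
  assumes g: "smooth g"
  obtains g' L M where "L \<ge> 0" "M \<ge> 0" 
    "\<And>s. s \<in> {a..b} \<Longrightarrow> \<bar>g' s\<bar> \<le> L"
    "\<And>s t. s \<in> {a..b} \<Longrightarrow> t \<in> {a..b} \<Longrightarrow> \<bar>g t - g s - g' s * (t - s)\<bar> \<le> M * (t - s)\<^sup>2"
proof -
  define g' where "g' = partial 1 g"
  define g'' where "g'' = partial 1 g'"
  have "Ck_on 2 g UNIV" using g by (simp add: smooth_def)
  then have d: "g differentiable (at t)" "g' differentiable (at t)" and c: "continuous_on UNIV g''" for t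
    by (simp_all add: numeral_2_eq_2 g'_def g''_def)
  have D: "(f has_real_derivative partial 1 f t) (at t)" if "f differentiable (at t)" for f :: "real \<Rightarrow> real" and t
  proof -
    have "GDERIV f (t - t + t *\<^sub>R 1) :> grad f t" using GDERIV_grad[OF that] by simp
    then show ?thesis
      using GDERIV_line[of f 0 t 1 "grad f t"] by (simp add: grad_def)
  qed
  have D1: "(g has_real_derivative g' t) (at t)" and D2: "(g' has_real_derivative g'' t) (at t)" for t
    using D[OF d(1)] D[OF d(2)] by (simp_all add: g'_def g''_def)
  have "bounded (g'' ` {a..b})"
    using compact_continuous_image[OF continuous_on_subset[OF c]] compact_imp_bounded by blast
  then obtain M where M: "\<And>t. t \<in> {a..b} \<Longrightarrow> \<bar>g'' t\<bar> \<le> M"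
    unfolding bounded_iff by (metis imageI real_norm_def)
  have "continuous_on {a..b} g'"
    using D2 by (meson DERIV_isCont continuous_at_imp_continuous_on)
  then have "bounded (g' ` {a..b})"
    using compact_continuous_image compact_imp_bounded by blast
  then obtain L where L: "\<And>t. t \<in> {a..b} \<Longrightarrow> \<bar>g' t\<bar> \<le> L"
    unfolding bounded_iff by (metis imageI real_norm_def)
  have quad: "\<bar>g t - g s - g' s * (t - s)\<bar> \<le> M * (t - s)\<^sup>2" if s: "s \<in> {a..b}" and t: "t \<in> {a..b}" for s t
  proof (cases "s = t")
    case False
    have mvt: "\<exists>z. z \<in> {a..b} \<and> \<bar>z - s\<bar> \<le> \<bar>r - s\<bar> \<and> f r - f s = f' z * (r - s)"
      if r: "r \<in> {a..b}" and f: "\<And>t. (f has_real_derivative f' t) (at t)" for r and f f' :: "real \<Rightarrow> real"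
    proof -
      consider "r < s" | "r = s" | "s < r" by linarith
      then show ?thesis
      proof cases
        case 1
        then obtain z where "r < z" "z < s" "f s - f r = (s - r) * f' z"
          using MVT2[of r s f f'] f by blast
        then show ?thesis using r s by (intro exI[of _ z]) (auto simp: algebra_simps)
      next
        case 3
        then obtain z where "s < z" "z < r" "f r - f s = (r - s) * f' z"
          using MVT2[of s r f f'] f by blast
        then show ?thesis using r s by (intro exI[of _ z]) (auto simp: algebra_simps)
      qed (use s in auto)
    qed
    obtain z where z: "z \<in> {a..b}" "\<bar>z - s\<bar> \<le> \<bar>t - s\<bar>" "g t - g s = g' z * (t - s)"
      using mvt[OF t D1] by blast
    obtain w where w: "w \<in> {a..b}" "g' z - g' s = g'' w * (z - s)"
      using mvt[OF z(1) D2] by blast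
    have "\<bar>g t - g s - g' s * (t - s)\<bar> = \<bar>g'' w\<bar> * \<bar>z - s\<bar> * \<bar>t - s\<bar>"
      using z(3) w(2) by (simp add: abs_mult[symmetric] left_diff_distrib[symmetric])
    also have "\<dots> \<le> M * \<bar>t - s\<bar> * \<bar>t - s\<bar>"
      using M[OF w(1)] z(2) by (intro mult_mono mult_right_mono) (auto intro: order_trans)
    finally show ?thesis by (simp add: power2_eq_square)
  qed auto
  \<comment> \<open>The maxima with 0 make the constants nonnegative even for an empty interval,
    where \<open>L\<close> and \<open>M\<close> are arbitrary.\<close>
  show thesis
    by (rule that[of "max L 0" "max M 0" g'])
      (use L in \<open>auto simp: le_max_iff_disj intro!: order_trans[OF quad] mult_right_mono\<close>)
qed

text \<open>In a chart the domain lies above a graph with a uniform quadratic Taylor remainder, so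
  balls of a fixed small radius touch it from both sides. \<open>e\<close> is the vertical axis of
  the chart and \<open>n\<close> the inner unit normal; bounded slope keeps their inner product
  above \<open>c\<close>, so one direction points uniformly inwards at all nearby boundary
  points.\<close>

lemma graph_tangent_balls:
  fixes D :: "(real^2) set"
  assumes D: "open D" and sb: "smooth_boundary D" and p: "p \<in> frontier D"
  obtains \<rho> R0 c e where "\<rho> > 0" "R0 > 0" "c > 0" "norm e = 1"
    "\<And>\<xi>. \<xi> \<in> frontier D \<Longrightarrow> \<xi> \<in> ball p \<rho> \<Longrightarrow> \<exists>n. norm n = 1 \<and> c \<le> n \<bullet> e \<and>
       (\<forall>R. 0 < R \<longrightarrow> R \<le> R0 \<longrightarrow> ball (\<xi> - R *\<^sub>R n) R \<inter> D = {} \<and> ball (\<xi> + R *\<^sub>R n) R \<subseteq> D)"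
    "\<And>x t. x \<in> closure D \<Longrightarrow> x \<in> ball p \<rho> \<Longrightarrow> 0 < t \<Longrightarrow> t < \<rho> \<Longrightarrow> x + t *\<^sub>R e \<in> D"
proof -
  obtain r and T :: "real^2 \<Rightarrow> real^2" and g where r: "r > 0" and T: "orthogonal_transformation T" and g: "smooth g"
    and Dr: "D \<inter> ball p r = {x \<in> ball p r. g (T x $ 1) < T x $ 2}"
    using sb[unfolded smooth_boundary_def, rule_format, OF p] by blast
  obtain e1 e2 where e: "norm e1 = 1" "norm e2 = 1" "e1 \<bullet> e2 = 0"
    and Te: "\<And>x. T x $ 1 = x \<bullet> e1" "\<And>x. T x $ 2 = x \<bullet> e2"
    by (rule orthogonal_transformation_axes[OF T]) (rule that)
  have Dr': "x \<in> D \<longleftrightarrow> g (x \<bullet> e1) < x \<bullet> e2" if "x \<in> ball p r" for x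
  proof -
    have "x \<in> D \<longleftrightarrow> x \<in> D \<inter> ball p r" using that by blast
    also have "\<dots> \<longleftrightarrow> x \<in> {x \<in> ball p r. g (T x $ 1) < T x $ 2}"
      by (simp only: Dr)
    also have "\<dots> \<longleftrightarrow> g (x \<bullet> e1) < x \<bullet> e2"
      using that Te(1)[of x] Te(2)[of x] by simp
    finally show ?thesis .
  qed
  have ee: "e1 \<bullet> e1 = 1" "e2 \<bullet> e2 = 1"
    using e by (simp_all add: norm_eq_1)
  let ?a = "p \<bullet> e1 - r" and ?b = "p \<bullet> e1 + r"
  obtain g' L M where LM: "L \<ge> 0" "M \<ge> 0" and L: "\<And>s. s \<in> {?a..?b} \<Longrightarrow> \<bar>g' s\<bar> \<le> L"
    and M: "\<And>s t. s \<in> {?a..?b} \<Longrightarrow> t \<in> {?a..?b} \<Longrightarrow> \<bar>g t - g s - g' s * (t - s)\<bar> \<le> M * (t - s)\<^sup>2"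
    by (rule smooth_imp_quadratic_bound[OF g, of ?a ?b]) (rule that)
  have "Ck_on 1 g UNIV" using g by (simp add: smooth_def)
  then have gcont: "continuous_on UNIV g"
    by (auto intro!: continuous_at_imp_continuous_on differentiable_imp_continuous_within)
  have in_ab: "x \<bullet> e1 \<in> {?a..?b}" if "x \<in> ball p r" for x
  proof -
    have "\<bar>(x - p) \<bullet> e1\<bar> \<le> norm (x - p)"
      using Cauchy_Schwarz_ineq2[of "x - p" e1] e by simp
    then show ?thesis using that by (auto simp: dist_norm norm_minus_commute inner_diff_left)
  qed
  have cl: "g (x \<bullet> e1) \<le> x \<bullet> e2" if "x \<in> closure D" "x \<in> ball p r" for x
  proof (rule ccontr)
    assume "\<not> g (x \<bullet> e1) \<le> x \<bullet> e2"
    have "open {x. x \<bullet> e2 < g (x \<bullet> e1)}"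
      by (intro open_Collect_less continuous_intros continuous_on_compose2[OF gcont]) auto
    then have W: "open (ball p r \<inter> {x. x \<bullet> e2 < g (x \<bullet> e1)})" (is "open ?W")
      by (intro open_Int open_ball)
    have "x \<in> ?W \<inter> closure D"
      using that \<open>\<not> _\<close> by auto
    then have "?W \<inter> D \<noteq> {}"
      using open_Int_closure_eq_empty[OF W, of D] by auto
    then obtain y where "y \<in> D" "y \<in> ball p r" "y \<bullet> e2 < g (y \<bullet> e1)"
      by blast
    then show False using Dr' by force
  qed
  have fr: "g (x \<bullet> e1) = x \<bullet> e2" if "x \<in> frontier D" "x \<in> ball p r" for x
    using cl[of x] Dr'[of x] that D by (auto simp: frontier_def interior_open)
  \<comment> \<open>\<open>r / 8\<close> keeps the tangent balls at points of
    \<open>ball p (r / 2)\<close> inside the chart; \<open>1 / (2 * M + 1)\<close> gives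
    \<open>R0 * (2 * M) \<le> 1\<close>, with the summand 1 guarding against
    \<open>M = 0\<close>.\<close>
  define R0 where "R0 = min (r / 8) (1 / (2 * M + 1))"
  have R0: "R0 > 0" "R0 \<le> r / 8" "R0 * (2 * M) \<le> 1"
    using r LM by (auto simp: R0_def min_def field_simps)
  show thesis
  proof
    show "r / 2 > 0" "R0 > 0" "1 / sqrt (1 + L\<^sup>2) > 0" "norm e2 = 1"
      using r R0 e by (auto simp: add_pos_nonneg)
    show "x + t *\<^sub>R e2 \<in> D" if "x \<in> closure D" "x \<in> ball p (r / 2)" "0 < t" "t < r / 2" for x t
    proof -
      have "dist p (x + t *\<^sub>R e2) \<le> dist p x + norm (t *\<^sub>R e2)"
        by (metis add_diff_cancel_left' dist_norm dist_triangle norm_minus_commute)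
      then have "x + t *\<^sub>R e2 \<in> ball p r" using that e by auto
      moreover have "x \<in> ball p r" using that by auto
      ultimately show ?thesis
        using cl[of x] Dr' that e by (auto simp: inner_add_left inner_commute[of e2] dot_square_norm)
    qed
    fix \<xi> assume \<xi>: "\<xi> \<in> frontier D" "\<xi> \<in> ball p (r / 2)"
    let ?s = "\<xi> \<bullet> e1"
    define N where "N = sqrt (1 + (g' ?s)\<^sup>2)"
    have N: "N \<ge> 1" by (simp add: N_def)
    define n where "n = (1 / N) *\<^sub>R (e2 - g' ?s *\<^sub>R e1)"
    have \<xi>r: "\<xi> \<in> ball p r" using \<xi> r by auto
    have s_ab: "?s \<in> {?a..?b}" using in_ab[OF \<xi>r] .
    have "(norm (e2 - g' ?s *\<^sub>R e1))\<^sup>2 = 1 + (g' ?s)\<^sup>2"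
      unfolding power2_norm_eq_inner
      using e ee by (simp add: inner_diff_left inner_diff_right inner_commute power2_eq_square)
    then have "norm (e2 - g' ?s *\<^sub>R e1) = N"
      using N_def by (metis norm_ge_zero real_sqrt_abs abs_of_nonneg)
    then have n1: "norm n = 1" using N by (simp add: n_def)
    have ne: "1 / sqrt (1 + L\<^sup>2) \<le> n \<bullet> e2"
    proof -
      have "N \<le> sqrt (1 + L\<^sup>2)"
        using L[OF s_ab] by (simp add: N_def abs_le_square_iff[symmetric])
      then show ?thesis
        using N e by (simp add: n_def inner_diff_left dot_square_norm frac_le)
    qed
    \<comment> \<open>Divided by \<open>N\<close>, the height above the graph agrees with the signed
      distance to the tangent line at \<xi> up to a quadratic error.\<close>
    have zn: "\<bar>(g (y \<bullet> e1) - y \<bullet> e2) / N + (y - \<xi>) \<bullet> n\<bar> \<le> M * (norm (y - \<xi>))\<^sup>2" if y: "y \<in> ball p r" for y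
    proof -
      have "(y - \<xi>) \<bullet> n = ((y \<bullet> e2 - g ?s) - g' ?s * (y \<bullet> e1 - ?s)) / N"
        using fr[OF \<xi>(1) \<xi>r] N by (simp add: n_def inner_diff_left inner_diff_right field_simps)
      then have "(g (y \<bullet> e1) - y \<bullet> e2) / N + (y - \<xi>) \<bullet> n = (g (y \<bullet> e1) - g ?s - g' ?s * (y \<bullet> e1 - ?s)) / N"
        by (simp add: add_divide_distrib[symmetric] algebra_simps)
      then have "\<bar>(g (y \<bullet> e1) - y \<bullet> e2) / N + (y - \<xi>) \<bullet> n\<bar> = \<bar>g (y \<bullet> e1) - g ?s - g' ?s * (y \<bullet> e1 - ?s)\<bar> / N"
        using N by simp
      also have "\<dots> \<le> \<bar>g (y \<bullet> e1) - g ?s - g' ?s * (y \<bullet> e1 - ?s)\<bar>"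
        using N by (simp add: divide_le_eq mult_le_cancel_left1)
      also have "\<dots> \<le> M * (y \<bullet> e1 - ?s)\<^sup>2"
        using M[OF s_ab in_ab[OF y]] .
      also have "\<dots> \<le> M * (norm (y - \<xi>))\<^sup>2"
      proof -
        have "\<bar>(y - \<xi>) \<bullet> e1\<bar> \<le> norm (y - \<xi>)"
          using Cauchy_Schwarz_ineq2[of "y - \<xi>" e1] e by simp
        then have "(y \<bullet> e1 - ?s)\<^sup>2 \<le> (norm (y - \<xi>))\<^sup>2"
          by (metis abs_le_square_iff abs_norm_cancel inner_diff_left)
        then show ?thesis using LM by (intro mult_left_mono) auto
      qed
      finally show ?thesis .
    qed
    \<comment> \<open>Expanding the square: inside a ball tangent at \<xi> the squared distance to
      \<xi> is controlled by the normal component. The sign \<sigma> treats inner and outer balls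
      together.\<close>
    have ballp: "y \<in> ball p r" and key: "(norm (y - \<xi>))\<^sup>2 < 2 * R * (\<sigma> * ((y - \<xi>) \<bullet> n))"
      if R: "0 < R" "R \<le> R0" and y: "y \<in> ball (\<xi> + (\<sigma> * R) *\<^sub>R n) R" and \<sigma>: "\<sigma> = 1 \<or> \<sigma> = -1" for y R \<sigma>
    proof -
      have s2: "\<sigma> * \<sigma> = 1" using \<sigma> by auto
      have d: "norm (y - \<xi> - (\<sigma> * R) *\<^sub>R n) < R"
        using y by (simp add: dist_norm norm_minus_commute algebra_simps)
      have "norm (y - \<xi>) \<le> norm (y - \<xi> - (\<sigma> * R) *\<^sub>R n) + norm ((\<sigma> * R) *\<^sub>R n)"
        by (metis diff_add_cancel norm_triangle_ineq)
      also have "norm ((\<sigma> * R) *\<^sub>R n) = R"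
        using \<sigma> n1 R by auto
      finally have "norm (y - \<xi>) < 2 * R" using d by simp
      then have "dist \<xi> y < r / 2" using R0 R by (simp add: dist_norm norm_minus_commute)
      then show "y \<in> ball p r" using \<xi> dist_triangle_less_add[of p \<xi> "r/2" y "r/2"]
        by (simp add: dist_commute)
      have "(norm (y - \<xi> - (\<sigma> * R) *\<^sub>R n))\<^sup>2 < R\<^sup>2"
        using d R by (intro power_strict_mono) auto
      also have "(norm (y - \<xi> - (\<sigma> * R) *\<^sub>R n))\<^sup>2 = (norm (y - \<xi>))\<^sup>2 - 2 * (\<sigma> * R) * ((y - \<xi>) \<bullet> n) + (\<sigma> * \<sigma>) * R\<^sup>2 * (n \<bullet> n)"
        unfolding power2_norm_eq_inner
        by (simp add: inner_diff_left inner_diff_right inner_commute algebra_simps power2_eq_square)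
      finally show "(norm (y - \<xi>))\<^sup>2 < 2 * R * (\<sigma> * ((y - \<xi>) \<bullet> n))"
        using n1 s2 by (simp add: dot_square_norm algebra_simps)
    qed
    \<comment> \<open>With the wrong sign of the height, the normal component would be at most the
      quadratic error, which contradicts \<open>key\<close> because
      \<open>R * (2 * M) \<le> 1\<close>.\<close>
    have side: "\<sigma> * (y \<bullet> e2 - g (y \<bullet> e1)) > 0" 
      if R: "0 < R" "R \<le> R0" and y: "y \<in> ball (\<xi> + (\<sigma> * R) *\<^sub>R n) R" and \<sigma>: "\<sigma> = 1 \<or> \<sigma> = -1" for y R \<sigma>
    proof (rule ccontr)
      assume neg: "\<not> ?thesis"
      let ?q = "(norm (y - \<xi>))\<^sup>2" and ?w = "(y \<bullet> e2 - g (y \<bullet> e1)) / N"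
      have w: "\<sigma> * ?w \<le> 0" using neg N by (simp add: divide_nonpos_pos)
      have "\<bar>(y - \<xi>) \<bullet> n - ?w\<bar> \<le> M * ?q"
        using zn[OF ballp[OF R y \<sigma>]] by (simp add: diff_divide_distrib algebra_simps)
      moreover have "\<sigma> * a - \<sigma> * b \<le> c" if "\<bar>a - b\<bar> \<le> c" for a b c :: real
        using \<sigma> that by auto
      ultimately have "\<sigma> * ((y - \<xi>) \<bullet> n) - \<sigma> * ?w \<le> M * ?q" by blast
      then have "\<sigma> * ((y - \<xi>) \<bullet> n) \<le> M * ?q" using w by simp
      then have "2 * R * (\<sigma> * ((y - \<xi>) \<bullet> n)) \<le> 2 * R * (M * ?q)"
        using R by (intro mult_left_mono) auto
      also have "\<dots> = (R * (2 * M)) * ?q" by simp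
      also have "\<dots> \<le> 1 * ?q"
      proof (rule mult_right_mono)
        have "R * (2 * M) \<le> R0 * (2 * M)" using R LM by (intro mult_right_mono) auto
        then show "R * (2 * M) \<le> 1" using R0 by simp
      qed simp
      finally show False using key[OF R y \<sigma>] by simp
    qed
    show "\<exists>n. norm n = 1 \<and> 1 / sqrt (1 + L\<^sup>2) \<le> n \<bullet> e2 \<and>
       (\<forall>R. 0 < R \<longrightarrow> R \<le> R0 \<longrightarrow> ball (\<xi> - R *\<^sub>R n) R \<inter> D = {} \<and> ball (\<xi> + R *\<^sub>R n) R \<subseteq> D)"
    proof (intro exI[of _ n] conjI allI impI n1 ne)
      fix R assume R: "0 < R" "R \<le> R0"
      show "ball (\<xi> - R *\<^sub>R n) R \<inter> D = {}"
      proof -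
        have "y \<notin> D" if "y \<in> ball (\<xi> - R *\<^sub>R n) R" for y
          using side[OF R, of y "-1"] ballp[OF R, of y "-1"] Dr'[of y] that by auto
        then show ?thesis by blast
      qed
      show "ball (\<xi> + R *\<^sub>R n) R \<subseteq> D"
      proof
        fix y assume "y \<in> ball (\<xi> + R *\<^sub>R n) R"
        then show "y \<in> D"
          using side[OF R, of y 1] ballp[OF R, of y 1] Dr'[of y] by auto
      qed
    qed
  qed
qed

text \<open>Each chart admits every radius up to its own bound, so the minimum over a finite
  subcover of the compact frontier is a common radius.\<close>

lemma uniform_exterior_ball:
  fixes D :: "(real^2) set"
  assumes D: "open D" "bounded D" and sb: "smooth_boundary D"
  obtains R where "R > 0" "\<And>\<xi>. \<xi> \<in> frontier D \<Longrightarrow> \<exists>q. dist \<xi> q = R \<and> ball q R \<inter> D = {}"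
proof -
  have "\<exists>\<rho> R0. \<rho> > 0 \<and> R0 > 0 \<and> (\<forall>\<xi>\<in>frontier D \<inter> ball p \<rho>. \<forall>R. 0 < R \<longrightarrow> R \<le> R0 \<longrightarrow> (\<exists>q. dist \<xi> q = R \<and> ball q R \<inter> D = {}))"
    if p: "p \<in> frontier D" for p
  proof -
    obtain \<rho> R0 c e where *: "\<rho> > 0" "R0 > 0" "c > 0" "norm e = 1"
    "\<And>\<xi>. \<xi> \<in> frontier D \<Longrightarrow> \<xi> \<in> ball p \<rho> \<Longrightarrow> \<exists>n. norm n = 1 \<and> c \<le> n \<bullet> e \<and>
       (\<forall>R. 0 < R \<longrightarrow> R \<le> R0 \<longrightarrow> ball (\<xi> - R *\<^sub>R n) R \<inter> D = {} \<and> ball (\<xi> + R *\<^sub>R n) R \<subseteq> D)"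
      by (rule graph_tangent_balls[OF D(1) sb p]) (rule that)
    have "\<exists>q. dist \<xi> q = R \<and> ball q R \<inter> D = {}" if \<xi>: "\<xi> \<in> frontier D \<inter> ball p \<rho>" and R: "0 < R" "R \<le> R0" for \<xi> R
    proof -
      obtain n where "norm n = 1" "ball (\<xi> - R *\<^sub>R n) R \<inter> D = {}"
        using *(5)[of \<xi>] \<xi> R by blast
      then show ?thesis using R by (intro exI[of _ "\<xi> - R *\<^sub>R n"]) (simp add: dist_norm)
    qed
    with * show ?thesis by blast
  qed
  then obtain \<rho> R0 where *: "\<And>p. p \<in> frontier D \<Longrightarrow> \<rho> p > 0" "\<And>p. p \<in> frontier D \<Longrightarrow> R0 p > 0"
    "\<And>p \<xi> R. p \<in> frontier D \<Longrightarrow> \<xi> \<in> frontier D \<Longrightarrow> \<xi> \<in> ball p (\<rho> p) \<Longrightarrow> 0 < R \<Longrightarrow> R \<le> R0 p \<Longrightarrow> (\<exists>q. dist \<xi> q = R \<and> ball q R \<inter> D = {})"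
    by (metis IntI)
  have comp: "compact (frontier D)" using D by (simp add: compact_frontier_bounded)
  obtain C where C: "C \<subseteq> frontier D" "finite C" "frontier D \<subseteq> (\<Union>p\<in>C. ball p (\<rho> p))"
    by (rule compactE_image[OF comp, of "frontier D" "\<lambda>p. ball p (\<rho> p)"]) (use *(1) in auto)
  define R where "R = Min (insert 1 (R0 ` C))"
  have R: "R > 0" "\<And>p. p \<in> C \<Longrightarrow> R \<le> R0 p"
    using C *(2) by (auto simp: R_def)
  have "\<exists>q. dist \<xi> q = R \<and> ball q R \<inter> D = {}" if \<xi>: "\<xi> \<in> frontier D" for \<xi>
  proof -
    obtain p where p: "p \<in> C" "\<xi> \<in> ball p (\<rho> p)" using C(3) \<xi> by blast
    show ?thesis
      by (rule *(3)[OF _ \<xi> p(2) R(1) R(2)[OF p(1)]]) (use C(1) p in auto)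
  qed
  with R(1) that show thesis by blast
qed

subsection \<open>The Green function\<close>

lemma ln_diff_abs_le:
  fixes a b c :: real
  assumes "0 < c" "c \<le> a" "c \<le> b"
  shows "\<bar>ln a - ln b\<bar> \<le> \<bar>a - b\<bar> / c"
proof -
  have *: "ln a - ln b \<le> \<bar>a - b\<bar> / c" if "c \<le> a" "c \<le> b" for a b
  proof -
    have "ln a - ln b \<le> (a - b) / b"
      using that assms(1) ln_diff_le[of a b] by simp
    also have "\<dots> \<le> \<bar>a - b\<bar> / c"
      using that assms(1) by (intro frac_le) auto
    finally show ?thesis .
  qed
  show ?thesis
    using *[OF assms(2,3)] *[OF assms(3,2)] by (simp add: abs_le_iff abs_minus_commute)
qed

lemma GDERIV_ln_dist:
  fixes x y :: "'a::real_inner"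
  assumes "x \<noteq> y"
  shows "GDERIV (\<lambda>z. ln (dist z y)) x :> (1 / (dist x y)\<^sup>2) *\<^sub>R (x - y)"
proof -
  have pos: "(x - y) \<bullet> (x - y) > 0" using assms by simp
  have "GDERIV (\<lambda>z. ln ((z - y) \<bullet> (z - y)) / 2) x :> (1 / (dist x y)\<^sup>2) *\<^sub>R (x - y)"
    unfolding gderiv_def using pos
    by (auto intro!: derivative_eq_intros simp: dist_norm power2_norm_eq_inner inner_commute divide_simps)
  moreover have "ln ((z - y) \<bullet> (z - y)) / 2 = ln (dist z y)" for z
    by (cases "z = y") (simp_all add: dist_norm ln_realpow flip: power2_norm_eq_inner)
  ultimately show ?thesis by simp
qed

text \<open>The point on the left is the inverse of \<open>y\<close> in the circle of radius
  \<open>R\<close> about \<open>q\<close>. For \<open>x\<close> on that circle the last term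
  vanishes, which is the Apollonius relation. The identity serves both the exterior comparison for
  the Green function and the circular means of the logarithm.\<close>

lemma kelvin_identity:
  fixes x y q :: "'a::real_inner"
  assumes "R > 0" "y \<noteq> q"
  shows "(dist x (q + (R\<^sup>2 / (dist y q)\<^sup>2) *\<^sub>R (y - q)) * dist y q / R)\<^sup>2
    = (dist x y)\<^sup>2 + ((dist x q)\<^sup>2 - R\<^sup>2) * ((dist y q)\<^sup>2 - R\<^sup>2) / R\<^sup>2"
proof -
  define a b where "a = x - q" and "b = y - q"
  define B where "B = b \<bullet> b"
  have B: "B > 0" using assms by (simp add: B_def b_def)
  have 1: "(dist y q)\<^sup>2 = B" by (simp add: dist_norm B_def b_def power2_norm_eq_inner)
  have 2: "(dist x q)\<^sup>2 = a \<bullet> a" by (simp add: dist_norm a_def power2_norm_eq_inner)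
  have "x - y = a - b" by (simp add: a_def b_def)
  then have 3: "(dist x y)\<^sup>2 = a \<bullet> a - 2 * (a \<bullet> b) + B"
    by (simp add: dist_norm power2_norm_eq_inner B_def inner_diff_left inner_diff_right inner_commute)
  have "x - (q + (R\<^sup>2 / B) *\<^sub>R (y - q)) = a - (R\<^sup>2 / B) *\<^sub>R b"
    by (simp add: a_def b_def)
  moreover have "(norm (a - c *\<^sub>R b))\<^sup>2 = a \<bullet> a - 2 * c * (a \<bullet> b) + c\<^sup>2 * B" for c
    unfolding power2_norm_eq_inner B_def
    by (simp add: inner_diff_left inner_diff_right inner_commute power2_eq_square)
  ultimately have 4: "(dist x (q + (R\<^sup>2 / B) *\<^sub>R (y - q)))\<^sup>2 = a \<bullet> a - 2 * (R\<^sup>2 / B) * (a \<bullet> b) + (R\<^sup>2 / B)\<^sup>2 * B"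
    by (simp add: dist_norm)
  show ?thesis
    unfolding power_mult_distrib power_divide 1 2 3 4 using B assms(1)
    by (simp add: field_simps power2_eq_square)
qed

section \<open>Regular part, sign and size of the Green function\<close>

locale green_domain =
  fixes D :: "(real^2) set" and G :: "real^2 \<Rightarrow> real^2 \<Rightarrow> real"
  assumes open_D: "open D" and bounded_D: "bounded D" and nonempty_D: "D \<noteq> {}"
    and boundary_D: "smooth_boundary D" and green: "green_function D G"
begin

text \<open>\<open>green_function\<close> asserts only that a regular part exists, so one is
  selected. The pole comes first, which makes \<open>H y\<close> the harmonic function.\<close>

definition H :: "real^2 \<Rightarrow> real^2 \<Rightarrow> real" where
  "H y = (SOME h. continuous_on (closure D) h \<and> Ck_on 2 h D \<and> (\<forall>x\<in>D. laplacian h x = 0) \<and>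
     (\<forall>x\<in>closure D - {y}. G x y = - (1 / (2 * pi)) * ln (dist x y) + h x))"

definition bdist :: "real^2 \<Rightarrow> real" where
  "bdist x = infdist x (frontier D)"

lemma
  assumes "y \<in> D"
  shows H_cont: "continuous_on (closure D) (H y)"
    and H_harm: "harmonic_on (H y) D"
    and G_eq: "\<And>x. x \<in> closure D \<Longrightarrow> x \<noteq> y \<Longrightarrow> G x y = - (1 / (2 * pi)) * ln (dist x y) + H y x"
proof -
  have "\<exists>h. continuous_on (closure D) h \<and> Ck_on 2 h D \<and> (\<forall>x\<in>D. laplacian h x = 0) \<and>
     (\<forall>x\<in>closure D - {y}. G x y = - (1 / (2 * pi)) * ln (dist x y) + h x)"
    using green[unfolded green_function_def, rule_format, OF assms] by blast
  from someI_ex[OF this, folded H_def]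
  have *: "continuous_on (closure D) (H y)" "Ck_on 2 (H y) D" "\<forall>x\<in>D. laplacian (H y) x = 0"
     "\<forall>x\<in>closure D - {y}. G x y = - (1 / (2 * pi)) * ln (dist x y) + H y x"
    by blast+
  show "continuous_on (closure D) (H y)" by fact
  show "harmonic_on (H y) D"
    using harmonic_on_laplacian_const[OF open_D *(2), of 0] *(3) by simp
  show "\<And>x. x \<in> closure D \<Longrightarrow> x \<noteq> y \<Longrightarrow> G x y = - (1 / (2 * pi)) * ln (dist x y) + H y x"
    using *(4) by blast
qed

lemma frontier_not_in: "x \<in> frontier D \<Longrightarrow> x \<notin> D"
  using open_D by (simp add: frontier_def interior_open)

lemma G_frontier: "y \<in> D \<Longrightarrow> x \<in> frontier D \<Longrightarrow> G x y = 0"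
  using green unfolding green_function_def by blast

lemma H_frontier: "y \<in> D \<Longrightarrow> x \<in> frontier D \<Longrightarrow> H y x = 1 / (2 * pi) * ln (dist x y)"
  using G_eq[of y x] G_frontier[of y x] frontier_not_in by (force simp: frontier_def)

lemma frontier_ne: "frontier D \<noteq> {}"
  using bounded_D nonempty_D by (intro frontier_not_empty) auto

lemma bdist_le: "\<xi> \<in> frontier D \<Longrightarrow> bdist x \<le> dist x \<xi>"
  unfolding bdist_def by (rule infdist_le)

lemma bdist_attained: "\<exists>\<xi>\<in>frontier D. bdist x = dist x \<xi>"
  unfolding bdist_def using infdist_attains_inf[OF frontier_closed frontier_ne] by metis

lemma bdist_nonneg: "bdist x \<ge> 0"
  by (simp add: bdist_def infdist_nonneg)

lemma bdist_pos: "x \<in> D \<Longrightarrow> bdist x > 0"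
  using bdist_attained[of x] frontier_not_in by (metis zero_less_dist_iff)

lemma bdist_lipschitz: "bdist x \<le> bdist y + dist x y"
  unfolding bdist_def by (rule infdist_triangle)

text \<open>A ball is connected: one that met both \<open>D\<close> and its complement would meet
  the frontier, at a distance below \<open>bdist x\<close>.\<close>

lemma ball_bdist_subset: "x \<in> D \<Longrightarrow> ball x (bdist x) \<subseteq> D"
proof (rule ccontr)
  assume x: "x \<in> D" and "\<not> ball x (bdist x) \<subseteq> D"
  then have "ball x (bdist x) - D \<noteq> {}" by blast
  moreover have "x \<in> ball x (bdist x) \<inter> D" using bdist_pos[OF x] x by simp
  ultimately have "ball x (bdist x) \<inter> frontier D \<noteq> {}"
    by (intro connected_Int_frontier connected_ball) blast+
  then show False using bdist_le[of _ x] by force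
qed

lemma bounded_dist: obtains B where "B > 0" "\<And>x y. x \<in> closure D \<Longrightarrow> y \<in> closure D \<Longrightarrow> dist x y \<le> B"
proof
  have b: "bounded (closure D)" using bounded_closure[OF bounded_D] .
  show "diameter (closure D) + 1 > 0" using diameter_ge_0[OF b] by simp
  show "dist x y \<le> diameter (closure D) + 1" if "x \<in> closure D" "y \<in> closure D" for x y
    using diameter_bounded_bound[OF b that] by simp
qed

lemma in_D_bdist: "x \<in> D \<Longrightarrow> y \<in> frontier D \<Longrightarrow> 0 < dist y x"
  using frontier_not_in by force

text \<open>The logarithmic pole dominates the bounded regular part close to \<open>y\<close>. Once
  a small disc about the pole is removed, the boundary values are zero on the frontier of
  \<open>D\<close> and nonnegative on the small circle.\<close>

lemma G_nonneg:
  assumes x: "x \<in> D" and y: "y \<in> D" and xy: "x \<noteq> y"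
  shows "0 \<le> G x y"
proof -
  have "bounded (H y ` closure D)"
    using compact_continuous_image[OF H_cont[OF y]] compact_imp_bounded bounded_D by simp
  then obtain B where B: "\<And>z. z \<in> closure D \<Longrightarrow> \<bar>H y z\<bar> \<le> B"
    unfolding bounded_iff by (metis imageI real_norm_def)
  \<comment> \<open>The halves keep \<open>x\<close> and the frontier away from the disc; the
    exponential makes \<open>- (1 / (2 * pi)) * ln s\<close> at least \<open>B\<close>.\<close>
  define s where "s = min (min (dist x y / 2) (bdist y / 2)) (exp (- (2 * pi * B)))"
  have s: "s > 0" "s < dist x y" "s < bdist y" "s \<le> exp (- (2 * pi * B))"
  proof -
    show "s > 0" using xy bdist_pos[OF y] by (simp add: s_def)
    have "s \<le> dist x y / 2" "s \<le> bdist y / 2" by (simp_all add: s_def)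
    then show "s < dist x y" "s < bdist y"
      using xy bdist_pos[OF y] by (simp_all, smt (verit) zero_less_dist_iff)
    show "s \<le> exp (- (2 * pi * B))" by (simp add: s_def)
  qed
  let ?U = "D - cball y s"
  have cl: "closure ?U \<subseteq> closure D - ball y s"
  proof -
    have "?U \<subseteq> closure D - ball y s" using closure_subset by fastforce
    then show ?thesis by (rule closure_minimal) (auto intro: closed_Diff)
  qed
  let ?g = "\<lambda>z. - (1 / (2 * pi)) * ln (dist z y) + H y z"
  have "0 \<le> ?g x"
  proof (rule harmonic_minimum_principle[where U="?U" and h="?g"])
    show "open ?U" "bounded ?U" using open_D bounded_D by (auto intro: bounded_diff open_Diff)
    show "x \<in> closure ?U"
      using x s closure_subset[of ?U] by (auto simp: dist_commute)
    show "continuous_on (closure ?U) ?g"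
      by (intro continuous_intros continuous_on_subset[OF H_cont[OF y]]) (use cl s in auto)
    have h1: "harmonic_on (\<lambda>z. - (1 / (2 * pi)) * ln (dist z y)) ?U"
      by (intro harmonic_on_cmult harmonic_on_subset[OF harmonic_on_ln_dist]) (use s in auto)
    show "harmonic_on ?g ?U"
      by (rule harmonic_on_add[OF h1 harmonic_on_subset[OF H_harm[OF y]]]) auto
    fix z assume z: "z \<in> frontier ?U"
    have z1: "z \<in> closure D" "z \<notin> ball y s" using z cl by (auto simp: frontier_def)
    have "open ?U" using open_D by (auto intro: open_Diff)
    then have "z \<notin> ?U" using z by (auto simp: frontier_def interior_open)
    then consider "z \<in> frontier D" | "dist y z = s"
      using z1 open_D by (auto simp: frontier_def interior_open)
    then show "0 \<le> ?g z"
    proof cases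
      case 1
      then show ?thesis using H_frontier[OF y 1] by simp
    next
      case 2
      have "ln s \<le> - (2 * pi * B)"
        using s by (metis ln_exp ln_le_cancel_iff exp_gt_zero)
      then have "B \<le> - (1 / (2 * pi)) * ln s"
        by (simp add: field_simps)
      then show ?thesis using B[OF z1(1)] 2 by (simp add: dist_commute abs_le_iff)
    qed
  qed
  then show ?thesis
    using G_eq[OF y _ xy] x closure_subset by force
qed

text \<open>Comparison with the Green function of the complement of a disc, which is explicit by inversion.\<close>

lemma G_le_exterior:
  assumes x: "x \<in> D" and y: "y \<in> D" and xy: "x \<noteq> y" and R: "R > 0" and q: "ball q R \<inter> D = {}"
  shows "G x y \<le> 1 / (4 * pi) * ln (1 + ((dist x q)\<^sup>2 - R\<^sup>2) * ((dist y q)\<^sup>2 - R\<^sup>2) / R\<^sup>2 / (dist x y)\<^sup>2)"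
proof -
  have qcl: "dist z q \<ge> R" if "z \<in> closure D" for z
    using q open_Int_closure_eq_empty[of "ball q R" D] that by (force simp: dist_commute)
  have qD: "dist z q > R" if "z \<in> D" for z
  proof -
    have "cball q R \<inter> D = {}"
      using q open_Int_closure_eq_empty[OF open_D, of "ball q R"] R by (auto simp: Int_commute)
    then show ?thesis using that by (force simp: dist_commute)
  qed
  have yq: "dist y q > R" "y \<noteq> q" using qD[OF y] R by auto
  \<comment> \<open>The inverse of \<open>y\<close> lies inside the disc, off
    \<open>closure D\<close>, so the logarithm of the distance to \<open>w\<close> is harmonic
    throughout \<open>D\<close>.\<close>
  define w where "w = q + (R\<^sup>2 / (dist y q)\<^sup>2) *\<^sub>R (y - q)"
  have "dist w q = R\<^sup>2 / dist y q"
    using yq by (simp add: w_def dist_norm power2_eq_square)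
  also have "\<dots> < R" using yq R by (simp add: field_simps power2_eq_square)
  finally have w: "z \<in> closure D \<Longrightarrow> z \<noteq> w" for z
    using qcl by force
  define P where "P z = dist z w * dist y q / R" for z
  have P2: "(P z)\<^sup>2 = (dist z y)\<^sup>2 + ((dist z q)\<^sup>2 - R\<^sup>2) * ((dist y q)\<^sup>2 - R\<^sup>2) / R\<^sup>2" for z
    unfolding P_def w_def by (rule kelvin_identity[OF R yq(2)])
  have Ppos: "P z > 0" if "z \<in> closure D" for z
    using w[OF that] yq R by (simp add: P_def)
  have lnP: "ln (P z) = ln (dist z w) + ln (dist y q / R)" if "z \<in> closure D" for z
    using w[OF that] yq R by (simp add: P_def ln_mult ln_div)
  let ?g = "\<lambda>z. H y z - 1 / (2 * pi) * (ln (dist z w) + ln (dist y q / R))"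
  have "?g x \<le> 0"
  proof (rule harmonic_maximum_principle[OF open_D bounded_D, where h="?g"])
    show "continuous_on (closure D) ?g"
      by (intro continuous_intros H_cont[OF y]) (use w in auto)
    show "harmonic_on ?g D"
      by (intro harmonic_on_diff H_harm[OF y] harmonic_on_cmult harmonic_on_add harmonic_on_const
           harmonic_on_subset[OF harmonic_on_ln_dist]) (use w closure_subset in blast)
    show "x \<in> closure D" using x closure_subset by blast
    fix z assume z: "z \<in> frontier D"
    then have zc: "z \<in> closure D" by (simp add: frontier_def)
    \<comment> \<open>Neither point lies inside the disc, so the correction term in
      \<open>P2\<close> is nonnegative and the comparison function dominates on the
      frontier.\<close>
    have "R\<^sup>2 \<le> (dist z q)\<^sup>2" "R\<^sup>2 \<le> (dist y q)\<^sup>2"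
      using qcl[OF zc] yq R by (auto intro: power_mono)
    then have le: "(dist z y)\<^sup>2 \<le> (P z)\<^sup>2"
      using R by (simp add: P2)
    have "dist z y \<le> P z"
      by (rule power2_le_imp_le[OF le less_imp_le[OF Ppos[OF zc]]])
    then have "ln (dist z y) \<le> ln (P z)"
      using Ppos[OF zc] in_D_bdist[OF y z] by (meson ln_le_cancel_iff)
    then show "?g z \<le> 0"
      using H_frontier[OF y z] lnP[OF zc] by (simp add: divide_right_mono)
  qed
  then have "H y x \<le> 1 / (2 * pi) * ln (P x)"
    using lnP x closure_subset by fastforce
  then have "G x y \<le> 1 / (2 * pi) * (ln (P x) - ln (dist x y))"
    using G_eq[OF y _ xy] x closure_subset[of D] by (simp add: subset_eq algebra_simps)
  also have "\<dots> = 1 / (4 * pi) * ln ((P x)\<^sup>2 / (dist x y)\<^sup>2)"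
    using Ppos[of x] x closure_subset[of D] xy by (simp add: subset_eq ln_div ln_realpow field_simps)
  also have "(P x)\<^sup>2 / (dist x y)\<^sup>2 = 1 + ((dist x q)\<^sup>2 - R\<^sup>2) * ((dist y q)\<^sup>2 - R\<^sup>2) / R\<^sup>2 / (dist x y)\<^sup>2"
    using xy by (simp add: P2 add_divide_distrib)
  finally show ?thesis .
qed

text \<open>The comparison disc touches \<open>D\<close> at a boundary point nearest to
  \<open>x\<close>. The two factors of the exterior bound are then of order \<open>d\<close> and
  \<open>d + s\<close>, with \<open>d\<close> the boundary distance of \<open>x\<close> and
  \<open>s\<close> the distance to the pole, and the logarithm is bounded linearly in
  \<open>d / s\<close>.\<close>

lemma G_upper:
  obtains C where "C > 0" "\<And>x y. x \<in> D \<Longrightarrow> y \<in> D \<Longrightarrow> x \<noteq> y \<Longrightarrow> G x y \<le> C * bdist x / dist x y"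
proof -
  obtain R where R: "R > 0" "\<And>\<xi>. \<xi> \<in> frontier D \<Longrightarrow> \<exists>q. dist \<xi> q = R \<and> ball q R \<inter> D = {}"
    by (rule uniform_exterior_ball[OF open_D bounded_D boundary_D]) (rule that)
  obtain B where B: "B > 0" "\<And>x y. x \<in> closure D \<Longrightarrow> y \<in> closure D \<Longrightarrow> dist x y \<le> B"
    by (rule bounded_dist) (rule that)
  define K where "K = ((2 * R + 2 * B) / R)\<^sup>2"
  have K: "K \<ge> 1" using R B by (simp add: K_def field_simps)
  have "G x y \<le> K * bdist x / dist x y" if x: "x \<in> D" and y: "y \<in> D" and xy: "x \<noteq> y" for x y
  proof -
    obtain \<xi> where \<xi>: "\<xi> \<in> frontier D" "bdist x = dist x \<xi>" using bdist_attained by blast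
    obtain q where q: "dist \<xi> q = R" "ball q R \<inter> D = {}" using R(2)[OF \<xi>(1)] by blast
    define d where "d = bdist x"
    define s where "s = dist x y"
    define a where "a = dist x q"
    define b where "b = dist y q"
    have s: "s > 0" using xy by (simp add: s_def)
    have d: "d > 0" using bdist_pos[OF x] by (simp add: d_def)
    have cl: "x \<in> closure D" "y \<in> closure D" "\<xi> \<in> closure D"
      using x y \<xi> closure_subset by (auto simp: frontier_def)
    have dB: "d \<le> B" "s \<le> B" using B(2) cl \<xi> by (auto simp: d_def s_def)
    have nq: "dist z q \<ge> R" if "z \<in> D" for z
      using q(2) that by (force simp: dist_commute)
    have a: "R \<le> a" "a \<le> R + d"
      using nq[OF x] dist_triangle[of x q \<xi>] q \<xi> by (auto simp: a_def d_def)
    have b: "R \<le> b" "b \<le> R + d + s"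
      using nq[OF y] dist_triangle[of y q x] a by (auto simp: b_def a_def s_def dist_commute)
    have "(a\<^sup>2 - R\<^sup>2) * (b\<^sup>2 - R\<^sup>2) \<le> (d * (2 * R + 2 * B)) * ((d + s) * (2 * R + 2 * B))"
    proof (rule mult_mono)
      have "a\<^sup>2 - R\<^sup>2 = (a - R) * (a + R)" "b\<^sup>2 - R\<^sup>2 = (b - R) * (b + R)"
        by (auto simp: power2_eq_square algebra_simps)
      then show "a\<^sup>2 - R\<^sup>2 \<le> d * (2 * R + 2 * B)" "b\<^sup>2 - R\<^sup>2 \<le> (d + s) * (2 * R + 2 * B)" "0 \<le> b\<^sup>2 - R\<^sup>2"
        using a b R(1) B(1) d s dB by (auto intro!: mult_mono)
      show "0 \<le> d * (2 * R + 2 * B)" using d R(1) B(1) by simp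
    qed
    then have "(a\<^sup>2 - R\<^sup>2) * (b\<^sup>2 - R\<^sup>2) / R\<^sup>2 / s\<^sup>2 \<le> (d * (2 * R + 2 * B)) * ((d + s) * (2 * R + 2 * B)) / R\<^sup>2 / s\<^sup>2"
      by (intro divide_right_mono) auto
    also have "\<dots> = K * (d / s) * (1 + d / s)"
      using s R(1) by (simp add: K_def field_simps power2_eq_square)
    finally have 1: "(a\<^sup>2 - R\<^sup>2) * (b\<^sup>2 - R\<^sup>2) / R\<^sup>2 / s\<^sup>2 \<le> K * (d / s) * (1 + d / s)" .
    define t where "t = d / s"
    have t: "t > 0" using d s by (simp add: t_def)
    \<comment> \<open>Domination by a perfect square turns the factor \<open>1 / (4 * pi)\<close>
      into \<open>1 / (2 * pi)\<close> and leaves the logarithm of \<open>1 + K * t\<close>, which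
      is at most \<open>K * t\<close>.\<close>
    have 2: "1 + K * t * (1 + t) \<le> (1 + K * t)\<^sup>2"
    proof -
      have "K * t\<^sup>2 \<le> K\<^sup>2 * t\<^sup>2"
        using K by (intro mult_right_mono) (auto simp: power2_eq_square)
      moreover have "K * t \<ge> 0" using K t by simp
      moreover have "1 + K * t * (1 + t) = 1 + K * t + K * t\<^sup>2" "(1 + K * t)\<^sup>2 = 1 + 2 * (K * t) + K\<^sup>2 * t\<^sup>2"
        by (simp_all add: power2_eq_square algebra_simps)
      ultimately show ?thesis by simp
    qed
    have nn: "0 \<le> (a\<^sup>2 - R\<^sup>2) * (b\<^sup>2 - R\<^sup>2) / R\<^sup>2 / s\<^sup>2"
      using a b R(1) by (auto intro!: mult_nonneg_nonneg power_mono divide_nonneg_nonneg)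
    have "1 + (a\<^sup>2 - R\<^sup>2) * (b\<^sup>2 - R\<^sup>2) / R\<^sup>2 / s\<^sup>2 \<le> (1 + K * t)\<^sup>2"
      using 1 2 unfolding t_def by linarith
    moreover have "0 < 1 + (a\<^sup>2 - R\<^sup>2) * (b\<^sup>2 - R\<^sup>2) / R\<^sup>2 / s\<^sup>2"
      using nn by linarith
    ultimately have 3: "ln (1 + (a\<^sup>2 - R\<^sup>2) * (b\<^sup>2 - R\<^sup>2) / R\<^sup>2 / s\<^sup>2) \<le> ln ((1 + K * t)\<^sup>2)"
      by (meson ln_le_cancel_iff order_less_le_trans)
    have "G x y \<le> 1 / (4 * pi) * ln (1 + (a\<^sup>2 - R\<^sup>2) * (b\<^sup>2 - R\<^sup>2) / R\<^sup>2 / s\<^sup>2)"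
      using G_le_exterior[OF x y xy R(1) q(2)] unfolding a_def b_def s_def .
    also have "\<dots> \<le> 1 / (4 * pi) * ln ((1 + K * t)\<^sup>2)"
      using 3 by (rule mult_left_mono) simp
    also have "\<dots> = 1 / (2 * pi) * ln (1 + K * t)"
      using K t by (simp add: ln_realpow add_pos_pos)
    also have "\<dots> \<le> 1 * (K * t)"
      using K t pi_gt3 ln_add_one_self_le_self[of "K * t"] by (intro mult_mono) auto
    finally show ?thesis by (simp add: t_def d_def s_def)
  qed
  moreover have "K > 0" using K by simp
  ultimately show thesis using that by blast
qed

section \<open>Dependence of the regular part on the pole\<close>

text \<open>The difference is harmonic in \<open>x\<close>, and its boundary values are differences
  of logarithms of distances of at least \<open>c\<close>, hence Lipschitz in the pole; the maximum
  principle carries this inside. Measurability of the integrands with respect to the pole rests on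
  this estimate.\<close>

lemma H_diff:
  assumes y: "y \<in> D" "y' \<in> D" and x: "x \<in> closure D"
    and c: "0 < c" "c \<le> bdist y" "c \<le> bdist y'"
  shows "\<bar>H y x - H y' x\<bar> \<le> dist y y' / c"
proof -
  have f: "\<bar>H y z - H y' z\<bar> \<le> dist y y' / c" if z: "z \<in> frontier D" for z
  proof -
    have zc: "c \<le> dist z y" "c \<le> dist z y'"
      using bdist_le[OF z, of y] bdist_le[OF z, of y'] c by (auto simp: dist_commute)
    have "\<bar>H y z - H y' z\<bar> = 1 / (2 * pi) * \<bar>ln (dist z y) - ln (dist z y')\<bar>"
      using H_frontier[OF y(1) z] H_frontier[OF y(2) z]
      by (simp add: abs_mult flip: right_diff_distrib diff_divide_distrib)
    also have "\<dots> \<le> 1 * \<bar>ln (dist z y) - ln (dist z y')\<bar>"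
      using pi_gt3 by (intro mult_right_mono) auto
    also have "\<dots> \<le> \<bar>dist z y - dist z y'\<bar> / c"
      using ln_diff_abs_le[OF c(1) zc] by simp
    also have "\<dots> \<le> dist y y' / c"
      using c abs_dist_diff_le[of y z y'] by (simp add: divide_right_mono dist_commute)
    finally show ?thesis .
  qed
  have cont: "continuous_on (closure D) (\<lambda>z. H y z - H y' z)"
    by (intro continuous_intros H_cont y)
  have harm: "harmonic_on (\<lambda>z. H y z - H y' z) D"
    by (intro harmonic_on_diff H_harm y)
  have "H y x - H y' x \<le> dist y y' / c"
    by (rule harmonic_maximum_principle[OF open_D bounded_D cont harm _ x]) (use f in \<open>simp add: abs_le_iff\<close>)
  moreover have "- (dist y y' / c) \<le> H y x - H y' x"
    by (rule harmonic_minimum_principle[OF open_D bounded_D cont harm _ x]) (meson f abs_le_D2 minus_le_iff)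
  ultimately show ?thesis by (simp add: abs_le_iff)
qed

lemma continuous_H_pole:
  assumes x: "x \<in> closure D"
  shows "continuous_on D (\<lambda>y. H y x)"
  unfolding continuous_on_iff
proof (intro ballI allI impI)
  fix y and e :: real assume y: "y \<in> D" and e: "e > 0"
  define c where "c = bdist y / 2"
  have c: "c > 0" using bdist_pos[OF y] by (simp add: c_def)
  have "dist (H y' x) (H y x) < e" if y': "y' \<in> D" "dist y' y < min c (e * c)" for y'
  proof -
    have "c \<le> bdist y" "c \<le> bdist y'"
      using bdist_lipschitz[of y y'] y' c by (auto simp: c_def dist_commute)
    then have "\<bar>H y' x - H y x\<bar> \<le> dist y' y / c"
      using H_diff[OF y'(1) y x c] by simp
    also have "\<dots> < e" using y'(2) c by (simp add: field_simps)
    finally show ?thesis by (simp add: dist_real_def)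
  qed
  then show "\<exists>d>0. \<forall>y'\<in>D. dist y' y < d \<longrightarrow> dist (H y' x) (H y x) < e"
    using c e by (intro exI[of _ "min c (e * c)"]) auto
qed

lemma continuous_grad_H_pole:
  assumes x: "x \<in> D"
  shows "continuous_on D (\<lambda>y. grad (H y) x)"
  unfolding continuous_on_iff
proof (intro ballI allI impI)
  fix y and e :: real assume y: "y \<in> D" and e: "e > 0"
  define c where "c = bdist y / 2"
  have c: "c > 0" using bdist_pos[OF y] by (simp add: c_def)
  \<comment> \<open>The gradient estimate loses a factor 16; 17 leaves room for a strict
    inequality.\<close>
  define \<delta> where "\<delta> = min c (e * c * bdist x / 17)"
  have \<delta>: "\<delta> > 0" using c e bdist_pos[OF x] by (simp add: \<delta>_def)
  have "dist (grad (H y') x) (grad (H y) x) < e" if y': "y' \<in> D" "dist y' y < \<delta>" for y'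
  proof -
    have cc: "c \<le> bdist y" "c \<le> bdist y'"
      using bdist_lipschitz[of y y'] y' c by (auto simp: c_def \<delta>_def dist_commute)
    have harm: "harmonic_on (\<lambda>z. H y' z - H y z) D"
      by (intro harmonic_on_diff H_harm y y')
    have "GDERIV (\<lambda>z. H y' z - H y z) x :> grad (H y') x - grad (H y) x"
      by (intro GDERIV_diff harmonic_on_GDERIV[OF H_harm[OF y] x] harmonic_on_GDERIV[OF H_harm[OF y'(1)] x])
    then have "grad (\<lambda>z. H y' z - H y z) x = grad (H y') x - grad (H y) x"
      by (rule GDERIV_imp_grad)
    moreover have "norm (grad (\<lambda>z. H y' z - H y z) x) \<le> 16 * (\<delta> / c) / bdist x"
    proof (rule harmonic_gradient_estimate)
      show "bdist x > 0" using bdist_pos[OF x] .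
      show "\<delta> / c > 0" using \<delta> c by simp
      show "harmonic_on (\<lambda>z. H y' z - H y z) (ball x (bdist x))"
        by (rule harmonic_on_subset[OF harm ball_bdist_subset[OF x]])
      fix z assume "z \<in> ball x (bdist x)"
      then have "z \<in> closure D" using ball_bdist_subset[OF x] closure_subset by blast
      then have "\<bar>H y' z - H y z\<bar> \<le> dist y' y / c"
        using H_diff[OF y'(1) y _ c cc(2,1)] by simp
      also have "\<dots> \<le> \<delta> / c" using y' c by (simp add: divide_right_mono)
      finally show "\<bar>H y' z - H y z\<bar> \<le> \<delta> / c" .
    qed
    moreover have "16 * (\<delta> / c) / bdist x < e"
    proof -
      have "\<delta> \<le> e * c * bdist x / 17" by (simp add: \<delta>_def)
      then have "16 * \<delta> < e * c * bdist x"
        using e c bdist_pos[OF x] \<delta> by (simp add: field_simps)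
      then show ?thesis using c bdist_pos[OF x] by (simp add: field_simps)
    qed
    ultimately show ?thesis by (simp add: dist_norm)
  qed
  then show "\<exists>d>0. \<forall>y'\<in>D. dist y' y < d \<longrightarrow> dist (grad (H y') x) (grad (H y) x) < e"
    using \<delta> by blast
qed

text \<open>The gradient of \<open>G\<close> in its first argument, written out so that it is
  explicit for every pole; at \<open>y = x\<close> the singular term is 0.\<close>

definition gradG :: "real^2 \<Rightarrow> real^2 \<Rightarrow> real^2" where
  "gradG x y = grad (H y) x - (1 / (2 * pi)) *\<^sub>R ((1 / (dist x y)\<^sup>2) *\<^sub>R (x - y))"

lemma G_eventually_eq:
  assumes "y \<in> D"
  shows "\<And>z. z \<in> D - {y} \<Longrightarrow> H y z - (1 / (2 * pi)) * ln (dist z y) = G z y"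
proof -
  fix z assume "z \<in> D - {y}"
  then have "z \<in> closure D" "z \<noteq> y" using closure_subset by auto
  then show "H y z - (1 / (2 * pi)) * ln (dist z y) = G z y"
    using G_eq[OF assms] by simp
qed

lemma GDERIV_G:
  assumes x: "x \<in> D" and y: "y \<in> D" and xy: "x \<noteq> y"
  shows "GDERIV (\<lambda>z. G z y) x :> gradG x y"
proof -
  have l: "GDERIV (\<lambda>z. 1 / (2 * pi) * ln (dist z y)) x :> (1 / (2 * pi)) *\<^sub>R ((1 / (dist x y)\<^sup>2) *\<^sub>R (x - y))"
    using GDERIV_mult[OF GDERIV_const GDERIV_ln_dist[OF xy], of "1 / (2 * pi)"] by simp
  have "GDERIV (\<lambda>z. H y z - 1 / (2 * pi) * ln (dist z y)) x :> gradG x y"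
    unfolding gradG_def by (intro GDERIV_diff harmonic_on_GDERIV[OF H_harm[OF y] x] l)
  moreover have "open (D - {y})" using open_D by (rule open_delete)
  moreover have "x \<in> D - {y}" using x xy by simp
  ultimately show ?thesis
    by (rule GDERIV_cong_open[OF _ _ _ G_eventually_eq[OF y]])
qed

lemma harmonic_on_G:
  assumes "y \<in> D"
  shows "harmonic_on (\<lambda>z. G z y) (D - {y})"
proof (rule harmonic_on_cong[OF _ _ G_eventually_eq[OF assms]])
  show "harmonic_on (\<lambda>z. H y z - 1 / (2 * pi) * ln (dist z y)) (D - {y})"
    by (intro harmonic_on_diff harmonic_on_cmult harmonic_on_subset[OF harmonic_on_ln_dist]
       harmonic_on_subset[OF H_harm[OF assms]]) auto
qed (use open_D in \<open>auto intro: open_delete\<close>)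

text \<open>Interior estimates at the scale of the boundary distance \<open>d\<close>, in two
  regimes. If the pole is nearer than \<open>d / 4\<close>, the regular part is estimated on a disc
  of radius \<open>d / 2\<close>. Otherwise \<open>G\<close> itself is harmonic on a disc of radius
  \<open>d / 8\<close>, where it is of size \<open>d / dist x y\<close>, and division by the radius
  cancels \<open>d\<close>.\<close>

lemma gradient_bounds:
  obtains C where "C > 0"
    "\<And>x y. x \<in> D \<Longrightarrow> y \<in> D \<Longrightarrow> norm (grad (H y) x) \<le> C / bdist x"
    "\<And>x y. x \<in> D \<Longrightarrow> y \<in> D \<Longrightarrow> x \<noteq> y \<Longrightarrow> norm (gradG x y) \<le> C / dist x y"
proof -
  obtain C where C: "C > 0" "\<And>x y. x \<in> D \<Longrightarrow> y \<in> D \<Longrightarrow> x \<noteq> y \<Longrightarrow> G x y \<le> C * bdist x / dist x y"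
    by (rule G_upper) (rule that)
  \<comment> \<open>Large enough for all cases: the far regime asks for
    \<open>4 * (288 * C + 1)\<close>, the near one for \<open>192 * C + 33\<close>.\<close>
  define C' where "C' = 8 * (288 * C + 40) + 1"
  have diff: "\<bar>norm (gradG x y) - norm (grad (H y) x)\<bar> \<le> 1 / dist x y" if "x \<noteq> y" for x y
  proof -
    have "\<bar>norm (gradG x y) - norm (grad (H y) x)\<bar> \<le> norm ((1 / (2 * pi)) *\<^sub>R ((1 / (dist x y)\<^sup>2) *\<^sub>R (x - y)))"
      using norm_triangle_ineq3[of "gradG x y" "grad (H y) x"] by (simp add: gradG_def)
    also have "\<dots> = (1 / (2 * pi)) * (1 / dist x y)"
      using that by (simp add: dist_norm power2_eq_square)
    also have "\<dots> \<le> 1 * (1 / dist x y)"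
      using pi_gt3 by (intro mult_right_mono) auto
    finally show ?thesis by simp
  qed
  have main: "norm (grad (H y) x) \<le> C' / bdist x \<and> (x \<noteq> y \<longrightarrow> norm (gradG x y) \<le> C' / dist x y)"
    if x: "x \<in> D" and y: "y \<in> D" for x y
  proof -
    define d where "d = bdist x"
    have d: "d > 0" using bdist_pos[OF x] by (simp add: d_def)
    show ?thesis
    proof (cases "dist x y < d / 4")
      case True
      \<comment> \<open>\<open>H y\<close> may be as large as the logarithm of \<open>d\<close>;
        removing that value leaves a function bounded independently of \<open>d\<close>.\<close>
      let ?k = "\<lambda>z. H y z - 1 / (2 * pi) * ln d"
      have sub: "cball x (d / 2) \<subseteq> D"
        using ball_bdist_subset[OF x] d by (force simp: d_def)
      have harm: "harmonic_on ?k D"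
        by (intro harmonic_on_diff H_harm[OF y] harmonic_on_const)
      have sph: "\<bar>?k z\<bar> \<le> 6 * C + 1" if z: "dist x z = d / 2" for z
      proof -
        have zD: "z \<in> D" using sub z by auto
        have zy: "d / 4 \<le> dist z y" "dist z y \<le> d"
          using True z dist_triangle[of x z y] dist_triangle[of z y x] by (auto simp: dist_commute)
        then have ne: "z \<noteq> y" using d by auto
        have k: "?k z = G z y + 1 / (2 * pi) * (ln (dist z y) - ln d)"
          using G_eq[OF y _ ne] zD closure_subset[of D] by (simp add: subset_eq diff_divide_distrib)
        have bz: "bdist z \<le> 3 / 2 * d" using bdist_lipschitz[of z x] z by (simp add: d_def dist_commute)
        have "C * bdist z / dist z y \<le> C * (3 / 2 * d) / (d / 4)"
          using C zy bz d by (intro frac_le mult_left_mono mult_nonneg_nonneg bdist_nonneg) auto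
        also have "\<dots> = 6 * C" using d by simp
        finally have G1: "G z y \<le> 6 * C" using C(2)[OF zD y ne] by simp
        have G0: "0 \<le> G z y" by (rule G_nonneg[OF zD y ne])
        have "\<bar>ln (dist z y) - ln d\<bar> \<le> \<bar>dist z y - d\<bar> / (d / 4)"
          using zy d by (intro ln_diff_abs_le) auto
        also have "\<dots> \<le> (3 / 4 * d) / (d / 4)"
          using zy d by (intro divide_right_mono) auto
        also have "\<dots> = 3" using d by simp
        finally have "1 / (2 * pi) * \<bar>ln (dist z y) - ln d\<bar> \<le> 1 / 6 * 3"
          using pi_gt3 by (intro mult_mono) (auto simp: field_simps)
        then have "\<bar>1 / (2 * pi) * (ln (dist z y) - ln d)\<bar> \<le> 1"
          unfolding abs_mult by simp
        then show ?thesis unfolding k using G0 G1 by linarith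
      qed
      have contk: "continuous_on (closure (ball x (d/2))) ?k"
        using sub d closure_subset[of D]
        by (intro continuous_intros continuous_on_subset[OF H_cont[OF y]]) auto
      have harmb: "harmonic_on ?k (ball x (d / 2))"
        by (rule harmonic_on_subset[OF harm]) (use sub in auto)
      have bdk: "\<bar>?k z\<bar> \<le> 6 * C + 1" if "z \<in> ball x (d / 2)" for z
      proof -
        have zc: "z \<in> closure (ball x (d / 2))" using that closure_subset by blast
        have f: "\<bar>?k u\<bar> \<le> 6 * C + 1" if "u \<in> frontier (ball x (d / 2))" for u
          using that d sph by (simp add: frontier_ball)
        have "?k z \<le> 6 * C + 1"
          by (rule harmonic_maximum_principle[OF open_ball bounded_ball contk harmb _ zc]) (use f in \<open>simp add: abs_le_iff\<close>)
        moreover have "- (6 * C + 1) \<le> ?k z"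
          by (rule harmonic_minimum_principle[OF open_ball bounded_ball contk harmb _ zc]) (meson f abs_le_D2 minus_le_iff)
        ultimately show ?thesis by (simp add: abs_le_iff)
      qed
      have "norm (grad ?k x) \<le> 16 * (6 * C + 1) / (d / 2)"
        using d C harmb bdk by (intro harmonic_gradient_estimate) auto
      moreover have "grad ?k x = grad (H y) x"
        using GDERIV_diff[OF harmonic_on_GDERIV[OF H_harm[OF y] x] GDERIV_const, of "1 / (2 * pi) * ln d"]
        by (intro GDERIV_imp_grad) simp
      ultimately have 1: "norm (grad (H y) x) \<le> (192 * C + 32) / d"
        by (simp add: field_simps)
      have b1: "norm (grad (H y) x) \<le> C' / d"
        using 1 C d by (auto simp: C'_def elim!: order_trans intro!: divide_right_mono)
      have "norm (gradG x y) \<le> C' / dist x y" if xy: "x \<noteq> y"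
      proof -
        have "norm (gradG x y) \<le> (192 * C + 32) / d + 1 / dist x y"
          using 1 diff[OF xy] by (simp add: abs_le_iff)
        also have "(192 * C + 32) / d \<le> (192 * C + 32) / dist x y"
          using True xy C d by (intro divide_left_mono) auto
        also have "(192 * C + 32) / dist x y + 1 / dist x y \<le> C' / dist x y"
          using xy C by (simp add: C'_def add_divide_distrib[symmetric] divide_right_mono)
        finally show ?thesis by simp
      qed
      with b1 show ?thesis by (simp add: d_def)
    next
      case False
      then have far: "dist x y \<ge> d / 4" "x \<noteq> y" using d by auto
      define \<rho> where "\<rho> = dist x y"
      have \<rho>: "\<rho> > 0" "\<rho> \<ge> d / 4" using far by (auto simp: \<rho>_def)
      have sub: "ball x (d / 8) \<subseteq> D - {y}"
        using ball_bdist_subset[OF x] far d by (force simp: d_def)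
      have "norm (grad (\<lambda>z. G z y) x) \<le> 16 * (9 / 4 * C * d / \<rho>) / (d / 8)"
      proof (rule harmonic_gradient_estimate)
        show "d / 8 > 0" "9 / 4 * C * d / \<rho> > 0" using d C \<rho> by auto
        show "harmonic_on (\<lambda>z. G z y) (ball x (d / 8))"
          by (rule harmonic_on_subset[OF harmonic_on_G[OF y] sub])
        fix z assume z: "z \<in> ball x (d / 8)"
        then have zD: "z \<in> D" "z \<noteq> y" using sub by auto
        have bz: "bdist z \<le> 9 / 8 * d" using bdist_lipschitz[of z x] z by (simp add: d_def dist_commute)
        have zy: "dist z y \<ge> \<rho> / 2"
          using dist_triangle[of x y z] z far by (simp add: \<rho>_def)
        have "G z y \<le> C * bdist z / dist z y" using C(2)[OF zD(1) y zD(2)] .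
        also have "\<dots> \<le> C * (9 / 8 * d) / (\<rho> / 2)"
          using C zy bz d \<rho> by (intro frac_le mult_left_mono mult_nonneg_nonneg bdist_nonneg) auto
        finally show "\<bar>G z y\<bar> \<le> 9 / 4 * C * d / \<rho>"
          using G_nonneg[OF zD(1) y zD(2)] by simp
      qed
      moreover have "grad (\<lambda>z. G z y) x = gradG x y"
        by (rule GDERIV_imp_grad[OF GDERIV_G[OF x y far(2)]])
      ultimately have 1: "norm (gradG x y) \<le> 288 * C / \<rho>"
        using d by (simp add: field_simps)
      have 2: "norm (grad (H y) x) \<le> (288 * C + 1) / \<rho>"
        using 1 diff[OF far(2)] by (simp add: abs_le_iff \<rho>_def add_divide_distrib)
      also have "\<dots> \<le> (288 * C + 1) / (d / 4)"
        using \<rho> d C by (intro divide_left_mono) auto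
      also have "\<dots> \<le> C' / d"
        using C d by (simp add: C'_def divide_right_mono)
      finally have "norm (grad (H y) x) \<le> C' / d" .
      moreover have "norm (gradG x y) \<le> C' / \<rho>"
        using 1 C \<rho> by (auto simp: C'_def elim!: order_trans intro!: divide_right_mono)
      ultimately show ?thesis by (simp add: d_def \<rho>_def)
    qed
  qed
  have "C' > 0" using C by (simp add: C'_def)
  with main that show thesis by blast
qed

end

subsection \<open>Weakly singular integrals in the plane\<close>

lemma measurable_lebesgueI: "f \<in> borel_measurable borel \<Longrightarrow> f \<in> borel_measurable lebesgue"
  by (simp add: measurable_completion)

lemma emeasure_lebesgue_ball:
  assumes "r \<ge> 0"
  shows "emeasure lebesgue (ball (a::real^2) r) = ennreal (pi * r\<^sup>2)"
proof -
  have "emeasure lebesgue (ball a r) = emeasure lborel (ball a r)"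
    by simp
  also have "\<dots> = ennreal (pi * r\<^sup>2)"
    using emeasure_ball[OF assms, of a] by (simp add: unit_ball_vol_2)
  finally show ?thesis .
qed

lemma measure_lebesgue_ball: "r \<ge> 0 \<Longrightarrow> measure lebesgue (ball (a::real^2) r) = pi * r\<^sup>2"
  unfolding measure_def by (subst emeasure_lebesgue_ball) simp_all

lemma borel_measurable_inv_dist [measurable]:
  fixes a :: "'a::euclidean_space"
  shows "A \<in> sets lebesgue \<Longrightarrow> (\<lambda>y. indicator A y / dist a y :: real) \<in> borel_measurable lebesgue"
  by (intro borel_measurable_divide borel_measurable_indicator measurable_lebesgueI
      borel_measurable_continuous_onI continuous_intros)

text \<open>Decompose the disc dyadically: on the n-th annulus the integrand is at most \<open>2\<^sup>n\<^sup>+\<^sup>1 / r\<close>.\<close>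

lemma nn_integral_inv_dist_ball:
  fixes a :: "real^2"
  assumes r: "r > 0"
  shows "(\<integral>\<^sup>+y. ennreal (indicator (ball a r) y / dist a y) \<partial>lebesgue) \<le> ennreal (4 * pi * r)"
proof -
  let ?f = "\<lambda>n y. ennreal (2 ^ (n + 1) / r) * indicator (ball a (r / 2 ^ n)) y"
  have pt: "ennreal (indicator (ball a r) y / dist a y) \<le> (\<Sum>n. ?f n y)" for y
  proof (cases "y \<in> ball a r \<and> y \<noteq> a")
    case True
    define d where "d = dist a y / r"
    have d: "0 < d" "d < 1" using True r by (auto simp: d_def)
    \<comment> \<open>The first dyadic level not above \<open>d\<close>; the annulus that contains
      \<open>y\<close> has the preceding index.\<close>
    define N where "N = (LEAST N. (1 / 2 :: real) ^ N \<le> d)"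
    obtain N0 where "(1 / 2 :: real) ^ N0 < d" using real_arch_pow_inv[of d "1/2"] d by auto
    then have N: "(1 / 2) ^ N \<le> d"
      using LeastI[of "\<lambda>N. (1 / 2 :: real) ^ N \<le> d" N0] by (simp add: N_def)
    have "N \<noteq> 0" using N d by (cases N) auto
    then obtain n where n: "N = Suc n" by (cases N) auto
    have nd: "d < (1 / 2) ^ n"
      using not_less_Least[of n "\<lambda>N. (1 / 2 :: real) ^ N \<le> d"] n by (simp add: N_def)
    have dist: "dist a y < r / 2 ^ n" "r / 2 ^ (n + 1) \<le> dist a y"
      using nd N r unfolding d_def n by (simp_all add: field_simps)
    have "indicator (ball a r) y / dist a y = 1 / dist a y" using True by simp
    also have "\<dots> \<le> 1 / (r / 2 ^ (n + 1))"
      using dist r by (intro frac_le) auto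
    also have "\<dots> = 2 ^ (n + 1) / r" by simp
    finally have "ennreal (indicator (ball a r) y / dist a y) \<le> ennreal (2 ^ (n + 1) / r)"
      by (rule ennreal_leI)
    also have "\<dots> = ?f n y" using dist by simp
    also have "\<dots> \<le> (\<Sum>n. ?f n y)"
    proof -
      have "g n \<le> suminf g" for g :: "nat \<Rightarrow> ennreal"
        using sum_le_suminf[of g "{n}"] by simp
      then show ?thesis .
    qed
    finally show ?thesis .
  qed auto
  have "(\<integral>\<^sup>+y. ennreal (indicator (ball a r) y / dist a y) \<partial>lebesgue) \<le> (\<integral>\<^sup>+y. (\<Sum>n. ?f n y) \<partial>lebesgue)"
    by (intro nn_integral_mono pt)
  also have "\<dots> = (\<Sum>n. \<integral>\<^sup>+y. ?f n y \<partial>lebesgue)"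
    by (intro nn_integral_suminf borel_measurable_times_ennreal borel_measurable_indicator) auto
  also have "\<dots> = (\<Sum>n. ennreal (2 * pi * r * (1 / 2) ^ n))"
  proof (rule suminf_cong)
    fix n
    have "(\<integral>\<^sup>+y. ?f n y \<partial>lebesgue) = ennreal (2 ^ (n + 1) / r) * ennreal (pi * (r / 2 ^ n)\<^sup>2)"
      using r by (subst nn_integral_cmult_indicator, simp, subst emeasure_lebesgue_ball) simp_all
    also have "\<dots> = ennreal (2 ^ (n + 1) / r * (pi * (r / 2 ^ n)\<^sup>2))"
      using r by (intro ennreal_mult[symmetric]) auto
    also have "2 ^ (n + 1) / r * (pi * (r / 2 ^ n)\<^sup>2) = 2 * pi * r * (1 / 2) ^ n"
      using r by (simp add: field_simps power2_eq_square)
    finally show "(\<integral>\<^sup>+y. ?f n y \<partial>lebesgue) = ennreal (2 * pi * r * (1 / 2) ^ n)" .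
  qed
  also have "\<dots> = ennreal (4 * pi * r)"
  proof (rule suminf_ennreal_eq)
    show "0 \<le> 2 * pi * r * (1 / 2) ^ n" for n using r by simp
    have "(\<lambda>n. 2 * pi * r * (1 / 2) ^ n) sums (2 * pi * r * 2)"
      using sums_mult[OF geometric_sums[of "1 / 2 :: real"], of "2 * pi * r"] by simp
    then show "(\<lambda>n. 2 * pi * r * (1 / 2) ^ n) sums (4 * pi * r)" by (simp add: mult_ac)
  qed
  finally show ?thesis .
qed

text \<open>Up to constants a disc about \<open>a\<close> is the worst set of given area
  \<open>m\<close>. With \<open>s = sqrt m\<close>, the part inside \<open>ball a s\<close>
  contributes at most \<open>4 * pi * s\<close> and the rest at most \<open>m / s = s\<close>; 4 pi
  + 1 is below 14. All later square roots of areas originate here.\<close>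

lemma nn_integral_inv_dist:
  fixes a :: "real^2"
  assumes A: "A \<in> lmeasurable"
  shows "(\<integral>\<^sup>+y. ennreal (indicator A y / dist a y) \<partial>lebesgue) \<le> ennreal (14 * sqrt (measure lebesgue A))"
proof (cases "measure lebesgue A = 0")
  case True
  have As: "A \<in> sets lebesgue" and Am: "emeasure lebesgue A = ennreal (measure lebesgue A)"
    using A by (auto simp: emeasure_eq_measure2)
  have "A \<in> null_sets lebesgue" using As Am True by auto
  then have "AE y in lebesgue. y \<notin> A" by (rule AE_not_in)
  then have "AE y in lebesgue. ennreal (indicator A y / dist a y) = 0"
    by eventually_elim simp
  then have "(\<integral>\<^sup>+y. ennreal (indicator A y / dist a y) \<partial>lebesgue) = (\<integral>\<^sup>+y. 0 \<partial>(lebesgue :: (real^2) measure))"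
    by (rule nn_integral_cong_AE)
  then show ?thesis by simp
next
  case False
  define m where "m = measure lebesgue A"
  define s where "s = sqrt m"
  have m: "m > 0" using False by (simp add: m_def zero_less_measure_iff)
  then have s: "s > 0" "s * s = m" by (auto simp: s_def)
  have As: "A \<in> sets lebesgue" and Am: "emeasure lebesgue A = ennreal m"
    using A by (auto simp: emeasure_eq_measure2 m_def)
  have pt: "ennreal (indicator A y / dist a y) \<le> ennreal (indicator (ball a s) y / dist a y) + ennreal (1 / s) * indicator A y" for y
  proof (cases "y \<in> A \<and> y \<notin> ball a s")
    case True
    then have "ennreal (1 / dist a y) \<le> ennreal (1 / s)"
      using s by (intro ennreal_leI frac_le) auto
    then show ?thesis using True by simp
  qed (auto intro: add_increasing2 split: split_indicator)
  have "(\<integral>\<^sup>+y. ennreal (indicator A y / dist a y) \<partial>lebesgue)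
     \<le> (\<integral>\<^sup>+y. ennreal (indicator (ball a s) y / dist a y) + ennreal (1 / s) * indicator A y \<partial>lebesgue)"
    by (intro nn_integral_mono pt)
  also have "\<dots> = (\<integral>\<^sup>+y. ennreal (indicator (ball a s) y / dist a y) \<partial>lebesgue) + (\<integral>\<^sup>+y. ennreal (1 / s) * indicator A y \<partial>lebesgue)"
    using As by (intro nn_integral_add measurable_compose[OF borel_measurable_inv_dist measurable_ennreal]
      borel_measurable_times_ennreal borel_measurable_indicator) auto
  also have "(\<integral>\<^sup>+y. ennreal (1 / s) * indicator A y \<partial>lebesgue) = ennreal (1 / s * m)"
    unfolding nn_integral_cmult_indicator[OF As] Am using s(1) m by (intro ennreal_mult[symmetric]) auto
  also have "(\<integral>\<^sup>+y. ennreal (indicator (ball a s) y / dist a y) \<partial>lebesgue) + ennreal (1 / s * m) \<le> ennreal (4 * pi * s) + ennreal (1 / s * m)"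
    by (intro add_right_mono nn_integral_inv_dist_ball s)
  also have "\<dots> = ennreal (4 * pi * s + 1 / s * m)"
    using s m by (intro ennreal_plus[symmetric]) auto
  also have "1 / s * m = s" using s by (auto simp: field_simps)
  also have "ennreal (4 * pi * s + s) \<le> ennreal (14 * s)"
  proof (rule ennreal_leI)
    have "4 * pi * s \<le> 13 * s" using s pi_less_4 pi_approx by (intro mult_right_mono) auto
    then show "4 * pi * s + s \<le> 14 * s" by simp
  qed
  finally show ?thesis by (simp add: s_def m_def)
qed

lemma integrable_inv_dist:
  fixes a :: "real^2"
  assumes A: "A \<in> lmeasurable"
  shows "integrable lebesgue (\<lambda>y. indicator A y / dist a y :: real)"
proof (rule integrableI_bounded)
  have As: "A \<in> sets lebesgue" using A by auto
  then show "(\<lambda>y. indicator A y / dist a y :: real) \<in> borel_measurable lebesgue" by measurable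
  have "(\<integral>\<^sup>+y. ennreal (norm (indicator A y / dist a y :: real)) \<partial>lebesgue) = (\<integral>\<^sup>+y. ennreal (indicator A y / dist a y) \<partial>lebesgue)"
    by (intro nn_integral_cong) simp
  also have "\<dots> \<le> ennreal (14 * sqrt (measure lebesgue A))"
    by (rule nn_integral_inv_dist[OF A])
  also have "\<dots> < \<infinity>" by simp
  finally show "(\<integral>\<^sup>+y. ennreal (norm (indicator A y / dist a y :: real)) \<partial>lebesgue) < \<infinity>" .
qed

lemma integral_inv_dist_le:
  fixes a :: "real^2"
  assumes A: "A \<in> lmeasurable"
  shows "(\<integral>y. indicator A y / dist a y \<partial>lebesgue) \<le> 14 * sqrt (measure lebesgue A)"
proof -
  have As: "A \<in> sets lebesgue" using A by auto
  have "(\<integral>y. indicator A y / dist a y \<partial>lebesgue) = enn2real (\<integral>\<^sup>+y. ennreal (indicator A y / dist a y) \<partial>lebesgue)"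
    using As by (intro integral_eq_nn_integral borel_measurable_inv_dist) auto
  also have "\<dots> \<le> 14 * sqrt (measure lebesgue A)"
    using nn_integral_inv_dist[OF A, of a] by (intro enn2real_leI) auto
  finally show ?thesis .
qed

lemma AE_notin_countable: "countable S \<Longrightarrow> AE y in lebesgue. (y::'a::euclidean_space) \<notin> S"
  by (intro AE_not_in null_sets_completionI countable_imp_null_set_lborel)

text \<open>\<open>S\<close> collects the points, such as the pole, where no kernel bound is
  available; being countable it is a null set.\<close>

lemma weakly_singular_integral:
  fixes F :: "real^2 \<Rightarrow> 'b::{banach, second_countable_topology}"
  assumes A: "A \<in> lmeasurable" and F: "F \<in> borel_measurable lebesgue" and S: "countable S" and C: "C \<ge> 0"
    and bnd: "\<And>y. y \<notin> S \<Longrightarrow> norm (F y) \<le> C * (indicator A y / dist a y)"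
  shows "integrable lebesgue F" "norm (integral\<^sup>L lebesgue F) \<le> C * (14 * sqrt (measure lebesgue A))"
proof -
  have int: "integrable lebesgue (\<lambda>y. C * (indicator A y / dist a y))"
    by (intro integrable_mult_right integrable_inv_dist A)
  have ae: "AE y in lebesgue. norm (F y) \<le> C * (indicator A y / dist a y)"
    using AE_notin_countable[OF S] by eventually_elim (rule bnd)
  show "integrable lebesgue F"
    by (rule Bochner_Integration.integrable_bound[OF int F]) (use ae C in auto)
  have "norm (integral\<^sup>L lebesgue F) \<le> (\<integral>y. C * (indicator A y / dist a y) \<partial>lebesgue)"
    using integral_norm_bound[of lebesgue F] integral_mono_AE[OF integrable_norm[OF \<open>integrable lebesgue F\<close>] int ae]
    by linarith
  also have "\<dots> = C * (\<integral>y. indicator A y / dist a y \<partial>lebesgue)"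
    by (rule integral_mult_right_zero)
  also have "\<dots> \<le> C * (14 * sqrt (measure lebesgue A))"
    by (rule mult_left_mono[OF integral_inv_dist_le[OF A] C])
  finally show "norm (integral\<^sup>L lebesgue F) \<le> C * (14 * sqrt (measure lebesgue A))" .
qed

text \<open>The singularity of the majorant moves with \<open>n\<close>, so a fixed majorant is not
  at hand near \<open>x\<close>. On a small disc about \<open>x\<close> both singular integrals are
  bounded by the square root of its area, uniformly in \<open>n\<close>; outside it the moving pole
  is eventually at distance at least \<open>\<delta> / 2\<close>, and ordinary dominated convergence
  applies.\<close>

lemma singular_dominated_convergence:
  fixes F :: "nat \<Rightarrow> real^2 \<Rightarrow> 'b::{banach, second_countable_topology}"
  assumes A: "A \<in> lmeasurable" and X: "X \<longlonglongrightarrow> x" and C: "C \<ge> 0" and S: "countable S"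
    and F: "\<And>n. F n \<in> borel_measurable lebesgue" and F0: "F0 \<in> borel_measurable lebesgue"
    and bnd: "\<And>n y. y \<notin> S \<Longrightarrow> norm (F n y) \<le> C * (indicator A y / dist x y + indicator A y / dist (X n) y)"
    and bd0: "\<And>y. y \<notin> S \<Longrightarrow> norm (F0 y) \<le> C * (indicator A y / dist x y)"
    and lim: "\<And>y. y \<notin> S \<Longrightarrow> (\<lambda>n. F n y) \<longlonglongrightarrow> F0 y"
  shows "(\<lambda>n. integral\<^sup>L lebesgue (F n)) \<longlonglongrightarrow> integral\<^sup>L lebesgue F0"
proof (rule LIMSEQ_I)
  fix e :: real assume e: "e > 0"
  have aeS: "AE y in lebesgue. y \<notin> S" by (rule AE_notin_countable[OF S])
  have intw: "integrable lebesgue (\<lambda>y. C * (indicator B y / dist x y + indicator B y / dist (X n) y))" if "B \<in> lmeasurable" for B n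
    by (intro integrable_mult_right Bochner_Integration.integrable_add integrable_inv_dist \<open>B \<in> lmeasurable\<close>)
  have intF: "integrable lebesgue (F n)" for n
    by (rule Bochner_Integration.integrable_bound[OF intw[OF A, of n] F])
       (use aeS bnd C in \<open>auto elim!: eventually_mono simp: abs_mult intro: order_trans\<close>)
  have intF0: "integrable lebesgue F0"
    by (rule weakly_singular_integral(1)[OF A F0 S C bd0])
  define c where "c = C + 1"
  have c: "c > 0" "C \<le> c" using C by (simp_all add: c_def)
  \<comment> \<open>The inner integrals sum to at most \<open>112 * C * \<delta>\<close>, and 112 /
    400 is below 1 / 2; dividing by \<open>c = C + 1\<close> instead of \<open>C\<close> allows
    \<open>C = 0\<close>.\<close>
  define \<delta> where "\<delta> = e / 400 / c"
  have \<delta>: "\<delta> > 0" using e c by (simp add: \<delta>_def)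
  let ?B = "ball x \<delta>"
  have AB: "A \<inter> ?B \<in> lmeasurable" using A by (intro fmeasurable_Int_fmeasurable) auto
  have mAB: "sqrt (measure lebesgue (A \<inter> ?B)) \<le> 2 * \<delta>"
  proof -
    have "measure lebesgue (A \<inter> ?B) \<le> measure lebesgue ?B"
      using A by (intro measure_mono_fmeasurable) auto
    also have "\<dots> \<le> (2 * \<delta>)\<^sup>2"
      using pi_less_4 \<delta> by (subst measure_lebesgue_ball) (simp_all add: power_mult_distrib)
    finally show ?thesis using \<delta> by (simp add: real_le_lsqrt)
  qed
  let ?in = "\<lambda>n y. indicator ?B y *\<^sub>R (F n y - F0 y)"
  let ?out = "\<lambda>n y. indicator (- ?B) y *\<^sub>R (F n y - F0 y)"
  have meas_in: "?in n \<in> borel_measurable lebesgue" "?out n \<in> borel_measurable lebesgue" for n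
    using F F0 by (auto intro!: borel_measurable_scaleR borel_measurable_diff borel_measurable_indicator)
  have bdist_in: "norm (?in n y) \<le> 2 * C * (indicator (A \<inter> ?B) y / dist x y + indicator (A \<inter> ?B) y / dist (X n) y)"
    if "y \<notin> S" for n y
  proof -
    have "norm (F n y - F0 y) \<le> C * (indicator A y / dist x y + indicator A y / dist (X n) y) + C * (indicator A y / dist x y)"
      using norm_triangle_ineq4[of "F n y" "F0 y"] bnd[OF that, of n] bd0[OF that] by linarith
    also have "\<dots> = 2 * C * (indicator A y / dist x y + indicator A y / dist (X n) y) - C * (indicator A y / dist (X n) y)"
      by (simp add: distrib_left)
    also have "\<dots> \<le> 2 * C * (indicator A y / dist x y + indicator A y / dist (X n) y)"
      using C by simp
    finally show ?thesis by (auto split: split_indicator)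
  qed
  have int_in: "norm (integral\<^sup>L lebesgue (?in n)) < e / 2" for n
  proof -
    have i1: "integrable lebesgue (\<lambda>y. 2 * C * (indicator (A \<inter> ?B) y / dist x y + indicator (A \<inter> ?B) y / dist (X n) y))"
      by (intro integrable_mult_right Bochner_Integration.integrable_add integrable_inv_dist AB)
    have ae: "AE y in lebesgue. norm (?in n y) \<le> 2 * C * (indicator (A \<inter> ?B) y / dist x y + indicator (A \<inter> ?B) y / dist (X n) y)"
      using aeS by eventually_elim (rule bdist_in)
    have i2: "integrable lebesgue (?in n)"
      by (rule Bochner_Integration.integrable_bound[OF i1 meas_in(1)]) (use ae C in \<open>auto elim!: eventually_mono simp: abs_mult\<close>)
    have "norm (integral\<^sup>L lebesgue (?in n)) \<le> (\<integral>y. 2 * C * (indicator (A \<inter> ?B) y / dist x y + indicator (A \<inter> ?B) y / dist (X n) y) \<partial>lebesgue)"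
      using integral_norm_bound[of lebesgue "?in n"] integral_mono_AE[OF integrable_norm[OF i2] i1 ae]
      by linarith
    also have "\<dots> = 2 * C * ((\<integral>y. indicator (A \<inter> ?B) y / dist x y \<partial>lebesgue) + (\<integral>y. indicator (A \<inter> ?B) y / dist (X n) y \<partial>lebesgue))"
      using integrable_inv_dist[OF AB] by (simp add: Bochner_Integration.integral_add)
    also have "\<dots> \<le> 2 * C * (14 * (2 * \<delta>) + 14 * (2 * \<delta>))"
      using integral_inv_dist_le[OF AB, of x] integral_inv_dist_le[OF AB, of "X n"] mAB C
      by (intro mult_left_mono add_mono) auto
    also have "\<dots> = C * (112 * \<delta>)" by simp
    also have "\<dots> < e / 2"
    proof -
      have "C * (112 * \<delta>) \<le> c * (112 * \<delta>)" using \<delta> c by (intro mult_right_mono) auto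
      also have "\<dots> = 112 * (c * \<delta>)" by simp
      also have "c * \<delta> = e / 400" using c by (simp add: \<delta>_def)
      also have "112 * (e / 400) < e / 2" using e by simp
      finally show ?thesis .
    qed
    finally show ?thesis .
  qed
  obtain N1 where N1: "\<And>n. n \<ge> N1 \<Longrightarrow> dist (X n) x < \<delta> / 2"
    using X \<delta> unfolding lim_sequentially by (meson half_gt_zero)
  have "(\<lambda>n. integral\<^sup>L lebesgue (?out (n + N1))) \<longlonglongrightarrow> integral\<^sup>L lebesgue (\<lambda>y::real^2. 0)"
  \<comment> \<open>Off the disc the three kernel terms are at most 1, 2 and 1 times
    \<open>C / \<delta>\<close>; 5 covers their sum.\<close>
  proof (rule integral_dominated_convergence[where w="\<lambda>y. 5 * C / \<delta> * indicator A y"])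
    show "integrable lebesgue (\<lambda>y. 5 * C / \<delta> * indicator A y)"
      using A unfolding fmeasurable_def by (intro integrable_mult_right integrable_real_indicator) blast+
    show "AE y in lebesgue. (\<lambda>n. ?out (n + N1) y) \<longlonglongrightarrow> 0"
      using aeS
    proof eventually_elim
      case (elim y)
      have "(\<lambda>n. indicator (- ?B) y *\<^sub>R (F n y - F0 y)) \<longlonglongrightarrow> indicator (- ?B) y *\<^sub>R (F0 y - F0 y)"
        by (intro tendsto_intros lim elim)
      from LIMSEQ_ignore_initial_segment[OF this, of N1] show ?case by simp
    qed
    show "AE y in lebesgue. norm (?out (n + N1) y) \<le> 5 * C / \<delta> * indicator A y" for n
      using aeS
    proof eventually_elim
      case (elim y)
      show ?case
      proof (cases "y \<in> ?B")
        case False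
        then have d1: "\<delta> \<le> dist x y" by simp
        moreover have "dist x y \<le> dist (X (n + N1)) x + dist (X (n + N1)) y"
          by (metis dist_commute dist_triangle)
        ultimately have d2: "\<delta> / 2 \<le> dist (X (n + N1)) y"
          using N1[of "n + N1"] by simp
        have aux: "indicator A y / p \<le> indicator A y / q" if "0 < q" "q \<le> p" for p q :: real
          using that by (intro frac_le) auto
        have i: "indicator A y / dist x y \<le> indicator A y / \<delta>" "indicator A y / dist (X (n + N1)) y \<le> indicator A y / (\<delta> / 2)"
          by (rule aux; use d1 d2 \<delta> in linarith)+
        have "norm (F (n + N1) y - F0 y) \<le> C * (indicator A y / dist x y + indicator A y / dist (X (n + N1)) y) + C * (indicator A y / dist x y)"
          using norm_triangle_ineq4[of "F (n + N1) y" "F0 y"] bnd[OF elim, of "n + N1"] bd0[OF elim] by linarith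
        also have "\<dots> \<le> C * (indicator A y / \<delta> + indicator A y / (\<delta> / 2)) + C * (indicator A y / \<delta>)"
          using i C by (intro add_mono mult_left_mono) auto
        also have "\<dots> \<le> 5 * C / \<delta> * indicator A y"
          using C \<delta> by (auto split: split_indicator simp: field_simps)
        finally show ?thesis using False by simp
      qed (use C \<delta> in simp)
    qed
  qed (use meas_in in auto)
  then have "(\<lambda>n. integral\<^sup>L lebesgue (?out (n + N1))) \<longlonglongrightarrow> 0" by simp
  then have "\<exists>N. \<forall>n\<ge>N. norm (integral\<^sup>L lebesgue (?out (n + N1)) - 0) < e / 2"
    by (rule LIMSEQ_D) (use e in simp)
  then obtain N2 where N2: "\<And>n. n \<ge> N2 \<Longrightarrow> norm (integral\<^sup>L lebesgue (?out (n + N1))) < e / 2"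
    by auto
  have "norm (integral\<^sup>L lebesgue (F n) - integral\<^sup>L lebesgue F0) < e" if n: "n \<ge> N1 + N2" for n
  proof -
    have intd: "integrable lebesgue (\<lambda>y. F n y - F0 y)"
      by (intro Bochner_Integration.integrable_diff intF intF0)
    have i: "integrable lebesgue (?in n)" "integrable lebesgue (?out n)"
      by (rule Bochner_Integration.integrable_bound[OF intd], use meas_in in simp, simp split: split_indicator)+
    have "integral\<^sup>L lebesgue (F n) - integral\<^sup>L lebesgue F0 = integral\<^sup>L lebesgue (\<lambda>y. ?in n y + ?out n y)"
      by (subst Bochner_Integration.integral_diff[symmetric, OF intF intF0], rule Bochner_Integration.integral_cong)
         (auto split: split_indicator)
    also have "\<dots> = integral\<^sup>L lebesgue (?in n) + integral\<^sup>L lebesgue (?out n)"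
      by (rule Bochner_Integration.integral_add[OF i])
    finally have eq: "integral\<^sup>L lebesgue (F n) - integral\<^sup>L lebesgue F0 = integral\<^sup>L lebesgue (?in n) + integral\<^sup>L lebesgue (?out n)" .
    have "n = (n - N1) + N1" "n - N1 \<ge> N2" using n by auto
    then have "norm (integral\<^sup>L lebesgue (?out n)) < e / 2" using N2[of "n - N1"] by simp
    then show ?thesis unfolding eq
      using int_in[of n] norm_triangle_ineq[of "integral\<^sup>L lebesgue (?in n)" "integral\<^sup>L lebesgue (?out n)"]
      by linarith
  qed
  then show "\<exists>N. \<forall>n\<ge>N. norm (integral\<^sup>L lebesgue (F n) - integral\<^sup>L lebesgue F0) < e"
    by blast
qed

subsection \<open>Potentials of sets\<close>

context green_domain
begin

definition pot :: "(real^2) set \<Rightarrow> real^2 \<Rightarrow> real" where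
  "pot A x = (LINT y:A|lebesgue. G x y)"

definition gpot :: "(real^2) set \<Rightarrow> real^2 \<Rightarrow> real^2" where
  "gpot A x = (LINT y:A|lebesgue. gradG x y)"

text \<open>One constant for all three kernel bounds, fixed by choice so that later estimates can
  refer to it by name.\<close>

definition CG :: real where
  "CG = (SOME C. C > 0 \<and> (\<forall>x\<in>D. \<forall>y\<in>D. norm (grad (H y) x) \<le> C / bdist x \<and>
     (x \<noteq> y \<longrightarrow> G x y \<le> C * bdist x / dist x y \<and> norm (gradG x y) \<le> C / dist x y)))"

lemma CG_pos: "CG > 0"
  and norm_grad_H_le: "\<And>x y. x \<in> D \<Longrightarrow> y \<in> D \<Longrightarrow> norm (grad (H y) x) \<le> CG / bdist x"
  and G_le: "\<And>x y. x \<in> D \<Longrightarrow> y \<in> D \<Longrightarrow> x \<noteq> y \<Longrightarrow> G x y \<le> CG * bdist x / dist x y"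
  and norm_gradG_le: "\<And>x y. x \<in> D \<Longrightarrow> y \<in> D \<Longrightarrow> x \<noteq> y \<Longrightarrow> norm (gradG x y) \<le> CG / dist x y"
proof -
  obtain C1 where C1: "C1 > 0" "\<And>x y. x \<in> D \<Longrightarrow> y \<in> D \<Longrightarrow> x \<noteq> y \<Longrightarrow> G x y \<le> C1 * bdist x / dist x y"
    by (rule G_upper) (rule that)
  obtain C2 where C2: "C2 > 0"
    "\<And>x y. x \<in> D \<Longrightarrow> y \<in> D \<Longrightarrow> norm (grad (H y) x) \<le> C2 / bdist x"
    "\<And>x y. x \<in> D \<Longrightarrow> y \<in> D \<Longrightarrow> x \<noteq> y \<Longrightarrow> norm (gradG x y) \<le> C2 / dist x y"
    by (rule gradient_bounds) (rule that)
  have "\<exists>C. C > 0 \<and> (\<forall>x\<in>D. \<forall>y\<in>D. norm (grad (H y) x) \<le> C / bdist x \<and>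
     (x \<noteq> y \<longrightarrow> G x y \<le> C * bdist x / dist x y \<and> norm (gradG x y) \<le> C / dist x y))"
  proof (intro exI[of _ "C1 + C2"] conjI ballI impI)
    show "C1 + C2 > 0" using C1 C2 by simp
    fix x y assume xy: "x \<in> D" "y \<in> D"
    show "norm (grad (H y) x) \<le> (C1 + C2) / bdist x"
      using C2(2)[OF xy] C1(1) by (simp add: add_divide_distrib add_increasing bdist_nonneg)
    assume ne: "x \<noteq> y"
    show "norm (gradG x y) \<le> (C1 + C2) / dist x y"
      using C2(3)[OF xy ne] C1(1) by (simp add: add_divide_distrib add_increasing)
    show "G x y \<le> (C1 + C2) * bdist x / dist x y"
      using C1(2)[OF xy ne] C2(1) bdist_nonneg[of x] by (simp add: distrib_right add_divide_distrib add_increasing2)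
  qed
  from someI_ex[OF this, folded CG_def] show "CG > 0"
    "\<And>x y. x \<in> D \<Longrightarrow> y \<in> D \<Longrightarrow> norm (grad (H y) x) \<le> CG / bdist x"
    "\<And>x y. x \<in> D \<Longrightarrow> y \<in> D \<Longrightarrow> x \<noteq> y \<Longrightarrow> G x y \<le> CG * bdist x / dist x y"
    "\<And>x y. x \<in> D \<Longrightarrow> y \<in> D \<Longrightarrow> x \<noteq> y \<Longrightarrow> norm (gradG x y) \<le> CG / dist x y"
    by blast+
qed

lemma subset_lmeasurable: "A \<in> sets lebesgue \<Longrightarrow> A \<subseteq> D \<Longrightarrow> A \<in> lmeasurable"
  by (rule bounded_set_imp_lmeasurable[OF bounded_subset[OF bounded_D]])

lemma measurable_indicator_D:
  fixes f :: "real^2 \<Rightarrow> 'b::{real_normed_vector, second_countable_topology}"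
  assumes "continuous_on D f" "A \<in> sets lebesgue" "A \<subseteq> D"
  shows "(\<lambda>y. indicator A y *\<^sub>R f y) \<in> borel_measurable lebesgue"
proof -
  have "(\<lambda>y. indicator D y *\<^sub>R f y) \<in> borel_measurable lebesgue"
    using assms(1) open_D by (intro measurable_lebesgueI borel_measurable_continuous_on_indicator) auto
  then have "(\<lambda>y. indicator A y *\<^sub>R (indicator D y *\<^sub>R f y)) \<in> borel_measurable lebesgue"
    by (rule borel_measurable_scaleR[OF borel_measurable_indicator[OF assms(2)]])
  moreover have "(\<lambda>y. indicator A y *\<^sub>R (indicator D y *\<^sub>R f y)) = (\<lambda>y. indicator A y *\<^sub>R f y)"
    using assms(3) by (intro ext) (auto split: split_indicator)
  ultimately show ?thesis by (simp only:)
qed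

lemma measurable_G:
  assumes x: "x \<in> D" and A: "A \<in> sets lebesgue" "A \<subseteq> D"
  shows "(\<lambda>y. indicator A y *\<^sub>R G x y) \<in> borel_measurable lebesgue"
proof (rule measurable_discrete_difference)
  have "(\<lambda>y. 1 / (2 * pi) * ln (dist x y)) \<in> borel_measurable lebesgue"
    by (intro measurable_lebesgueI borel_measurable_times borel_measurable_const borel_measurable_ln
        borel_measurable_continuous_onI continuous_intros)
  then have "(\<lambda>y. indicator A y *\<^sub>R (1 / (2 * pi) * ln (dist x y))) \<in> borel_measurable lebesgue"
    using A by (intro borel_measurable_scaleR borel_measurable_indicator)
  then show "(\<lambda>y. indicator A y *\<^sub>R H y x - indicator A y *\<^sub>R (1 / (2 * pi) * ln (dist x y))) \<in> borel_measurable lebesgue"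
    using x closure_subset[of D] by (intro borel_measurable_diff measurable_indicator_D[OF continuous_H_pole A]) auto
  show "indicator A y *\<^sub>R H y x - indicator A y *\<^sub>R (1 / (2 * pi) * ln (dist x y)) = indicator A y *\<^sub>R G x y"
    if "y \<notin> {x}" for y
    using G_eq[of y x] A subsetD[OF closure_subset x] that by (auto split: split_indicator)
qed auto

lemma measurable_gradG:
  assumes x: "x \<in> D" and A: "A \<in> sets lebesgue" "A \<subseteq> D"
  shows "(\<lambda>y. indicator A y *\<^sub>R gradG x y) \<in> borel_measurable lebesgue"
proof -
  have m: "(\<lambda>y. (1 / (2 * pi)) *\<^sub>R ((1 / (dist x y)\<^sup>2) *\<^sub>R (x - y))) \<in> borel_measurable lebesgue"
    by (intro measurable_lebesgueI borel_measurable_scaleR borel_measurable_const borel_measurable_divide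
        borel_measurable_continuous_onI continuous_intros)
  have "(\<lambda>y. indicator A y *\<^sub>R grad (H y) x - indicator A y *\<^sub>R ((1 / (2 * pi)) *\<^sub>R ((1 / (dist x y)\<^sup>2) *\<^sub>R (x - y)))) \<in> borel_measurable lebesgue"
    by (intro borel_measurable_diff measurable_indicator_D[OF continuous_grad_H_pole[OF x] A]
        borel_measurable_scaleR[OF borel_measurable_indicator[OF A(1)] m])
  then show ?thesis by (simp add: gradG_def scaleR_diff_right)
qed

text \<open>The factor \<open>bdist x\<close> records that potentials decay linearly at the
  boundary. The gradient bound lacks it but holds on all of \<open>D\<close>, and its square root is
  what makes small patches negligible.\<close>

lemma
  assumes x: "x \<in> D" and A: "A \<in> sets lebesgue" "A \<subseteq> D"
  shows integrable_G: "set_integrable lebesgue A (G x)"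
    and pot_le: "\<bar>pot A x\<bar> \<le> CG * bdist x * (14 * sqrt (measure lebesgue A))"
    and integrable_gradG: "set_integrable lebesgue A (gradG x)"
    and norm_gpot_le: "norm (gpot A x) \<le> CG * (14 * sqrt (measure lebesgue A))"
proof -
  have Al: "A \<in> lmeasurable" by (rule subset_lmeasurable[OF A])
  have 1: "norm (indicator A y *\<^sub>R G x y) \<le> CG * bdist x * (indicator A y / dist x y)" if "y \<notin> {x}" for y
    using G_le[OF x, of y] G_nonneg[OF x, of y] A that by (auto split: split_indicator)
  have 2: "norm (indicator A y *\<^sub>R gradG x y) \<le> CG * (indicator A y / dist x y)" if "y \<notin> {x}" for y
    using norm_gradG_le[OF x, of y] A that by (auto split: split_indicator)
  have C1: "0 \<le> CG * bdist x" using CG_pos bdist_nonneg by simp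
  have C2: "0 \<le> CG" using CG_pos by simp
  have S: "countable {x}" by simp
  note G = weakly_singular_integral[OF Al measurable_G[OF x A] S C1 1]
  note gG = weakly_singular_integral[OF Al measurable_gradG[OF x A] S C2 2]
  show "set_integrable lebesgue A (G x)"
    using G(1) unfolding set_integrable_def .
  show "set_integrable lebesgue A (gradG x)"
    using gG(1) unfolding set_integrable_def .
  show "\<bar>pot A x\<bar> \<le> CG * bdist x * (14 * sqrt (measure lebesgue A))"
    using G(2) unfolding set_lebesgue_integral_def pot_def real_norm_def .
  show "norm (gpot A x) \<le> CG * (14 * sqrt (measure lebesgue A))"
    using gG(2) unfolding set_lebesgue_integral_def gpot_def .
qed

lemma pot_nonneg:
  assumes x: "x \<in> D" and A: "A \<in> sets lebesgue" "A \<subseteq> D"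
  shows "pot A x \<ge> 0"
  unfolding pot_def set_lebesgue_integral_def
proof (rule integral_nonneg_AE)
  show "AE y in lebesgue. 0 \<le> indicator A y *\<^sub>R G x y"
    using AE_notin_countable[of "{x}"]
  proof (rule eventually_mono)
    show "0 \<le> indicator A y *\<^sub>R G x y" if "y \<notin> {x}" for y
      using G_nonneg[OF x, of y] A that by (auto split: split_indicator)
  qed simp
qed

lemma bdist_half:
  assumes x: "x \<in> D" and z: "z \<in> ball x (bdist x / 2)"
  shows "z \<in> D \<and> bdist x / 2 \<le> bdist z"
proof
  have d: "dist x z < bdist x / 2" using z by simp
  then have "z \<in> ball x (bdist x)" using bdist_pos[OF x] by simp
  then show "z \<in> D" using ball_bdist_subset[OF x] by blast
  show "bdist x / 2 \<le> bdist z" using bdist_lipschitz[of x z] d by linarith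
qed

lemma H_lipschitz:
  assumes x: "x \<in> D" and y: "y \<in> D" and z: "z \<in> ball x (bdist x / 2)"
  shows "\<bar>H y z - H y x\<bar> \<le> 2 * CG / bdist x * dist z x"
proof -
  have "norm (H y z - H y x) \<le> 2 * CG / bdist x * norm (z - x)"
  proof (rule differentiable_bound[where S="ball x (bdist x / 2)" and f'="\<lambda>w v. v \<bullet> grad (H y) w"])
    fix w assume w: "w \<in> ball x (bdist x / 2)"
    have wD: "w \<in> D" "bdist x / 2 \<le> bdist w" using bdist_half[OF x w] by auto
    show "(H y has_derivative (\<lambda>v. v \<bullet> grad (H y) w)) (at w within ball x (bdist x / 2))"
      using harmonic_on_GDERIV[OF H_harm[OF y] wD(1)] unfolding gderiv_def by (rule has_derivative_at_withinI)
    show "onorm (\<lambda>v. v \<bullet> grad (H y) w) \<le> 2 * CG / bdist x"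
    proof (rule onorm_le)
      fix v :: "real^2"
      have "norm (grad (H y) w) \<le> CG / bdist w" by (rule norm_grad_H_le[OF wD(1) y])
      also have "\<dots> \<le> CG / (bdist x / 2)"
        using wD(2) CG_pos bdist_pos[OF x] by (intro divide_left_mono) auto
      finally have "norm (grad (H y) w) \<le> 2 * CG / bdist x" by (simp add: mult.commute)
      then have "norm (grad (H y) w) * norm v \<le> 2 * CG / bdist x * norm v"
        by (rule mult_right_mono) simp
      moreover have "norm (v \<bullet> grad (H y) w) \<le> norm (grad (H y) w) * norm v"
        using Cauchy_Schwarz_ineq2[of v "grad (H y) w"] by (simp add: mult.commute)
      ultimately show "norm (v \<bullet> grad (H y) w) \<le> 2 * CG / bdist x * norm v"
        by (rule order_trans[rotated])
    qed
  qed (use z bdist_pos[OF x] in auto)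
  then show ?thesis by (simp add: dist_norm)
qed

lemma G_difference_le:
  assumes x: "x \<in> D"
  obtains K where "K > 0"
    "\<And>y z. y \<in> D \<Longrightarrow> z \<in> ball x (bdist x / 2) \<Longrightarrow> y \<noteq> x \<Longrightarrow> y \<noteq> z \<Longrightarrow>
       \<bar>G z y - G x y\<bar> \<le> K * dist z x * (1 / dist x y + 1 / dist z y)"
proof -
  obtain B where B: "B > 0" "\<And>x y. x \<in> closure D \<Longrightarrow> y \<in> closure D \<Longrightarrow> dist x y \<le> B"
    by (rule bounded_dist) (rule that)
  define K where "K = 2 * CG * B / bdist x + 1"
  have K: "K > 0" using B CG_pos bdist_pos[OF x] by (simp add: K_def add_pos_pos)
  have "\<bar>G z y - G x y\<bar> \<le> K * dist z x * (1 / dist x y + 1 / dist z y)"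
    if y: "y \<in> D" and z: "z \<in> ball x (bdist x / 2)" and ne: "y \<noteq> x" "y \<noteq> z" for y z
  proof -
    have zD: "z \<in> D" using bdist_half[OF x z] by auto
    have cl: "x \<in> closure D" "y \<in> closure D" "z \<in> closure D" using x y zD closure_subset by blast+
    define p q where "p = dist x y" and "q = dist z y"
    have pq: "p > 0" "q > 0" using ne by (auto simp: p_def q_def)
    have "\<bar>ln q - ln p\<bar> \<le> \<bar>q - p\<bar> / min p q"
      using pq by (intro ln_diff_abs_le) auto
    also have "\<dots> \<le> dist z x / min p q"
      using pq abs_dist_diff_le[of z y x] by (intro divide_right_mono) (auto simp: p_def q_def dist_commute)
    also have "\<dots> \<le> dist z x * (1 / p + 1 / q)"
      using pq by (auto simp: min_def divide_inverse intro!: mult_left_mono)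
    finally have 1: "\<bar>ln q - ln p\<bar> \<le> dist z x * (1 / p + 1 / q)" .
    have 2: "\<bar>H y z - H y x\<bar> \<le> 2 * CG * B / bdist x * dist z x * (1 / p + 1 / q)"
    proof -
      \<comment> \<open>The diameter bound turns the contribution of the regular part into a
        multiple of the singular weight, so one form of bound covers both parts.\<close>
      have "1 \<le> B / p" using B(2)[OF cl(1,2)] pq by (simp add: p_def)
      then have "1 \<le> B * (1 / p + 1 / q)" using pq B(1) by (simp add: distrib_left add_increasing2)
      then have "2 * CG / bdist x * dist z x * 1 \<le> 2 * CG / bdist x * dist z x * (B * (1 / p + 1 / q))"
        using CG_pos bdist_nonneg by (intro mult_left_mono) auto
      then show ?thesis using H_lipschitz[OF x y z] by (simp add: mult_ac)
    qed
    have "\<bar>G z y - G x y\<bar> \<le> \<bar>H y z - H y x\<bar> + 1 / (2 * pi) * \<bar>ln q - ln p\<bar>"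
    proof -
      have "G z y - G x y = (H y z - H y x) - 1 / (2 * pi) * (ln q - ln p)"
        using G_eq[OF y cl(1)] G_eq[OF y cl(3)] ne by (simp add: p_def q_def right_diff_distrib)
      then have "\<bar>G z y - G x y\<bar> \<le> \<bar>H y z - H y x\<bar> + \<bar>1 / (2 * pi) * (ln q - ln p)\<bar>"
        by linarith
      then show ?thesis by (simp add: abs_mult)
    qed
    moreover have "1 / (2 * pi) * \<bar>ln q - ln p\<bar> \<le> 1 * \<bar>ln q - ln p\<bar>"
      using pi_gt3 by (intro mult_right_mono) auto
    moreover have "a \<le> f + e" if "a \<le> b + c" "c \<le> 1 * d" "d \<le> e" "b \<le> f" for a b c d e f :: real
      using that by linarith
    ultimately have "\<bar>G z y - G x y\<bar> \<le> 2 * CG * B / bdist x * dist z x * (1 / p + 1 / q) + dist z x * (1 / p + 1 / q)"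
      using 1 2 by blast
    also have "\<dots> = K * dist z x * (1 / p + 1 / q)" by (simp add: K_def algebra_simps)
    finally show ?thesis unfolding p_def q_def .
  qed
  with K that show thesis by blast
qed

text \<open>Differentiation under the integral in spite of the pole: each difference quotient is
  dominated by kernels with poles at \<open>x\<close> and at \<open>X n\<close>, and the convergence
  theorem for a moving singularity stands in for a fixed majorant.\<close>

lemma GDERIV_pot:
  assumes x: "x \<in> D" and A: "A \<in> sets lebesgue" "A \<subseteq> D"
  shows "GDERIV (pot A) x :> gpot A x"
proof -
  obtain K where K: "K > 0"
    "\<And>y z. y \<in> D \<Longrightarrow> z \<in> ball x (bdist x / 2) \<Longrightarrow> y \<noteq> x \<Longrightarrow> y \<noteq> z \<Longrightarrow>
       \<bar>G z y - G x y\<bar> \<le> K * dist z x * (1 / dist x y + 1 / dist z y)"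
    by (rule G_difference_le[OF x]) (rule that)
  let ?B = "ball x (bdist x / 2)"
  have Al: "A \<in> lmeasurable" by (rule subset_lmeasurable[OF A])
  have "((\<lambda>z. norm ((pot A z - pot A x) - (z - x) \<bullet> gpot A x) / norm (z - x)) \<longlongrightarrow> 0) (at x within ?B)"
    unfolding tendsto_at_iff_sequentially o_def
  proof (intro allI impI)
    fix X assume "\<forall>n. X n \<in> ?B - {x}" and Xx: "X \<longlonglongrightarrow> x"
    then have X: "X n \<in> ?B" "X n \<noteq> x" for n by auto
    have XD: "X n \<in> D" for n using bdist_half[OF x X(1)] by auto
    define q where "q n y = (G (X n) y - G x y - (X n - x) \<bullet> gradG x y) / norm (X n - x)" for n y
    let ?F = "\<lambda>n y. indicator A y *\<^sub>R q n y"
    let ?S = "insert x (range X)"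
    have F_eq: "?F n = (\<lambda>y. (indicator A y *\<^sub>R G (X n) y - indicator A y *\<^sub>R G x y - (X n - x) \<bullet> (indicator A y *\<^sub>R gradG x y)) / norm (X n - x))" for n
      by (auto simp: q_def fun_eq_iff split: split_indicator)
    have "(\<lambda>n. integral\<^sup>L lebesgue (?F n)) \<longlonglongrightarrow> integral\<^sup>L lebesgue (\<lambda>y::real^2. 0::real)"
    proof (rule singular_dominated_convergence[OF Al Xx, where S="?S" and C="K + CG"])
      show "0 \<le> K + CG" using K CG_pos by simp
      show "countable ?S" by simp
      show "?F n \<in> borel_measurable lebesgue" for n
        unfolding F_eq
        by (intro borel_measurable_divide borel_measurable_diff borel_measurable_inner borel_measurable_const
            measurable_G measurable_gradG XD x A)
      show "(\<lambda>y. 0::real) \<in> borel_measurable lebesgue" by simp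
      show "norm (0::real) \<le> (K + CG) * (indicator A y / dist x y)" for y
        using K(1) CG_pos by (simp add: zero_le_mult_iff)
      show "norm (?F n y) \<le> (K + CG) * (indicator A y / dist x y + indicator A y / dist (X n) y)" if y: "y \<notin> ?S" for n y
      proof (cases "y \<in> A")
        case True
        then have yD: "y \<in> D" "y \<noteq> x" "y \<noteq> X n" using A y by auto
        define l where "l = norm (X n - x)"
        have l: "l > 0" using X by (simp add: l_def)
        have "\<bar>G (X n) y - G x y\<bar> \<le> K * l * (1 / dist x y + 1 / dist (X n) y)"
          using K(2)[OF yD(1) X(1) yD(2,3)] by (simp add: l_def dist_norm)
        moreover have "\<bar>(X n - x) \<bullet> gradG x y\<bar> \<le> CG * l * (1 / dist x y + 1 / dist (X n) y)"
        proof -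
          have "\<bar>(X n - x) \<bullet> gradG x y\<bar> \<le> l * norm (gradG x y)"
            unfolding l_def by (rule Cauchy_Schwarz_ineq2)
          also have "\<dots> \<le> l * (CG / dist x y)"
            using l norm_gradG_le[OF x yD(1)] yD by (intro mult_left_mono) auto
          also have "\<dots> = CG * l * (1 / dist x y)" by simp
          also have "\<dots> \<le> CG * l * (1 / dist x y + 1 / dist (X n) y)"
            using l CG_pos by (intro mult_left_mono) auto
          finally show ?thesis .
        qed
        ultimately have "\<bar>G (X n) y - G x y - (X n - x) \<bullet> gradG x y\<bar> \<le> K * l * (1 / dist x y + 1 / dist (X n) y) + CG * l * (1 / dist x y + 1 / dist (X n) y)"
          by linarith
        moreover have "K * l * s + CG * l * s = (K + CG) * s * l" for s by (simp add: algebra_simps)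
        ultimately have "\<bar>G (X n) y - G x y - (X n - x) \<bullet> gradG x y\<bar> \<le> (K + CG) * (1 / dist x y + 1 / dist (X n) y) * l"
          by simp
        then have "\<bar>q n y\<bar> \<le> (K + CG) * (1 / dist x y + 1 / dist (X n) y)"
          using l unfolding q_def l_def[symmetric] abs_divide by (simp only: abs_of_pos pos_divide_le_eq)
        then show ?thesis using True by simp
      qed simp
      show "(\<lambda>n. ?F n y) \<longlonglongrightarrow> 0" if y: "y \<notin> ?S" for y
      proof (cases "y \<in> A")
        case True
        then have yD: "y \<in> D" "x \<noteq> y" using A y by auto
        have "((\<lambda>z. G z y) has_derivative (\<lambda>h. h \<bullet> gradG x y)) (at x)"
          using GDERIV_G[OF x yD] by (simp add: gderiv_def)
        then have "((\<lambda>z. norm ((G z y - G x y) - (z - x) \<bullet> gradG x y) / norm (z - x)) \<longlongrightarrow> 0) (at x)"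
          by (simp add: has_derivative_iff_norm)
        then have "(\<lambda>n. norm ((G (X n) y - G x y) - (X n - x) \<bullet> gradG x y) / norm (X n - x)) \<longlonglongrightarrow> 0"
          using X Xx unfolding tendsto_at_iff_sequentially o_def by blast
        then have "(\<lambda>n. norm (q n y)) \<longlonglongrightarrow> 0" by (simp add: q_def)
        then have "(\<lambda>n. q n y) \<longlonglongrightarrow> 0" by (rule tendsto_norm_zero_cancel)
        then show ?thesis using True by simp
      qed simp
    qed
    then have "(\<lambda>n. integral\<^sup>L lebesgue (?F n)) \<longlonglongrightarrow> 0" by simp
    then have "(\<lambda>n. norm (integral\<^sup>L lebesgue (?F n))) \<longlonglongrightarrow> 0"
      by (rule tendsto_norm_zero)
    moreover have "norm (integral\<^sup>L lebesgue (?F n)) = norm ((pot A (X n) - pot A x) - (X n - x) \<bullet> gpot A x) / norm (X n - x)" for n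
    proof -
      have i: "integrable lebesgue (\<lambda>y. indicator A y *\<^sub>R G (X n) y)" "integrable lebesgue (\<lambda>y. indicator A y *\<^sub>R G x y)"
        "integrable lebesgue (\<lambda>y. indicator A y *\<^sub>R gradG x y)"
        using integrable_G[OF XD A] integrable_G[OF x A] integrable_gradG[OF x A] unfolding set_integrable_def by auto
      have i2: "integrable lebesgue (\<lambda>y. indicator A y *\<^sub>R G (X n) y - indicator A y *\<^sub>R G x y)"
        using i(1,2) by (rule Bochner_Integration.integrable_diff)
      have i3: "integrable lebesgue (\<lambda>y. (X n - x) \<bullet> (indicator A y *\<^sub>R gradG x y))"
        using i(3) by (rule integrable_inner_right)
      have "integral\<^sup>L lebesgue (?F n) = (pot A (X n) - pot A x - (X n - x) \<bullet> gpot A x) / norm (X n - x)"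
        unfolding F_eq pot_def gpot_def set_lebesgue_integral_def integral_divide_zero
          Bochner_Integration.integral_diff[OF i2 i3] Bochner_Integration.integral_diff[OF i(1,2)]
        using integral_inner_right[OF i(3), of "X n - x"] by simp
      then show ?thesis by simp
    qed
    ultimately show "(\<lambda>n. norm ((pot A (X n) - pot A x) - (X n - x) \<bullet> gpot A x) / norm (X n - x)) \<longlonglongrightarrow> 0"
      by simp
  qed
  moreover have "at x within ?B = at x"
    using bdist_pos[OF x] by (intro at_within_open) auto
  ultimately have "(pot A has_derivative (\<lambda>h. h \<bullet> gpot A x)) (at x)"
    unfolding has_derivative_iff_norm by (simp add: bounded_linear_inner_left)
  then show ?thesis by (simp add: gderiv_def)
qed

text \<open>Together with \<open>GDERIV_pot\<close> this makes potentials of measurable sets C^1 in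
  \<open>D\<close>, the regularity on which the weak formulation is run.\<close>

lemma continuous_gpot:
  assumes A: "A \<in> sets lebesgue" "A \<subseteq> D"
  shows "continuous_on D (gpot A)"
  unfolding continuous_on_sequentially o_def
proof (intro allI ballI impI, elim conjE)
  fix X x assume x: "x \<in> D" and XD: "\<forall>n. X n \<in> D" and Xx: "X \<longlonglongrightarrow> x"
  have Al: "A \<in> lmeasurable" by (rule subset_lmeasurable[OF A])
  let ?S = "insert x (range X)"
  show "(\<lambda>n. gpot A (X n)) \<longlonglongrightarrow> gpot A x"
    unfolding gpot_def set_lebesgue_integral_def
  proof (rule singular_dominated_convergence[OF Al Xx, where S="?S" and C="CG"])
    show "0 \<le> CG" using CG_pos by simp
    show "(\<lambda>y. indicator A y *\<^sub>R gradG (X n) y) \<in> borel_measurable lebesgue" for n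
      using measurable_gradG XD A by blast
    show "(\<lambda>y. indicator A y *\<^sub>R gradG x y) \<in> borel_measurable lebesgue"
      using measurable_gradG x A by blast
    show "norm (indicator A y *\<^sub>R gradG (X n) y) \<le> CG * (indicator A y / dist x y + indicator A y / dist (X n) y)" if "y \<notin> ?S" for n y
    proof (cases "y \<in> A")
      case True
      moreover have "X n \<noteq> y" using that by blast
      ultimately have "norm (gradG (X n) y) \<le> CG / dist (X n) y"
        using norm_gradG_le[of "X n" y] XD A by blast
      also have "\<dots> \<le> CG * (1 / dist x y + 1 / dist (X n) y)"
        using CG_pos by (simp add: distrib_left)
      finally show ?thesis using True by simp
    qed simp
    show "norm (indicator A y *\<^sub>R gradG x y) \<le> CG * (indicator A y / dist x y)" if "y \<notin> ?S" for y
      using norm_gradG_le[OF x, of y] A that by (auto split: split_indicator)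
    show "(\<lambda>n. indicator A y *\<^sub>R gradG (X n) y) \<longlonglongrightarrow> indicator A y *\<^sub>R gradG x y" if "y \<notin> ?S" for y
    proof (cases "y \<in> A")
      case True
      then have y: "y \<in> D" "y \<noteq> x" using A that by auto
      have "(\<lambda>n. grad (H y) (X n)) \<longlonglongrightarrow> grad (H y) x"
        using harmonic_on_isCont_grad[OF H_harm[OF y(1)] x] Xx by (rule isCont_tendsto_compose)
      then have "(\<lambda>n. gradG (X n) y) \<longlonglongrightarrow> gradG x y"
        unfolding gradG_def by (intro tendsto_intros Xx) (use y in auto)
      then show ?thesis by (intro tendsto_intros)
    qed simp
  qed auto
qed

end

subsection \<open>The potential of the domain is a multiple of the torsion function\<close>

lemma harmonic_on_imp_continuous_on: "harmonic_on h S \<Longrightarrow> continuous_on S h"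
  by (simp add: continuous_at_imp_continuous_on harmonic_on_isCont)

lemma circ_mean_cong:
  assumes "circ_mean f x r m" "r \<ge> 0" "\<And>z. dist x z = r \<Longrightarrow> f z = g z"
  shows "circ_mean g x r m"
  using assms(1) unfolding circ_mean_def
  by (rule has_integral_eq[rotated]) (simp add: assms(3) dist_circ[OF assms(2)])

lemma circ_mean_const: "circ_mean (\<lambda>_. c) x r c"
  using has_integral_const_real[of c 0 1] by (simp add: circ_mean_def)

text \<open>For \<open>y\<close> outside the circle the logarithm is harmonic on the disc. For
  \<open>y\<close> inside, the inverse point \<open>w\<close> lies outside, and on the circle the
  distances to \<open>y\<close> and \<open>w\<close> have the constant ratio
  \<open>d / r\<close>.\<close>

lemma circ_mean_ln_dist:
  assumes r: "r > 0" and y: "y \<noteq> x" "dist x y \<noteq> r"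
  shows "circ_mean (\<lambda>z. ln (dist z y)) x r (ln (max r (dist x y)))"
proof (cases "r < dist x y")
  case True
  have "circ_mean (\<lambda>z. ln (dist z y)) x r (ln (dist x y))"
    by (rule harmonic_circ_mean[OF r True harmonic_on_subset[OF harmonic_on_ln_dist]]) auto
  with True show ?thesis by (simp add: max_def)
next
  case False
  define d where "d = dist x y"
  have d: "0 < d" "d < r" using y False by (auto simp: d_def)
  define w where "w = x + (r\<^sup>2 / (dist y x)\<^sup>2) *\<^sub>R (y - x)"
  have xw: "dist x w = r\<^sup>2 / d"
    using d by (simp add: w_def dist_norm d_def power2_eq_square norm_minus_commute)
  have "r * d < r * r" using d r by simp
  then have rw: "r < dist x w" unfolding xw using d by (simp add: pos_less_divide_eq power2_eq_square)
  have "circ_mean (\<lambda>z. ln (dist z w)) x r (ln (dist x w))"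
    by (rule harmonic_circ_mean[OF r rw harmonic_on_subset[OF harmonic_on_ln_dist]]) auto
  from circ_mean_add[OF this circ_mean_const[of "ln (d / r)"]]
  have "circ_mean (\<lambda>z. ln (dist z w) + ln (d / r)) x r (ln (r\<^sup>2 / d) + ln (d / r))"
    unfolding xw .
  moreover have "ln (r\<^sup>2 / d) + ln (d / r) = ln r"
    using r d by (simp add: ln_div ln_realpow)
  ultimately have "circ_mean (\<lambda>z. ln (dist z w) + ln (d / r)) x r (ln r)" by simp
  then have "circ_mean (\<lambda>z. ln (dist z y)) x r (ln r)"
  proof (rule circ_mean_cong)
    fix z assume z: "dist x z = r"
    have zw: "dist z w > 0" using rw z by auto
    have "(dist z w * dist y x / r)\<^sup>2 = (dist z y)\<^sup>2 + ((dist z x)\<^sup>2 - r\<^sup>2) * ((dist y x)\<^sup>2 - r\<^sup>2) / r\<^sup>2"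
      unfolding w_def by (rule kelvin_identity[OF r y(1)])
    then have "(dist z w * dist y x / r)\<^sup>2 = (dist z y)\<^sup>2" using z by (simp add: dist_commute)
    then have "dist z w * (d / r) = dist z y"
      using r by (simp add: d_def dist_commute)
    then show "ln (dist z w) + ln (d / r) = ln (dist z y)"
      using zw d r by (metis divide_pos_pos ln_mult_pos)
  qed (use r in simp)
  with False show ?thesis by (simp add: max_def)
qed

section \<open>The excess of circular means of the logarithm\<close>

text \<open>By \<open>circ_mean_ln_dist\<close> this is the amount by which the mean over the circle
  of radius \<open>r\<close> about \<open>x\<close> of the logarithm of the distance to
  \<open>y\<close> exceeds its value at \<open>x\<close>; it vanishes for \<open>y\<close> outside
  the disc.\<close>

definition log_kernel :: "real^2 \<Rightarrow> real \<Rightarrow> real^2 \<Rightarrow> real" where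
  "log_kernel x r y = indicator (ball x r) y * ln (r / dist x y)"

definition log_kernel_mass :: real where "log_kernel_mass = (\<integral>y. log_kernel 0 1 y \<partial>lborel)"

lemma borel_measurable_log_kernel: "log_kernel x r \<in> borel_measurable borel"
  unfolding log_kernel_def[abs_def]
  by (intro borel_measurable_times borel_measurable_indicator borel_measurable_ln borel_measurable_divide
      borel_measurable_const borel_measurable_continuous_onI continuous_intros) simp

lemma log_kernel_nonneg: "r > 0 \<Longrightarrow> 0 \<le> log_kernel x r y"
  by (cases "y = x") (auto simp: log_kernel_def split: split_indicator)

lemma integrable_log_kernel:
  assumes r: "r > 0"
  shows "integrable lborel (log_kernel x r)"
proof -
  have "integrable lebesgue (\<lambda>y. r * (indicator (ball x r) y / dist x y))"
    by (intro integrable_mult_right integrable_inv_dist) simp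
  then have "integrable lebesgue (log_kernel x r)"
  proof (rule Bochner_Integration.integrable_bound)
    show "log_kernel x r \<in> borel_measurable lebesgue"
      by (rule measurable_lebesgueI[OF borel_measurable_log_kernel])
    have "norm (log_kernel x r y) \<le> norm (r * (indicator (ball x r) y / dist x y))" for y
    proof (cases "y = x \<or> y \<notin> ball x r")
      case False
      then have "ln (r / dist x y) \<le> r / dist x y - 1" "log_kernel x r y = ln (r / dist x y)"
        using r by (auto intro!: ln_le_minus_one simp: log_kernel_def)
      then show ?thesis using False log_kernel_nonneg[OF r, of x y] r by simp
    qed (auto simp: log_kernel_def)
    then show "AE y in lebesgue. norm (log_kernel x r y) \<le> norm (r * (indicator (ball x r) y / dist x y))"
      by simp
  qed
  then show ?thesis
    by (simp add: integrable_completion borel_measurable_log_kernel)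
qed

lemma integral_log_kernel:
  assumes r: "r > 0"
  shows "(\<integral>y. log_kernel x r y \<partial>lborel) = r\<^sup>2 * log_kernel_mass"
proof -
  have eq: "log_kernel x r (x + r *\<^sub>R y) = log_kernel 0 1 y" for y
    using r by (auto simp: log_kernel_def dist_norm split: split_indicator)
  have "(\<integral>y. log_kernel x r y \<partial>lborel) = (\<integral>y. log_kernel x r y \<partial>density (distr lborel borel (\<lambda>y. x + r *\<^sub>R y)) (\<lambda>_. \<bar>r\<bar> ^ DIM(real^2)))"
    using lborel_affine[of r x] r by simp
  also have "\<dots> = (\<integral>y. (\<bar>r\<bar> ^ DIM(real^2)) *\<^sub>R log_kernel x r y \<partial>distr lborel borel (\<lambda>y. x + r *\<^sub>R y))"
    using r borel_measurable_log_kernel by (subst integral_density) (auto simp del: real_scaleR_def)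
  also have "\<dots> = (\<integral>y. (\<bar>r\<bar> ^ DIM(real^2)) *\<^sub>R log_kernel x r (x + r *\<^sub>R y) \<partial>lborel)"
    using borel_measurable_log_kernel by (subst integral_distr) (auto simp del: real_scaleR_def intro!: borel_measurable_continuous_onI continuous_intros)
  also have "\<dots> = r\<^sup>2 * log_kernel_mass" using r by (simp add: eq log_kernel_mass_def)
  finally show ?thesis .
qed

text \<open>The kernel is at least ln 2 on the disc of half the radius.\<close>

lemma log_kernel_mass_pos: "log_kernel_mass > 0"
proof -
  have "ln 2 * (pi / 4) = (\<integral>y. ln 2 * indicator (ball 0 (1/2)) y \<partial>(lborel :: (real^2) measure))"
    using content_ball[of "1/2" "0::real^2"] by (simp add: unit_ball_vol_2 power2_eq_square)
  also have "\<dots> \<le> log_kernel_mass"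
    unfolding log_kernel_mass_def
  proof (rule integral_mono_AE)
    show "integrable lborel (\<lambda>y::real^2. ln 2 * indicator (ball 0 (1/2)) y :: real)"
      by (intro integrable_mult_right integrable_real_indicator) (auto simp: emeasure_ball)
    show "integrable lborel (log_kernel 0 1)" by (rule integrable_log_kernel) simp
    have "AE y in lborel. (y::real^2) \<noteq> 0" by (rule AE_lborel_singleton)
    then show "AE y in lborel. ln 2 * indicator (ball 0 (1/2)) y \<le> log_kernel 0 1 y"
    proof eventually_elim
      case (elim y)
      have "ln 2 \<le> ln (1 / norm y)" if "norm y < 1 / 2"
        using that elim by (subst ln_le_cancel_iff) (auto simp: field_simps)
      then show ?case using log_kernel_nonneg[of 1 0 y] elim
        by (auto simp: log_kernel_def split: split_indicator)
    qed
  qed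
  finally show ?thesis by (rule less_le_trans[rotated]) simp
qed

lemma harmonic_on_inner: "harmonic_on (\<lambda>x. x \<bullet> a) S"
  unfolding harmonic_on_def
  by (intro ballI exI[of _ 1] conjI exI[of _ "\<lambda>z. cnj (cx a) * z"])
     (auto intro!: holomorphic_intros simp: inner_eq_Re_cnj)

text \<open>Recentring \<bar>z\<bar>^2 / 4 at \<open>x\<close> changes it by an affine, hence
  harmonic, function; the quadratic term is then constant on circles about \<open>x\<close>.\<close>

lemma harmonic_on_torsion:
  assumes S: "open S" "Ck_on 2 \<psi> S" and lap: "\<And>x. x \<in> S \<Longrightarrow> laplacian \<psi> x = -1"
  shows "harmonic_on (\<lambda>z. \<psi> z + (dist x z)\<^sup>2 / 4) S"
proof -
  have "harmonic_on (\<lambda>z. (\<psi> z - (-1) / 4 * (norm z)\<^sup>2) - (1 / 2 * (z \<bullet> x) - (norm x)\<^sup>2 / 4)) S"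
    by (intro harmonic_on_diff harmonic_on_cmult harmonic_on_inner harmonic_on_const
        harmonic_on_laplacian_const[OF S lap])
  moreover have "(\<lambda>z. (\<psi> z - (-1) / 4 * (norm z)\<^sup>2) - (1 / 2 * (z \<bullet> x) - (norm x)\<^sup>2 / 4)) = (\<lambda>z. \<psi> z + (dist x z)\<^sup>2 / 4)"
    unfolding dist_norm power2_norm_eq_inner
    by (rule ext) (simp add: inner_diff_left inner_diff_right inner_commute field_simps)
  ultimately show ?thesis by (simp only:)
qed

lemma circ_mean_torsion:
  assumes S: "open S" "Ck_on 2 \<psi> S" and lap: "\<And>x. x \<in> S \<Longrightarrow> laplacian \<psi> x = -1"
    and r: "0 < r" "r < R" "ball x R \<subseteq> S"
  shows "circ_mean \<psi> x r (\<psi> x - r\<^sup>2 / 4)"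
proof -
  have "circ_mean (\<lambda>z. \<psi> z + (dist x z)\<^sup>2 / 4) x r (\<psi> x)"
    using harmonic_circ_mean[OF r(1,2) harmonic_on_subset[OF harmonic_on_torsion[OF S lap, of x] r(3)]] by simp
  from circ_mean_diff[OF this circ_mean_const[of "r\<^sup>2 / 4"]] show ?thesis
    by (rule circ_mean_cong) (use r in auto)
qed

context green_domain
begin

text \<open>The values \<open>G x x\<close> are unspecified. This kernel agrees with
  \<open>G\<close> off the diagonal and is explicit on it, so measurability on a product space can
  be proved for it.\<close>

definition green_kernel :: "real^2 \<Rightarrow> real^2 \<Rightarrow> real" where
  "green_kernel x y = indicator D y * (H y x - 1 / (2 * pi) * ln (dist x y))"

lemma green_kernel_eq: "x \<in> D \<Longrightarrow> y \<noteq> x \<Longrightarrow> green_kernel x y = indicator D y * G x y"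
  using G_eq[of y x] closure_subset[of D] by (auto simp: green_kernel_def split: split_indicator)

lemma borel_measurable_green_kernel: "x \<in> D \<Longrightarrow> green_kernel x \<in> borel_measurable borel"
proof -
  assume x: "x \<in> D"
  have "(\<lambda>y. indicator D y *\<^sub>R H y x) \<in> borel_measurable borel"
    using x closure_subset[of D] open_D by (intro borel_measurable_continuous_on_indicator continuous_H_pole) auto
  moreover have "(\<lambda>y. indicator D y * (1 / (2 * pi) * ln (dist x y))) \<in> borel_measurable borel"
    using open_D by (intro borel_measurable_times borel_measurable_indicator borel_measurable_ln
      borel_measurable_const borel_measurable_continuous_onI continuous_intros) auto
  ultimately have "(\<lambda>y. indicator D y *\<^sub>R H y x - indicator D y * (1 / (2 * pi) * ln (dist x y))) \<in> borel_measurable borel"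
    by (rule borel_measurable_diff)
  moreover have "green_kernel x = (\<lambda>y. indicator D y *\<^sub>R H y x - indicator D y * (1 / (2 * pi) * ln (dist x y)))"
    by (auto simp: green_kernel_def fun_eq_iff right_diff_distrib)
  ultimately show ?thesis by simp
qed

lemma D_sets: "D \<in> sets lebesgue" "D \<subseteq> D"
  using open_D by auto

lemma
  assumes x: "x \<in> D"
  shows integrable_green_kernel: "integrable lborel (green_kernel x)"
    and pot_eq_green_kernel: "pot D x = (\<integral>y. green_kernel x y \<partial>lborel)"
proof -
  have i: "integrable lebesgue (\<lambda>y. indicator D y *\<^sub>R G x y)"
    using integrable_G[OF x D_sets] by (simp add: set_integrable_def)
  have m: "green_kernel x \<in> borel_measurable lborel" "green_kernel x \<in> borel_measurable lebesgue"
    using borel_measurable_green_kernel[OF x] measurable_lebesgueI by auto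
  have ae: "AE y in lebesgue. indicator D y *\<^sub>R G x y = green_kernel x y"
    using AE_notin_countable[of "{x}"]
  proof (rule eventually_mono)
    show "indicator D y *\<^sub>R G x y = green_kernel x y" if "y \<notin> {x}" for y
      using green_kernel_eq[OF x, of y] that by simp
  qed simp
  have "integrable lebesgue (green_kernel x)"
    using i integrable_cong_AE[OF _ m(2) ae] by auto
  then show "integrable lborel (green_kernel x)"
    using m(1) by (simp add: integrable_completion)
  have "pot D x = (\<integral>y. green_kernel x y \<partial>lebesgue)"
    unfolding pot_def set_lebesgue_integral_def
    using i m ae by (intro integral_cong_AE) auto
  also have "\<dots> = (\<integral>y. green_kernel x y \<partial>lborel)"
    by (rule integral_completion[OF m(1)])
  finally show "pot D x = (\<integral>y. green_kernel x y \<partial>lborel)" .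
qed

text \<open>Continuity in the point is combined with the Lipschitz bound in the pole, which is
  uniform in the point. This supplies product measurability for the Fubini argument.\<close>

lemma continuous_H_joint: "continuous_on (D \<times> D) (\<lambda>(x, y). H y x)"
  unfolding continuous_on_sequentially o_def
proof (intro allI ballI impI, elim conjE)
  fix X p assume p: "p \<in> D \<times> D" and XD: "\<forall>n. X n \<in> D \<times> D" and Xp: "X \<longlonglongrightarrow> p"
  obtain x y where xy: "p = (x, y)" "x \<in> D" "y \<in> D" using p by auto
  define a where "a = (\<lambda>n. fst (X n))"
  define b where "b = (\<lambda>n. snd (X n))"
  have ab: "a n \<in> D" "b n \<in> D" for n using XD by (auto simp: a_def b_def mem_Times_iff)
  have lim: "a \<longlonglongrightarrow> x" "b \<longlonglongrightarrow> y"
    using tendsto_fst[OF Xp] tendsto_snd[OF Xp] xy by (auto simp: a_def b_def)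
  define c where "c = bdist y / 2"
  have c: "c > 0" using bdist_pos[OF xy(3)] by (simp add: c_def)
  have "eventually (\<lambda>n. dist (b n) y < c) sequentially"
    using lim(2) c by (rule tendstoD)
  then have ev: "eventually (\<lambda>n. norm (H (b n) (a n) - H y (a n)) \<le> dist (b n) y / c) sequentially"
  proof (rule eventually_mono)
    fix n assume n: "dist (b n) y < c"
    have "c \<le> bdist y" "c \<le> bdist (b n)"
      using bdist_lipschitz[of y "b n"] n c by (auto simp: c_def dist_commute)
    then show "norm (H (b n) (a n) - H y (a n)) \<le> dist (b n) y / c"
      using H_diff[OF ab(2) xy(3) subsetD[OF closure_subset ab(1)] c] by simp
  qed
  have "(\<lambda>n. dist (b n) y / c) \<longlonglongrightarrow> 0"
    using lim(2) tendsto_dist_iff tendsto_divide_zero by blast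
  with ev have 1: "(\<lambda>n. H (b n) (a n) - H y (a n)) \<longlonglongrightarrow> 0"
    by (rule Lim_null_comparison)
  have 2: "(\<lambda>n. H y (a n)) \<longlonglongrightarrow> H y x"
    using harmonic_on_isCont[OF H_harm[OF xy(3)] xy(2)] lim(1) by (rule isCont_tendsto_compose)
  show "(\<lambda>n. case X n of (x, y) \<Rightarrow> H y x) \<longlonglongrightarrow> (case p of (x, y) \<Rightarrow> H y x)"
    using tendsto_add[OF 1 2] xy(1) by (simp add: a_def b_def case_prod_beta)
qed

lemma continuous_pot: "A \<in> sets lebesgue \<Longrightarrow> A \<subseteq> D \<Longrightarrow> continuous_on D (pot A)"
  using GDERIV_pot unfolding gderiv_def
  by (meson continuous_at_imp_continuous_on has_derivative_continuous)

lemma circ_in_D: "x \<in> D \<Longrightarrow> 0 < r \<Longrightarrow> r < bdist x \<Longrightarrow> circ x r t \<in> D"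
  using ball_bdist_subset[of x] dist_circ[of r x t] by (force simp: subset_eq)

text \<open>The regular part reproduces its value at the centre; the logarithm contributes the
  excess recorded by \<open>log_kernel\<close>.\<close>

lemma circ_mean_G:
  assumes x: "x \<in> D" and y: "y \<in> D" and r: "0 < r" "r < bdist x" and ne: "y \<noteq> x" "dist x y \<noteq> r"
  shows "circ_mean (\<lambda>z. green_kernel z y) x r (green_kernel x y - 1 / (2 * pi) * log_kernel x r y)"
proof -
  have "circ_mean (\<lambda>z. H y z - 1 / (2 * pi) * ln (dist z y)) x r (H y x - 1 / (2 * pi) * ln (max r (dist x y)))"
    by (intro circ_mean_diff circ_mean_cmult circ_mean_ln_dist r ne
        harmonic_circ_mean[OF r harmonic_on_subset[OF H_harm[OF y] ball_bdist_subset[OF x]]])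
  moreover have "H y x - 1 / (2 * pi) * ln (max r (dist x y)) = green_kernel x y - 1 / (2 * pi) * log_kernel x r y"
    using y ne r by (auto simp: green_kernel_def log_kernel_def max_def ln_div right_diff_distrib diff_divide_distrib)
  moreover have "(\<lambda>z. green_kernel z y) = (\<lambda>z. H y z - 1 / (2 * pi) * ln (dist z y))"
    using y by (simp add: green_kernel_def)
  ultimately show ?thesis by (simp only:)
qed

text \<open>Comparing circular means identifies the potential of \<open>D\<close> with a multiple of \<open>\<psi>\<^sub>0\<close>
  without second derivatives of the potential.\<close>

lemma circ_mean_potD:
  assumes x: "x \<in> D" and r: "0 < r" "r < bdist x"
  shows "circ_mean (pot D) x r (pot D x - r\<^sup>2 * log_kernel_mass / (2 * pi))"
proof -
  \<comment> \<open>The integral of \<open>f\<close> over circle parameter and pole, taken in both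
    orders, gives the mean of the potential on one side and its central value minus the integrated
    excess on the other.\<close>
  define f where "f = (\<lambda>t y. indicator {0..1::real} t * green_kernel (circ x r t) y)"
  have cD: "circ x r t \<in> D" for t by (rule circ_in_D[OF x r])
  have contu: "continuous_on {0..1} (\<lambda>t. pot D (circ x r t))"
    using continuous_on_compose2[OF continuous_pot[OF D_sets] continuous_circ] cD by blast
  have meas: "case_prod f \<in> borel_measurable (lborel \<Otimes>\<^sub>M lborel)"
  proof -
    have "(\<lambda>p. indicator ({0..1} \<times> D) p *\<^sub>R H (snd p) (circ x r (fst p))) \<in> borel_measurable borel"
    proof (rule borel_measurable_continuous_on_indicator)
      show "{0..1::real} \<times> D \<in> sets borel"
        unfolding borel_prod[symmetric] using open_D by (intro pair_measureI) auto
      show "continuous_on ({0..1} \<times> D) (\<lambda>p. H (snd p) (circ x r (fst p)))"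
        by (rule continuous_on_compose2[OF continuous_H_joint, of _ "\<lambda>p. (circ x r (fst p), snd p)", simplified])
           (auto intro!: continuous_intros continuous_on_compose2[OF continuous_circ[of UNIV]] cD)
    qed
    moreover have "(\<lambda>p. indicator ({0..1} \<times> D) p *\<^sub>R (1 / (2 * pi) * ln (dist (circ x r (fst p)) (snd p)))) \<in> borel_measurable borel"
    proof (intro borel_measurable_scaleR borel_measurable_indicator borel_measurable_times borel_measurable_const borel_measurable_ln)
      show "{0..1::real} \<times> D \<in> sets borel"
        unfolding borel_prod[symmetric] using open_D by (intro pair_measureI) auto
      show "(\<lambda>p. dist (circ x r (fst p)) (snd p)) \<in> borel_measurable borel"
        by (intro borel_measurable_continuous_onI continuous_intros continuous_on_compose2[OF continuous_circ[of UNIV]]) auto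
    qed
    ultimately have "(\<lambda>p. indicator ({0..1} \<times> D) p *\<^sub>R H (snd p) (circ x r (fst p)) - indicator ({0..1} \<times> D) p *\<^sub>R (1 / (2 * pi) * ln (dist (circ x r (fst p)) (snd p)))) \<in> borel_measurable borel"
      by (rule borel_measurable_diff)
    moreover have "case_prod f = (\<lambda>p. indicator ({0..1} \<times> D) p *\<^sub>R H (snd p) (circ x r (fst p)) - indicator ({0..1} \<times> D) p *\<^sub>R (1 / (2 * pi) * ln (dist (circ x r (fst p)) (snd p))))"
      by (auto simp: f_def green_kernel_def fun_eq_iff split: split_indicator)
    ultimately have "case_prod f \<in> borel_measurable borel" by simp
    then show ?thesis unfolding borel_prod[symmetric] by simp
  qed
  have inner: "integrable lborel (f t)" "(\<integral>y. f t y \<partial>lborel) = indicator {0..1} t *\<^sub>R pot D (circ x r t)"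
    "(\<integral>y. norm (f t y) \<partial>lborel) = indicator {0..1} t *\<^sub>R pot D (circ x r t)" for t
  proof -
    show "integrable lborel (f t)"
      unfolding f_def using integrable_green_kernel[OF cD] by (rule integrable_mult_right)
    show 1: "(\<integral>y. f t y \<partial>lborel) = indicator {0..1} t *\<^sub>R pot D (circ x r t)"
      unfolding f_def using pot_eq_green_kernel[OF cD, of t] by simp
    \<comment> \<open>Nonnegativity of \<open>G\<close> identifies the norm with the function, so
      absolute integrability reduces to continuity of the potential along the circle.\<close>
    have "AE y in lborel. y \<noteq> circ x r t" by (rule AE_lborel_singleton)
    then have "AE y in lborel. norm (f t y) = f t y"
    proof eventually_elim
      case (elim y)
      then have "green_kernel (circ x r t) y = indicator D y * G (circ x r t) y" by (intro green_kernel_eq cD)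
      then have "0 \<le> green_kernel (circ x r t) y"
        using G_nonneg[OF cD, of y t] elim by (auto split: split_indicator)
      then show ?case by (simp add: f_def)
    qed
    then have "(\<integral>y. norm (f t y) \<partial>lborel) = (\<integral>y. f t y \<partial>lborel)"
      using \<open>integrable lborel (f t)\<close> by (intro integral_cong_AE) auto
    with 1 show "(\<integral>y. norm (f t y) \<partial>lborel) = indicator {0..1} t *\<^sub>R pot D (circ x r t)" by simp
  qed
  have intu: "integrable lborel (\<lambda>t. indicator {0..1} t *\<^sub>R pot D (circ x r t))"
    using borel_integrable_compact[OF _ contu] by simp
  have intf: "integrable (lborel \<Otimes>\<^sub>M lborel) (case_prod f)"
    by (rule lborel_pair.Fubini_integrable[OF meas]) (use intu inner in simp_all)
  have outer: "AE y in lborel. (\<integral>t. f t y \<partial>lborel) = green_kernel x y - 1 / (2 * pi) * log_kernel x r y"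
  proof -
    have s: "sphere x r \<in> null_sets lborel"
      using negligible_sphere[of x r] by (simp add: negligible_iff_null_sets null_sets_completion_iff)
    show ?thesis
      using AE_lborel_singleton[of x] AE_not_in[OF s]
    proof eventually_elim
      case (elim y)
      show ?case
      proof (cases "y \<in> D")
        case True
        have ne: "y \<noteq> x" "dist x y \<noteq> r" using elim by auto
        have m: "circ_mean (\<lambda>z. green_kernel z y) x r (green_kernel x y - 1 / (2 * pi) * log_kernel x r y)"
          by (rule circ_mean_G[OF x True r ne])
        have cne: "circ x r t \<noteq> y" for t using dist_circ[of r x t] r ne by auto
        have "continuous_on {0..1} (\<lambda>t. green_kernel (circ x r t) y)"
          unfolding green_kernel_def
          by (intro continuous_intros continuous_on_compose2[OF harmonic_on_imp_continuous_on[OF H_harm[OF True]] continuous_circ])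
             (use cD cne in auto)
        then have "set_integrable lborel {0..1} (\<lambda>t. green_kernel (circ x r t) y)"
          unfolding set_integrable_def by (intro borel_integrable_compact) auto
        from set_borel_integral_eq_integral(2)[OF this]
        have "(\<integral>t. f t y \<partial>lborel) = integral {0..1} (\<lambda>t. green_kernel (circ x r t) y)"
          by (simp add: f_def set_lebesgue_integral_def)
        then show ?thesis using m unfolding circ_mean_def by (simp add: integral_unique)
      next
        case False
        have "y \<notin> ball x r" using False ball_bdist_subset[OF x] r by force
        then show ?thesis using False by (simp add: f_def green_kernel_def log_kernel_def)
      qed
    qed
  qed
  have mo: "(\<lambda>y. \<integral>t. f t y \<partial>lborel) \<in> borel_measurable lborel"
    using lborel_pair.integrable_snd[OF intf] by auto
  have i2: "integrable lborel (\<lambda>y. 1 / (2 * pi) * log_kernel x r y)"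
    by (intro integrable_mult_right integrable_log_kernel r)
  have "(\<integral>t. indicator {0..1} t *\<^sub>R pot D (circ x r t) \<partial>lborel) = (\<integral>t. \<integral>y. f t y \<partial>lborel \<partial>lborel)"
    by (simp add: inner)
  also have "\<dots> = (\<integral>y. \<integral>t. f t y \<partial>lborel \<partial>lborel)"
    by (rule lborel_pair.Fubini_integral[OF intf, symmetric])
  also have "\<dots> = (\<integral>y. green_kernel x y - 1 / (2 * pi) * log_kernel x r y \<partial>lborel)"
    by (intro integral_cong_AE mo outer) (use borel_measurable_integrable[OF integrable_green_kernel[OF x]] borel_measurable_integrable[OF i2] in auto)
  also have "\<dots> = pot D x - 1 / (2 * pi) * (r\<^sup>2 * log_kernel_mass)"
    by (subst Bochner_Integration.integral_diff[OF integrable_green_kernel[OF x] i2])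
       (simp add: pot_eq_green_kernel[OF x] integral_log_kernel[OF r(1)])
  finally have eq: "(\<integral>t. indicator {0..1} t *\<^sub>R pot D (circ x r t) \<partial>lborel) = pot D x - r\<^sup>2 * log_kernel_mass / (2 * pi)" by simp
  have "set_integrable lborel {0..1} (\<lambda>t. pot D (circ x r t))"
    using intu by (simp add: set_integrable_def)
  from set_borel_integral_eq_integral[OF this] eq
  show ?thesis unfolding circ_mean_def set_lebesgue_integral_def by (metis integrable_integral)
qed

text \<open>The bound by a multiple of \<open>bdist\<close> forces the potential to 0 at the
  frontier.\<close>

lemma pot_tendsto_frontier:
  assumes A: "A \<in> sets lebesgue" "A \<subseteq> D"
  shows "continuous_on (closure D) (\<lambda>x. if x \<in> D then pot A x else 0)"
  unfolding continuous_on_sequentially o_def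
proof (intro allI ballI impI, elim conjE)
  let ?u = "\<lambda>x. if x \<in> D then pot A x else 0"
  fix X x assume x: "x \<in> closure D" and XD: "\<forall>n. X n \<in> closure D" and Xx: "X \<longlonglongrightarrow> x"
  show "(\<lambda>n. ?u (X n)) \<longlonglongrightarrow> ?u x"
  proof (cases "x \<in> D")
    case True
    have "eventually (\<lambda>n. X n \<in> D) sequentially"
      by (rule topological_tendstoD[OF Xx open_D True])
    then have ev: "eventually (\<lambda>n. pot A (X n) = ?u (X n)) sequentially"
      by (rule eventually_mono) simp
    have "isCont (pot A) x" using continuous_pot[OF A] open_D True continuous_on_eq_continuous_at by blast
    then have "(\<lambda>n. pot A (X n)) \<longlonglongrightarrow> pot A x"
      using Xx by (rule isCont_tendsto_compose)
    then show ?thesis using True Lim_transform_eventually[OF _ ev] by simp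
  next
    case False
    then have xf: "x \<in> frontier D" using x open_D by (simp add: frontier_def interior_open)
    let ?c = "CG * (14 * sqrt (measure lebesgue A))"
    have b: "norm (?u (X n)) \<le> ?c * dist (X n) x" for n
    proof (cases "X n \<in> D")
      case True
      have "\<bar>pot A (X n)\<bar> \<le> ?c * bdist (X n)" using pot_le[OF True A] by (simp add: mult_ac)
      also have "\<dots> \<le> ?c * dist (X n) x" using bdist_le[OF xf] CG_pos by (intro mult_left_mono) auto
      finally show ?thesis using True by simp
    qed (use CG_pos in simp)
    have l: "(\<lambda>n. ?c * dist (X n) x) \<longlonglongrightarrow> 0"
      using Xx tendsto_dist_iff tendsto_mult_right_zero by blast
    have "(\<lambda>n. ?u (X n)) \<longlonglongrightarrow> 0"
      by (rule Lim_null_comparison[OF _ l], rule always_eventually, rule allI, rule b)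
    then show ?thesis using False by simp
  qed
qed

text \<open>In fact \<open>log_kernel_mass = pi / 2\<close> and \<open>C0 = 1\<close>, but only positivity matters.\<close>

definition C0 :: real where "C0 = 2 * log_kernel_mass / pi"

lemma C0_pos: "C0 > 0" using log_kernel_mass_pos by (simp add: C0_def)

text \<open>Circular means of both functions fall below the central value by a multiple of
  \<open>r\<^sup>2\<close>, and \<open>C0\<close> is chosen to make the deficits agree. The
  difference has the exact mean value property and zero boundary values; the maximum principle
  applies to it and to its negative.\<close>

lemma potD_eq_torsion:
  assumes \<psi>: "torsion_function D \<psi>" and x: "x \<in> D"
  shows "pot D x = C0 * \<psi> x"
proof -
  have cont\<psi>: "continuous_on (closure D) \<psi>" and ck: "Ck_on 2 \<psi> D"
    and lap: "\<And>x. x \<in> D \<Longrightarrow> laplacian \<psi> x = -1" and z: "\<And>x. x \<in> frontier D \<Longrightarrow> \<psi> x = 0"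
    using \<psi> unfolding torsion_function_def by force+
  let ?w = "\<lambda>x. (if x \<in> D then pot D x else 0) - C0 * \<psi> x"
  have contw: "continuous_on (closure D) ?w"
    by (intro continuous_on_diff pot_tendsto_frontier D_sets continuous_on_mult continuous_on_const cont\<psi>)
  have mv: "\<exists>R>0. \<forall>r. 0 < r \<longrightarrow> r < R \<longrightarrow> circ_mean ?w x r (?w x)" if x: "x \<in> D" for x
  proof (intro exI[of _ "bdist x"] conjI allI impI)
    show "bdist x > 0" by (rule bdist_pos[OF x])
    fix r assume r: "0 < r" "r < bdist x"
    have "circ_mean (\<lambda>x. pot D x - C0 * \<psi> x) x r ((pot D x - r\<^sup>2 * log_kernel_mass / (2 * pi)) - C0 * (\<psi> x - r\<^sup>2 / 4))"
      by (intro circ_mean_diff circ_mean_cmult circ_mean_potD[OF x r]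
          circ_mean_torsion[OF open_D ck lap r ball_bdist_subset[OF x]])
    moreover have "(pot D x - r\<^sup>2 * log_kernel_mass / (2 * pi)) - C0 * (\<psi> x - r\<^sup>2 / 4) = ?w x"
      using x by (simp add: C0_def right_diff_distrib)
    ultimately have "circ_mean (\<lambda>x. pot D x - C0 * \<psi> x) x r (?w x)" by simp
    then show "circ_mean ?w x r (?w x)"
      by (rule circ_mean_cong) (use r ball_bdist_subset[OF x] in \<open>auto simp: subset_eq\<close>)
  qed
  have f: "?w x = 0" if "x \<in> frontier D" for x
    using that z frontier_not_in by simp
  have xc: "x \<in> closure D" using x closure_subset by blast
  have 1: "?w x \<le> 0"
    by (rule maximum_principle_circ_mean[OF open_D bounded_D contw mv _ xc]) (use f in auto)
  have contw': "continuous_on (closure D) (\<lambda>x. (-1) * ?w x)"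
    by (intro continuous_on_mult continuous_on_const contw)
  have mv': "\<exists>R>0. \<forall>r. 0 < r \<longrightarrow> r < R \<longrightarrow> circ_mean (\<lambda>x. (-1) * ?w x) x r ((-1) * ?w x)" if x: "x \<in> D" for x
    using mv[OF x] circ_mean_cmult[of ?w x _ "?w x" "-1"] by blast
  have 2: "(-1) * ?w x \<le> 0"
    by (rule maximum_principle_circ_mean[OF open_D bounded_D contw' mv' _ xc]) (use f in auto)
  show ?thesis using 1 2 x by simp
qed

end

subsection \<open>Differentiation under the integral sign\<close>

lemma GDERIV_lipschitz:
  fixes f :: "'a::euclidean_space \<Rightarrow> real"
  assumes S: "convex S" and d: "\<And>z. z \<in> S \<Longrightarrow> GDERIV f z :> g z" and bnd: "\<And>z. z \<in> S \<Longrightarrow> norm (g z) \<le> M"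
    and xy: "x \<in> S" "y \<in> S"
  shows "\<bar>f x - f y\<bar> \<le> M * norm (x - y)"
proof -
  have "norm (f x - f y) \<le> M * norm (x - y)"
  proof (rule differentiable_bound[OF S _ _ xy, where f'="\<lambda>z h. h \<bullet> g z"])
    fix z assume z: "z \<in> S"
    show "(f has_derivative (\<lambda>h. h \<bullet> g z)) (at z within S)"
      using d[OF z] unfolding gderiv_def by (rule has_derivative_at_withinI)
    show "onorm (\<lambda>h. h \<bullet> g z) \<le> M"
    proof (rule onorm_le)
      fix h
      have "norm (h \<bullet> g z) \<le> norm (g z) * norm h"
        using Cauchy_Schwarz_ineq2[of h "g z"] by (simp add: mult.commute)
      also have "\<dots> \<le> M * norm h" using bnd[OF z] by (rule mult_right_mono) simp
      finally show "norm (h \<bullet> g z) \<le> M * norm h" .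
    qed
  qed
  then show ?thesis by simp
qed

text \<open>The gradient bound dominates the difference quotients by the mean value inequality; the
  factor 2 in the majorant pays for the subtracted linear term. It is meant for kernels without a
  pole, such as convolution kernels.\<close>

lemma leibniz_gradient:
  fixes K :: "'a::euclidean_space \<Rightarrow> 'a \<Rightarrow> real"
  assumes e: "e > 0" and d: "\<And>z y. z \<in> ball x e \<Longrightarrow> GDERIV (\<lambda>z. K z y) z :> k z y"
    and bnd: "\<And>z y. z \<in> ball x e \<Longrightarrow> norm (k z y) \<le> w y" and w: "integrable lborel w"
    and int: "\<And>z. z \<in> ball x e \<Longrightarrow> integrable lborel (K z)" and m: "k x \<in> borel_measurable lborel"
  shows "integrable lborel (k x)" "GDERIV (\<lambda>z. \<integral>y. K z y \<partial>lborel) x :> (\<integral>y. k x y \<partial>lborel)"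
proof -
  have xB: "x \<in> ball x e" using e by simp
  show ik: "integrable lborel (k x)"
    by (rule Bochner_Integration.integrable_bound[OF w m])
       (use bnd[OF xB] in \<open>auto intro!: AE_I2 order_trans[OF bnd[OF xB]]\<close>)
  let ?I = "\<lambda>z. \<integral>y. K z y \<partial>lborel" and ?g = "\<integral>y. k x y \<partial>lborel"
  have "((\<lambda>z. norm ((?I z - ?I x) - (z - x) \<bullet> ?g) / norm (z - x)) \<longlongrightarrow> 0) (at x within ball x e)"
    unfolding tendsto_at_iff_sequentially o_def
  proof (intro allI impI)
    fix X assume "\<forall>n. X n \<in> ball x e - {x}" and Xx: "X \<longlonglongrightarrow> x"
    then have X: "X n \<in> ball x e" "X n \<noteq> x" for n by auto
    define q where "q n y = (K (X n) y - K x y - (X n - x) \<bullet> k x y) / norm (X n - x)" for n y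
    have i2: "integrable lborel (\<lambda>y. K (X n) y - K x y)" for n
      by (intro Bochner_Integration.integrable_diff int X xB)
    have i3: "integrable lborel (\<lambda>y. (X n - x) \<bullet> k x y)" for n
      using ik by (rule integrable_inner_right)
    have iq: "integrable lborel (q n)" for n
      unfolding q_def by (intro integrable_divide Bochner_Integration.integrable_diff[OF i2 i3])
    have "(\<lambda>n. integral\<^sup>L lborel (q n)) \<longlonglongrightarrow> integral\<^sup>L lborel (\<lambda>y::'a. 0::real)"
    proof (rule integral_dominated_convergence[where w="\<lambda>y. 2 * w y"])
      show "integrable lborel (\<lambda>y. 2 * w y)" using w by simp
      show "q n \<in> borel_measurable lborel" for n using iq by auto
      show "AE y in lborel. (\<lambda>n. q n y) \<longlonglongrightarrow> 0"
      proof (rule AE_I2)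
        fix y
        have "((\<lambda>z. K z y) has_derivative (\<lambda>h. h \<bullet> k x y)) (at x)"
          using d[OF xB, of y] by (simp add: gderiv_def)
        then have "((\<lambda>z. norm ((K z y - K x y) - (z - x) \<bullet> k x y) / norm (z - x)) \<longlongrightarrow> 0) (at x)"
          by (simp add: has_derivative_iff_norm)
        then have "(\<lambda>n. norm ((K (X n) y - K x y) - (X n - x) \<bullet> k x y) / norm (X n - x)) \<longlonglongrightarrow> 0"
          using X Xx unfolding tendsto_at_iff_sequentially o_def by blast
        then have "(\<lambda>n. norm (q n y)) \<longlonglongrightarrow> 0" by (simp add: q_def)
        then show "(\<lambda>n. q n y) \<longlonglongrightarrow> 0" by (rule tendsto_norm_zero_cancel)
      qed
      show "AE y in lborel. norm (q n y) \<le> 2 * w y" for n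
      proof (rule AE_I2)
        fix y
        define l where "l = norm (X n - x)"
        have l: "l > 0" using X by (simp add: l_def)
        have "\<bar>K (X n) y - K x y\<bar> \<le> w y * l"
          unfolding l_def by (rule GDERIV_lipschitz[OF convex_ball d bnd X(1) xB])
        moreover have "\<bar>(X n - x) \<bullet> k x y\<bar> \<le> w y * l"
          using Cauchy_Schwarz_ineq2[of "X n - x" "k x y"] mult_left_mono[OF bnd[OF xB, of y] norm_ge_zero[of "X n - x"]]
          by (simp add: l_def mult.commute)
        ultimately have "\<bar>K (X n) y - K x y - (X n - x) \<bullet> k x y\<bar> \<le> 2 * w y * l"
          by linarith
        then show "norm (q n y) \<le> 2 * w y"
          using l unfolding q_def l_def[symmetric] real_norm_def abs_divide by (simp only: abs_of_pos pos_divide_le_eq)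
      qed
    qed simp
    then have "(\<lambda>n. integral\<^sup>L lborel (q n)) \<longlonglongrightarrow> 0" by simp
    then have "(\<lambda>n. norm (integral\<^sup>L lborel (q n))) \<longlonglongrightarrow> 0"
      by (rule tendsto_norm_zero)
    moreover have "integral\<^sup>L lborel (q n) = (?I (X n) - ?I x - (X n - x) \<bullet> ?g) / norm (X n - x)" for n
      unfolding q_def integral_divide_zero Bochner_Integration.integral_diff[OF i2 i3]
        Bochner_Integration.integral_diff[OF int[OF X(1)] int[OF xB]]
      using integral_inner_right[OF ik, of "X n - x"] by simp
    ultimately show "(\<lambda>n. norm ((?I (X n) - ?I x) - (X n - x) \<bullet> ?g) / norm (X n - x)) \<longlonglongrightarrow> 0"
      by simp
  qed
  moreover have "at x within ball x e = at x"
    using e by (intro at_within_open) auto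
  ultimately show "GDERIV ?I x :> ?g"
    unfolding gderiv_def has_derivative_iff_norm by (simp add: bounded_linear_inner_left)
qed

subsection \<open>Continuously differentiable functions with compact support\<close>

text \<open>The gradient is an explicit argument and \<open>K\<close> any compact set outside which
  \<open>f\<close> vanishes, so products and extensions by zero can be described pointwise with the
  same \<open>K\<close>.\<close>

definition C1c :: "('a::euclidean_space \<Rightarrow> real) \<Rightarrow> ('a \<Rightarrow> 'a) \<Rightarrow> 'a set \<Rightarrow> bool" where
  "C1c f g K \<longleftrightarrow> compact K \<and> (\<forall>x. GDERIV f x :> g x) \<and> continuous_on UNIV g \<and> (\<forall>x. x \<notin> K \<longrightarrow> f x = 0)"

lemma GDERIV_const_imp:
  assumes "GDERIV (\<lambda>x. c) x :> g" shows "g = (0::'a::euclidean_space)"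
  using GDERIV_imp_grad[OF assms] GDERIV_imp_grad[OF GDERIV_const[of c x]] by simp

lemma C1c_grad_zero: "C1c f g K \<Longrightarrow> x \<notin> K \<Longrightarrow> g x = 0"
proof -
  assume C: "C1c f g K" and x: "x \<notin> K"
  have "GDERIV (\<lambda>x. 0) x :> g x"
  proof (rule GDERIV_cong_open)
    show "GDERIV f x :> g x" "open (- K)" "x \<in> - K" "\<And>y. y \<in> - K \<Longrightarrow> f y = 0"
      using C x by (simp_all add: C1c_def compact_imp_closed open_Compl)
  qed
  then show ?thesis by (rule GDERIV_const_imp)
qed

lemma C1c_continuous: "C1c f g K \<Longrightarrow> continuous_on UNIV f"
  unfolding C1c_def gderiv_def by (meson continuous_at_imp_continuous_on has_derivative_continuous)

lemma compact_support_bounded: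
  fixes g :: "'a::metric_space \<Rightarrow> 'b::real_normed_vector"
  assumes "compact K" "continuous_on UNIV g" "\<And>x. x \<notin> K \<Longrightarrow> g x = 0"
  obtains M where "M > 0" "\<And>x. norm (g x) \<le> M"
proof -
  have "bounded (g ` K)"
    by (intro compact_imp_bounded compact_continuous_image continuous_on_subset[OF assms(2)] assms(1)) simp
  then obtain B where B: "\<And>x. x \<in> K \<Longrightarrow> norm (g x) \<le> B"
    unfolding bounded_iff by (metis imageI)
  have "norm (g x) \<le> max B 1" for x
    using B assms(3) by (cases "x \<in> K") (auto simp: le_max_iff_disj)
  then show thesis using that[of "max B 1"] by simp
qed

lemma compact_support_integrable:
  fixes f :: "'a::euclidean_space \<Rightarrow> 'b::{banach, second_countable_topology}"
  assumes "compact K" "continuous_on UNIV f" "\<And>x. x \<notin> K \<Longrightarrow> f x = 0"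
  shows "integrable lborel f"
proof -
  have "integrable lborel (\<lambda>x. indicator K x *\<^sub>R f x)"
    using assms continuous_on_subset by (intro borel_integrable_compact) blast+
  moreover have "(\<lambda>x. indicator K x *\<^sub>R f x) = f"
    using assms(3) by (auto simp: fun_eq_iff split: split_indicator)
  ultimately show ?thesis by simp
qed

lemma compact_support_uniformly_continuous:
  fixes g :: "'a::euclidean_space \<Rightarrow> 'b::real_normed_vector"
  assumes K: "compact K" and g: "continuous_on UNIV g" "\<And>x. x \<notin> K \<Longrightarrow> g x = 0" and e: "e > 0"
  obtains d where "d > 0" "\<And>x y. norm y \<le> d \<Longrightarrow> norm (g (x - y) - g x) \<le> e"
proof -
  obtain R where R: "\<And>x. x \<in> K \<Longrightarrow> norm x \<le> R"
    using compact_imp_bounded[OF K] unfolding bounded_iff by auto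
  let ?B = "cball (0::'a) (R + 2)"
  have "uniformly_continuous_on ?B g"
    by (intro compact_uniformly_continuous continuous_on_subset[OF g(1)]) auto
  then have "\<exists>d>0. \<forall>x\<in>?B. \<forall>y\<in>?B. dist y x < d \<longrightarrow> dist (g y) (g x) < e"
    using e unfolding uniformly_continuous_on_def by blast
  then obtain d where d: "d > 0" "\<And>x y. x \<in> ?B \<Longrightarrow> y \<in> ?B \<Longrightarrow> dist y x < d \<Longrightarrow> dist (g y) (g x) < e"
    by blast
  show thesis
  proof (rule that[of "min (d / 2) 1"])
    show "min (d / 2) 1 > 0" using d by simp
    fix x y :: 'a assume y: "norm y \<le> min (d / 2) 1"
    show "norm (g (x - y) - g x) \<le> e"
    proof (cases "norm x \<le> R + 1")
      case True
      then have "norm (x - y) \<le> R + 2" using norm_triangle_ineq4[of x y] y by simp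
      then have "dist (g (x - y)) (g x) < e"
        using True y d(1) by (intro d(2)) (auto simp: dist_norm norm_minus_commute)
      then show ?thesis by (simp add: dist_norm)
    next
      case False
      have "norm x \<le> norm (x - y) + norm y" by (metis diff_add_cancel norm_triangle_ineq)
      then have "x \<notin> K" "x - y \<notin> K" using False R y by force+
      then show ?thesis using g(2) e by simp
    qed
  qed
qed

text \<open>By translation invariance the integral of \<open>f (z + y)\<close> over \<open>y\<close>
  does not depend on \<open>z\<close>; differentiating at \<open>z = 0\<close> gives the claim. It
  plays the part of integration by parts.\<close>

lemma integral_C1c_grad:
  fixes f :: "'a::euclidean_space \<Rightarrow> real"
  assumes C: "C1c f g K"
  shows "integrable lborel g" "(\<integral>y. g y \<partial>lborel) = 0"
proof -
  have K: "compact K" and d: "\<And>x. GDERIV f x :> g x" and g: "continuous_on UNIV g" and f0: "\<And>x. x \<notin> K \<Longrightarrow> f x = 0"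
    using C by (auto simp: C1c_def)
  have g0: "\<And>x. x \<notin> K \<Longrightarrow> g x = 0" by (rule C1c_grad_zero[OF C])
  have fc: "continuous_on UNIV f" by (rule C1c_continuous[OF C])
  show ig: "integrable lborel g" by (rule compact_support_integrable[OF K g g0])
  have fi: "integrable lborel f" by (rule compact_support_integrable[OF K fc f0])
  obtain M where M: "M > 0" "\<And>x. norm (g x) \<le> M"
    by (rule compact_support_bounded[OF K g]) (erule g0, rule that)
  obtain R where R: "\<And>x. x \<in> K \<Longrightarrow> norm x \<le> R"
    using compact_imp_bounded[OF K] unfolding bounded_iff by auto
  have shift: "integrable lborel (\<lambda>y. f (z + y))" "(\<integral>y. f (z + y) \<partial>lborel) = (\<integral>y. f y \<partial>lborel)" for z
  proof -
    have m: "f \<in> borel_measurable borel" using fc by (rule borel_measurable_continuous_onI)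
    show "integrable lborel (\<lambda>y. f (z + y))"
      using fi integrable_distr_eq[of "(+) z" lborel borel f] m lborel_distr_plus[of z] by simp
    show "(\<integral>y. f (z + y) \<partial>lborel) = (\<integral>y. f y \<partial>lborel)"
      using integral_distr[of "(+) z" lborel borel f] m lborel_distr_plus[of z] by simp
  qed
  have "GDERIV (\<lambda>z. \<integral>y. f (z + y) \<partial>lborel) 0 :> (\<integral>y. g (0 + y) \<partial>lborel)"
  proof (rule leibniz_gradient(2)[where e=1 and w="\<lambda>y. M * indicator (cball 0 (R + 1)) y"])
    show "GDERIV (\<lambda>z. f (z + y)) z :> g (z + y)" for z y
    proof -
      have "((\<lambda>z. z + y) has_derivative (\<lambda>h. h)) (at z)"
        by (auto intro!: derivative_eq_intros)
      from has_derivative_compose[OF this, of f "\<lambda>h. h \<bullet> g (z + y)"] d[of "z + y"]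
      show ?thesis by (simp add: gderiv_def)
    qed
    show "norm (g (z + y)) \<le> M * indicator (cball 0 (R + 1)) y" if "z \<in> ball 0 1" for z y
    proof (cases "z + y \<in> K")
      case True
      have "norm y \<le> norm (z + y) + norm z" using norm_triangle_ineq4[of "z + y" z] by simp
      then have "y \<in> cball 0 (R + 1)" using R[OF True] that by simp
      then show ?thesis using M by simp
    qed (use g0 M in simp)
    show "integrable lborel (\<lambda>y::'a. M * indicator (cball 0 (R + 1)) y)"
      by (intro integrable_mult_right integrable_real_indicator emeasure_bounded_finite bounded_cball) simp
    show "(\<lambda>y. g (0 + y)) \<in> borel_measurable lborel"
      using g by (simp add: borel_measurable_continuous_onI)
  qed (use shift in auto)
  then have "GDERIV (\<lambda>z::'a. \<integral>y. f y \<partial>lborel) 0 :> (\<integral>y. g y \<partial>lborel)"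
    by (simp add: shift)
  then show "(\<integral>y. g y \<partial>lborel) = 0"
    by (rule GDERIV_const_imp)
qed

subsection \<open>A smooth mollifier\<close>

text \<open>The negative powers arise from differentiating exp (- 1 / s); with them the derivative
  of each member is a linear combination of members.\<close>

definition flat_exp :: "nat \<Rightarrow> real \<Rightarrow> real" where
  "flat_exp m s = (if s > 0 then exp (- inverse s) * inverse s ^ m else 0)"

lemma flat_exp_tendsto_0: "(flat_exp m \<longlongrightarrow> 0) (at 0)"
proof (rule filterlim_split_at)
  have "eventually (\<lambda>s::real. s < 0) (at_left 0)"
    by (simp add: eventually_at_left_field) (use lt_ex in blast)
  then have "eventually (\<lambda>s. 0 = flat_exp m s) (at_left 0)"
    by eventually_elim (simp add: flat_exp_def)
  then show "(flat_exp m \<longlongrightarrow> 0) (at_left 0)"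
    by (rule Lim_transform_eventually[OF tendsto_const])
  have "((\<lambda>s. inverse s ^ m / exp (inverse s)) \<longlongrightarrow> (0::real)) (at_right 0)"
    by (rule filterlim_compose[OF tendsto_power_div_exp_0 filterlim_inverse_at_top_right])
  moreover have "eventually (\<lambda>s::real. s > 0) (at_right 0)" by (simp add: eventually_at_right_less)
  then have "eventually (\<lambda>s. inverse s ^ m / exp (inverse s) = flat_exp m s) (at_right 0)"
    by eventually_elim (simp add: flat_exp_def exp_minus divide_inverse mult.commute)
  ultimately show "(flat_exp m \<longlongrightarrow> 0) (at_right 0)" by (rule Lim_transform_eventually)
qed

lemma DERIV_flat_exp: "(flat_exp m has_real_derivative (- real m * flat_exp (Suc m) s + flat_exp (Suc (Suc m)) s)) (at s)"
proof -
  consider "s < 0" | "s = 0" | "s > 0" by linarith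
  then show ?thesis
  proof cases
    case 1
    have "((\<lambda>s. 0) has_real_derivative 0) (at s)" by simp
    then have "(flat_exp m has_real_derivative 0) (at s)"
      by (rule has_field_derivative_transform_within_open[of _ _ _ "{..<0}"]) (use 1 in \<open>auto simp: flat_exp_def\<close>)
    then show ?thesis using 1 by (simp add: flat_exp_def)
  next
    case 2
    have "((\<lambda>h. (flat_exp m (0 + h) - flat_exp m 0) / h) \<longlongrightarrow> 0) (at 0)"
    proof (rule Lim_transform_eventually[OF flat_exp_tendsto_0[of "Suc m"]])
      show "\<forall>\<^sub>F h in at 0. flat_exp (Suc m) h = (flat_exp m (0 + h) - flat_exp m 0) / h"
        by (intro always_eventually allI) (simp add: flat_exp_def divide_inverse mult_ac)
    qed
    then have "(flat_exp m has_real_derivative 0) (at 0)" by (simp add: DERIV_def)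
    then show ?thesis using 2 by (simp add: flat_exp_def)
  next
    case 3
    have "((\<lambda>s. exp (- inverse s) * inverse s ^ m) has_real_derivative
        exp (- inverse s) * (inverse s)\<^sup>2 * inverse s ^ m - exp (- inverse s) * (real m * inverse s ^ (m - 1) * (inverse s)\<^sup>2)) (at s)"
      using 3 by (auto intro!: derivative_eq_intros simp: power2_eq_square)
    moreover have "exp (- inverse s) * (inverse s)\<^sup>2 * inverse s ^ m - exp (- inverse s) * (real m * inverse s ^ (m - 1) * (inverse s)\<^sup>2)
        = - real m * flat_exp (Suc m) s + flat_exp (Suc (Suc m)) s"
      using 3 by (cases m) (simp_all add: flat_exp_def power2_eq_square algebra_simps)
    ultimately have "((\<lambda>s. exp (- inverse s) * inverse s ^ m) has_real_derivative (- real m * flat_exp (Suc m) s + flat_exp (Suc (Suc m)) s)) (at s)"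
      by simp
    then show ?thesis
      by (rule has_field_derivative_transform_within_open[of _ _ _ "{0<..}"]) (use 3 in \<open>auto simp: flat_exp_def\<close>)
  qed
qed

text \<open>By the previous lemma this class is closed under partial derivatives, so its members are smooth.\<close>

inductive bump_class :: "real \<Rightarrow> ('a::euclidean_space \<Rightarrow> real) \<Rightarrow> bool" for e where
  bump_class_const: "bump_class e (\<lambda>x. c)"
| bump_class_inner: "bump_class e (\<lambda>x. x \<bullet> b)"
| bump_class_add: "bump_class e f \<Longrightarrow> bump_class e g \<Longrightarrow> bump_class e (\<lambda>x. f x + g x)"
| bump_class_mult: "bump_class e f \<Longrightarrow> bump_class e g \<Longrightarrow> bump_class e (\<lambda>x. f x * g x)"
| bump_class_flat_exp: "bump_class e (\<lambda>x. flat_exp m (e\<^sup>2 - x \<bullet> x))"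

lemma bump_class_partial:
  assumes "bump_class e f"
  shows "(\<forall>x. f differentiable (at x)) \<and> (\<forall>b. bump_class e (partial b f))"
  using assms
proof induction
  case (bump_class_const c)
  have "partial b (\<lambda>x. c) = (\<lambda>x::'a. 0)" for b
    using GDERIV_partial[OF GDERIV_const] by (auto simp: fun_eq_iff)
  then show ?case using bump_class.bump_class_const[of e 0] by simp
next
  case (bump_class_inner a)
  have g: "GDERIV (\<lambda>x. x \<bullet> a) x :> a" for x
    by (auto simp: gderiv_def intro!: derivative_eq_intros)
  have "partial b (\<lambda>x. x \<bullet> a) = (\<lambda>x::'a. b \<bullet> a)" for b
    using GDERIV_partial[OF g] by (auto simp: fun_eq_iff)
  then show ?case using bump_class.bump_class_const[of e] g GDERIV_imp_differentiable by auto
next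
  case (bump_class_add f h)
  have g: "GDERIV (\<lambda>x. f x + h x) x :> grad f x + grad h x" for x
    using bump_class_add by (intro GDERIV_add GDERIV_grad) auto
  have gf: "GDERIV f x :> grad f x" "GDERIV h x :> grad h x" for x
    using bump_class_add by (auto intro: GDERIV_grad)
  have "partial b (\<lambda>x. f x + h x) = (\<lambda>x. partial b f x + partial b h x)" for b
    using GDERIV_partial[OF g] GDERIV_partial[OF gf(1)] GDERIV_partial[OF gf(2)] by (simp add: fun_eq_iff inner_add_right)
  then show ?case using bump_class_add g GDERIV_imp_differentiable by (auto intro: bump_class.bump_class_add)
next
  case (bump_class_mult f h)
  have gf: "GDERIV f x :> grad f x" "GDERIV h x :> grad h x" for x
    using bump_class_mult by (auto intro: GDERIV_grad)
  have g: "GDERIV (\<lambda>x. f x * h x) x :> f x *\<^sub>R grad h x + h x *\<^sub>R grad f x" for x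
    by (rule GDERIV_mult[OF gf])
  have "partial b (\<lambda>x. f x * h x) = (\<lambda>x. f x * partial b h x + h x * partial b f x)" for b
    using GDERIV_partial[OF g] GDERIV_partial[OF gf(1)] GDERIV_partial[OF gf(2)] by (simp add: fun_eq_iff inner_add_right)
  then show ?case using bump_class_mult g GDERIV_imp_differentiable
    by (auto intro!: bump_class.bump_class_add bump_class.bump_class_mult)
next
  case (bump_class_flat_exp m)
  let ?d = "\<lambda>x::'a. - real m * flat_exp (Suc m) (e\<^sup>2 - x \<bullet> x) + flat_exp (Suc (Suc m)) (e\<^sup>2 - x \<bullet> x)"
  have g: "GDERIV (\<lambda>x::'a. flat_exp m (e\<^sup>2 - x \<bullet> x)) x :> ?d x *\<^sub>R ((-2) *\<^sub>R x)" for x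
  proof -
    have "GDERIV (\<lambda>x::'a. e\<^sup>2 - x \<bullet> x) x :> (-2) *\<^sub>R x"
      unfolding gderiv_def by (auto intro!: derivative_eq_intros simp: inner_commute)
    from GDERIV_DERIV_compose[OF this DERIV_flat_exp[of m]] show ?thesis by simp
  qed
  have "partial b (\<lambda>x::'a. flat_exp m (e\<^sup>2 - x \<bullet> x)) = (\<lambda>x. ?d x * ((-2) * (x \<bullet> b)))" for b
    using GDERIV_partial[OF g] by (simp add: fun_eq_iff inner_commute)
  moreover have "bump_class e (\<lambda>x::'a. ?d x * ((-2) * (x \<bullet> b)))" for b
    by (intro bump_class.bump_class_add bump_class.bump_class_mult bump_class.bump_class_const bump_class.bump_class_inner bump_class.bump_class_flat_exp)
  ultimately have "bump_class e (partial b (\<lambda>x::'a. flat_exp m (e\<^sup>2 - x \<bullet> x)))" for b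
    by (simp only:)
  then show ?case using GDERIV_imp_differentiable[OF g] by blast
qed

lemma bump_class_GDERIV: "bump_class e f \<Longrightarrow> GDERIV f x :> grad f x"
  by (rule GDERIV_grad) (simp add: bump_class_partial)

lemma bump_class_continuous: "bump_class e f \<Longrightarrow> continuous_on UNIV f"
  by (intro continuous_at_imp_continuous_on ballI differentiable_imp_continuous_within) (simp add: bump_class_partial)

lemma bump_class_continuous_grad: "bump_class e f \<Longrightarrow> continuous_on UNIV (grad f)"
  unfolding grad_def
  by (intro continuous_on_sum continuous_on_scaleR continuous_on_const bump_class_continuous[of e]) (simp add: bump_class_partial)

lemma mollifier:
  fixes e :: real
  assumes e: "e > 0"
  obtains \<rho> :: "real^2 \<Rightarrow> real" where "bump_class e \<rho>" "\<And>x. \<rho> x \<ge> 0" "\<And>x. norm x > e \<Longrightarrow> \<rho> x = 0"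
    "integrable lborel \<rho>" "(\<integral>x. \<rho> x \<partial>lborel) = 1"
proof -
  let ?f = "\<lambda>x::real^2. flat_exp 0 (e\<^sup>2 - x \<bullet> x)"
  have bump_class: "bump_class e ?f" by (rule bump_class_flat_exp)
  have nn: "?f x \<ge> 0" for x by (simp add: flat_exp_def)
  have z: "?f x = 0" if "norm x > e" for x
  proof -
    have "e\<^sup>2 < (norm x)\<^sup>2" using that e by (intro power_strict_mono) auto
    then show ?thesis by (simp add: flat_exp_def power2_norm_eq_inner)
  qed
  have i: "integrable lborel ?f"
    by (rule compact_support_integrable[OF compact_cball[of 0 e] bump_class_continuous[OF bump_class]]) (use z in auto)
  have pos: "(\<integral>x. ?f x \<partial>lborel) > 0"
  proof -
    \<comment> \<open>On the ball of half the radius \<open>e\<^sup>2 - x \<bullet> x\<close> is at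
      least \<open>3 / 4 * e\<^sup>2\<close>, which bounds the bump from below and makes its
      integral positive.\<close>
    let ?c = "exp (- inverse (3 / 4 * e\<^sup>2))"
    have "0 < ?c * (pi * (e / 2)\<^sup>2)" using e by simp
    also have "\<dots> = (\<integral>x. ?c * indicator (ball 0 (e / 2)) x \<partial>(lborel :: (real^2) measure))"
      using content_ball[of "e / 2" "0::real^2"] e by (simp add: unit_ball_vol_2)
    also have "\<dots> \<le> (\<integral>x. ?f x \<partial>lborel)"
    proof (rule integral_mono[OF _ i])
      show "integrable lborel (\<lambda>x::real^2. ?c * indicator (ball 0 (e / 2)) x)"
        using e by (intro integrable_mult_right integrable_real_indicator) (auto simp: emeasure_ball)
      fix x :: "real^2"
      show "?c * indicator (ball 0 (e / 2)) x \<le> ?f x"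
      proof (cases "norm x < e / 2")
        case True
        then have "(norm x)\<^sup>2 \<le> (e / 2)\<^sup>2" by (intro power_mono) auto
        then have 1: "3 / 4 * e\<^sup>2 \<le> e\<^sup>2 - x \<bullet> x"
          by (simp add: power2_norm_eq_inner power_divide)
        have 2: "3 / 4 * e\<^sup>2 > 0" using e by simp
        then have "?c \<le> exp (- inverse (e\<^sup>2 - x \<bullet> x))"
          using 1 le_imp_inverse_le[OF 1 2] by (simp del: inverse_mult_distrib)
        moreover have "0 < e\<^sup>2 - x \<bullet> x" using 1 2 by linarith
        ultimately show ?thesis using True by (simp add: flat_exp_def del: inverse_mult_distrib)
      qed (use nn in simp)
    qed
    finally show ?thesis .
  qed
  define Z where "Z = (\<integral>x. ?f x \<partial>lborel)"
  show thesis
  proof (rule that[of "\<lambda>x. (1 / Z) * ?f x"])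
    show "bump_class e (\<lambda>x. (1 / Z) * ?f x)" by (intro bump_class_mult bump_class_const bump_class)
    show "0 \<le> (1 / Z) * ?f x" for x using nn pos by (simp add: Z_def)
    show "integrable lborel (\<lambda>x. (1 / Z) * ?f x)" using i by (rule integrable_mult_right)
    show "(\<integral>x. (1 / Z) * ?f x \<partial>lborel) = 1"
      using pos by (simp add: Z_def)
  qed (use z in simp)
qed

section \<open>Convolution and approximation by test functions\<close>

definition conv :: "('a::euclidean_space \<Rightarrow> real) \<Rightarrow> ('a \<Rightarrow> real) \<Rightarrow> 'a \<Rightarrow> real" where
  "conv f \<rho> x = (\<integral>y. f y * \<rho> (x - y) \<partial>lborel)"

lemma GDERIV_diff_const:
  assumes "GDERIV f (x - y) :> g"
  shows "GDERIV (\<lambda>z. f (z - y)) x :> g"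
proof -
  have "((\<lambda>z. z - y) has_derivative (\<lambda>h. h)) (at x)" by (auto intro!: derivative_eq_intros)
  from has_derivative_compose[OF this, of f "\<lambda>h. h \<bullet> g"] assms
  show ?thesis by (simp add: gderiv_def)
qed

lemma GDERIV_conv:
  fixes f \<rho> :: "'a::euclidean_space \<Rightarrow> real"
  assumes f: "continuous_on UNIV f" "compact K" "\<And>x. x \<notin> K \<Longrightarrow> f x = 0"
    and \<rho>: "bump_class e \<rho>" "\<And>x. norm x > e \<Longrightarrow> \<rho> x = 0"
  shows "GDERIV (conv f \<rho>) x :> (\<integral>y. f y *\<^sub>R grad \<rho> (x - y) \<partial>lborel)"
    "integrable lborel (\<lambda>y. f y *\<^sub>R grad \<rho> (x - y))"
proof -
  have C: "C1c \<rho> (grad \<rho>) (cball 0 e)"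
    using \<rho> by (auto simp: C1c_def bump_class_GDERIV bump_class_continuous_grad)
  obtain M where M: "M > 0" "\<And>x. norm (grad \<rho> x) \<le> M"
    by (rule compact_support_bounded[OF compact_cball bump_class_continuous_grad[OF \<rho>(1)]]) (erule C1c_grad_zero[OF C], rule that)
  have cs: "continuous_on UNIV (\<lambda>y. \<rho> (z - y))" "continuous_on UNIV (\<lambda>y. grad \<rho> (z - y))" for z
    by (intro continuous_on_compose2[OF bump_class_continuous[OF \<rho>(1)]] continuous_on_compose2[OF bump_class_continuous_grad[OF \<rho>(1)]] continuous_intros; simp)+
  have d: "GDERIV (\<lambda>z. f y * \<rho> (z - y)) z :> f y *\<^sub>R grad \<rho> (z - y)" for z y
    using GDERIV_mult[OF GDERIV_const[of "f y"] GDERIV_diff_const[OF bump_class_GDERIV[OF \<rho>(1)]]] by simp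
  have bnd: "norm (f y *\<^sub>R grad \<rho> (z - y)) \<le> M * \<bar>f y\<bar>" for z y
    using mult_left_mono[OF M(2)[of "z - y"] abs_ge_zero[of "f y"]] by (simp add: mult.commute[of M])
  have w: "integrable lborel (\<lambda>y. M * \<bar>f y\<bar>)"
    by (rule compact_support_integrable[OF f(2)]) (use f(1,3) in \<open>auto intro!: continuous_intros\<close>)
  have int: "integrable lborel (\<lambda>y. f y * \<rho> (z - y))" for z
    by (rule compact_support_integrable[OF f(2)]) (use f(3) in \<open>auto intro!: continuous_intros f(1) cs\<close>)
  have m: "(\<lambda>y. f y *\<^sub>R grad \<rho> (x - y)) \<in> borel_measurable lborel"
    by (simp, intro borel_measurable_continuous_onI continuous_intros f(1) cs)
  show "GDERIV (conv f \<rho>) x :> (\<integral>y. f y *\<^sub>R grad \<rho> (x - y) \<partial>lborel)"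
    unfolding conv_def[abs_def]
    by (rule leibniz_gradient(2)[where e=1 and k="\<lambda>z y. f y *\<^sub>R grad \<rho> (z - y)", OF _ d bnd w int m]) simp
  show "integrable lborel (\<lambda>y. f y *\<^sub>R grad \<rho> (x - y))"
    by (rule leibniz_gradient(1)[where e=1 and x=x and k="\<lambda>z y. f y *\<^sub>R grad \<rho> (z - y)", OF _ d bnd w int m]) simp
qed

text \<open>Every derivative is moved onto \<rho>, whose partial derivatives stay in
  \<open>bump_class\<close> and vanish off the same ball; hence the induction generalises over
  \<rho> while \<open>f\<close> is merely continuous.\<close>

lemma Ck_on_conv:
  fixes f \<rho> :: "'a::euclidean_space \<Rightarrow> real"
  assumes f: "continuous_on UNIV f" "compact K" "\<And>x. x \<notin> K \<Longrightarrow> f x = 0"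
    and \<rho>: "bump_class e \<rho>" "\<And>x. norm x > e \<Longrightarrow> \<rho> x = 0"
  shows "Ck_on k (conv f \<rho>) UNIV"
  using \<rho>
proof (induction k arbitrary: \<rho>)
  case 0
  have "isCont (conv f \<rho>) x" for x
    using GDERIV_conv(1)[OF f 0] unfolding gderiv_def by (metis has_derivative_continuous)
  then show ?case by (simp add: continuous_at_imp_continuous_on)
next
  case (Suc k)
  have g: "GDERIV (conv f \<rho>) x :> (\<integral>y. f y *\<^sub>R grad \<rho> (x - y) \<partial>lborel)" for x
    by (rule GDERIV_conv(1)[OF f Suc.prems])
  have "Ck_on k (partial b (conv f \<rho>)) UNIV" if "b \<in> Basis" for b
  proof -
    have "partial b (conv f \<rho>) x = conv f (partial b \<rho>) x" for x
    proof -
      have "partial b (conv f \<rho>) x = (\<integral>y. b \<bullet> (f y *\<^sub>R grad \<rho> (x - y)) \<partial>lborel)"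
        using GDERIV_partial[OF g] integral_inner_right[OF GDERIV_conv(2)[OF f Suc.prems]] by simp
      also have "\<dots> = conv f (partial b \<rho>) x"
        unfolding conv_def using GDERIV_partial[OF bump_class_GDERIV[OF Suc.prems(1)]] by simp
      finally show ?thesis .
    qed
    then have eq: "partial b (conv f \<rho>) = conv f (partial b \<rho>)" by (rule ext)
    show ?thesis unfolding eq
    proof (rule Suc.IH)
      show "bump_class e (partial b \<rho>)" using bump_class_partial[OF Suc.prems(1)] by blast
      fix x :: 'a assume x: "norm x > e"
      have "GDERIV (\<lambda>x. 0) x :> grad \<rho> x"
        by (rule GDERIV_cong_open[OF bump_class_GDERIV[OF Suc.prems(1)], of "- cball 0 e"]) (use x Suc.prems(2) in auto)
      then have "grad \<rho> x = 0" by (rule GDERIV_const_imp)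
      then show "partial b \<rho> x = 0" using GDERIV_partial[OF bump_class_GDERIV[OF Suc.prems(1)]] by simp
    qed
  qed
  then show ?case by (simp add: GDERIV_imp_differentiable[OF g])
qed

lemma conv_commute:
  fixes f \<rho> :: "'a::euclidean_space \<Rightarrow> real"
  assumes "continuous_on UNIV f" "continuous_on UNIV \<rho>"
  shows "conv f \<rho> x = (\<integral>y. f (x - y) * \<rho> y \<partial>lborel)"
proof -
  let ?F = "\<lambda>y. f y * \<rho> (x - y)"
  have m: "?F \<in> borel_measurable borel"
    by (intro borel_measurable_continuous_onI continuous_intros continuous_on_compose2[OF assms(2)] assms(1)) auto
  have "lborel = distr lborel borel (\<lambda>y. x - y)"
    using lborel_affine[of "-1" x] by (simp add: density_1)
  then have "conv f \<rho> x = (\<integral>y. ?F y \<partial>distr lborel borel (\<lambda>y. x - y))"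
    unfolding conv_def by simp
  also have "\<dots> = (\<integral>y. ?F (x - y) \<partial>lborel)"
    by (rule integral_distr[OF _ m]) (auto intro!: borel_measurable_continuous_onI continuous_intros)
  finally show ?thesis by simp
qed

text \<open>Test functions enter the weak equation only through their gradients, so uniform
  closeness of gradients is the right notion. Smoothness comes from derivatives falling on \<rho>,
  closeness from the commuted form, in which the gradient is an average of translates of the
  uniformly continuous \<open>g\<close>.\<close>

lemma mollification:
  fixes D :: "(real^2) set"
  assumes C: "C1c f g K" and D: "open D" "K \<subseteq> D" and e: "e > 0"
  obtains \<phi> where "test_function D \<phi>" "\<And>x. norm (grad \<phi> x - g x) \<le> e"
proof -
  have K: "compact K" and d: "\<And>x. GDERIV f x :> g x" and gc: "continuous_on UNIV g" and f0: "\<And>x. x \<notin> K \<Longrightarrow> f x = 0"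
    using C by (auto simp: C1c_def)
  have g0: "\<And>x. x \<notin> K \<Longrightarrow> g x = 0" by (rule C1c_grad_zero[OF C])
  have fc: "continuous_on UNIV f" by (rule C1c_continuous[OF C])
  obtain d1 where d1: "d1 > 0" "\<And>x y. norm y \<le> d1 \<Longrightarrow> norm (g (x - y) - g x) \<le> e"
    by (rule compact_support_uniformly_continuous[OF K gc _ e]) (erule g0, rule that)
  obtain d2 where d2: "d2 > 0" "(\<Union>x\<in>K. cball x d2) \<subseteq> D"
    using compact_subset_open_imp_cball_epsilon_subset[OF K D] by blast
  \<comment> \<open>\<open>d1\<close> controls the oscillation of \<open>g\<close>,
    \<open>d2\<close> keeps the enlarged support inside \<open>D\<close>.\<close>
  define \<epsilon> where "\<epsilon> = min d1 d2"
  have \<epsilon>: "\<epsilon> > 0" "\<epsilon> \<le> d1" "\<epsilon> \<le> d2"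
    using d1 d2 by (auto simp: \<epsilon>_def)
  obtain \<rho> :: "real^2 \<Rightarrow> real" where \<rho>: "bump_class \<epsilon> \<rho>" "\<And>x. \<rho> x \<ge> 0" "\<And>x. norm x > \<epsilon> \<Longrightarrow> \<rho> x = 0"
    "integrable lborel \<rho>" "(\<integral>x. \<rho> x \<partial>lborel) = 1"
    by (rule mollifier[OF \<epsilon>(1)]) (rule that)
  have \<rho>c: "continuous_on UNIV \<rho>" by (rule bump_class_continuous[OF \<rho>(1)])
  obtain M where M: "M > 0" "\<And>x. norm (g x) \<le> M"
    by (rule compact_support_bounded[OF K gc]) (erule g0, rule that)
  obtain M' where M': "M' > 0" "\<And>x. norm (f x) \<le> M'"
    by (rule compact_support_bounded[OF K fc]) (erule f0, rule that)
  let ?\<phi> = "conv f \<rho>"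
  have smooth: "smooth ?\<phi>"
    unfolding smooth_def using Ck_on_conv[OF fc K f0 \<rho>(1,3)] by blast
  define S where "S = (\<Union>x\<in>K. \<Union>y\<in>cball 0 \<epsilon>. {x + y})"
  have S: "compact S" unfolding S_def using compact_sums'[OF K compact_cball] .
  have supp: "?\<phi> x = 0" if "x \<notin> S" for x
  proof -
    have "f y * \<rho> (x - y) = 0" for y
    proof (cases "y \<in> K")
      case True
      have "x - y \<notin> cball 0 \<epsilon>"
      proof
        assume "x - y \<in> cball 0 \<epsilon>"
        then have "x \<in> S" unfolding S_def using True by (intro UN_I[of y] UN_I[of "x - y"]) auto
        then show False using that by simp
      qed
      then show ?thesis using \<rho>(3) by simp
    qed (use f0 in simp)
    then have "(\<lambda>y. f y * \<rho> (x - y)) = (\<lambda>y. 0)" by (rule ext)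
    then show ?thesis unfolding conv_def by simp
  qed
  have "{x. ?\<phi> x \<noteq> 0} \<subseteq> S" using supp by blast
  then have cl: "closure {x. ?\<phi> x \<noteq> 0} \<subseteq> S"
    by (rule closure_minimal[OF _ compact_imp_closed[OF S]])
  have "S \<subseteq> D"
  proof
    fix z assume "z \<in> S"
    then obtain x y where "x \<in> K" "norm y \<le> \<epsilon>" "z = x + y" unfolding S_def by auto
    then have "z \<in> cball x d2" using \<epsilon> by (simp add: dist_norm)
    then show "z \<in> D" using d2(2) \<open>x \<in> K\<close> by blast
  qed
  with cl have "closure {x. ?\<phi> x \<noteq> 0} \<subseteq> D" by blast
  moreover have "compact (closure {x. ?\<phi> x \<noteq> 0})"
    using bounded_subset[OF compact_imp_bounded[OF S] cl] by (simp add: compact_eq_bounded_closed)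
  ultimately have test: "test_function D ?\<phi>" using smooth by (simp add: test_function_def)
  have "norm (grad ?\<phi> x - g x) \<le> e" for x
  proof -
    have eq: "?\<phi> = (\<lambda>x. \<integral>y. f (x - y) * \<rho> y \<partial>lborel)"
      by (rule ext) (rule conv_commute[OF fc \<rho>c])
    have cs: "continuous_on UNIV (\<lambda>y. f (z - y))" "continuous_on UNIV (\<lambda>y. g (z - y))" for z
      by (intro continuous_on_compose2[OF fc] continuous_on_compose2[OF gc] continuous_intros; simp)+
    have dd: "GDERIV (\<lambda>z. f (z - y) * \<rho> y) z :> \<rho> y *\<^sub>R g (z - y)" for z y
      using GDERIV_mult[OF GDERIV_diff_const[OF d] GDERIV_const[of "\<rho> y"]] by simp
    have bnd: "norm (\<rho> y *\<^sub>R g (z - y)) \<le> M * \<rho> y" for z y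
      using mult_left_mono[OF M(2)[of "z - y"] \<rho>(2)[of y]] \<rho>(2)[of y] by (simp add: mult.commute[of M])
    have w: "integrable lborel (\<lambda>y. M * \<rho> y)" using \<rho>(4) by simp
    have int: "integrable lborel (\<lambda>y. f (z - y) * \<rho> y)" for z
      by (rule compact_support_integrable[OF compact_cball[of 0 \<epsilon>]]) (use \<rho>(3) in \<open>auto intro!: continuous_intros cs \<rho>c\<close>)
    have m: "(\<lambda>y. \<rho> y *\<^sub>R g (x - y)) \<in> borel_measurable lborel"
      by (simp, intro borel_measurable_continuous_onI continuous_intros cs \<rho>c)
    have G: "GDERIV ?\<phi> x :> (\<integral>y. \<rho> y *\<^sub>R g (x - y) \<partial>lborel)"
      unfolding eq by (rule leibniz_gradient(2)[where e=1 and k="\<lambda>z y. \<rho> y *\<^sub>R g (z - y)", OF _ dd bnd w int m]) simp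
    have I: "integrable lborel (\<lambda>y. \<rho> y *\<^sub>R g (x - y))"
      by (rule leibniz_gradient(1)[where e=1 and k="\<lambda>z y. \<rho> y *\<^sub>R g (z - y)", OF _ dd bnd w int m]) simp
    have J: "integrable lborel (\<lambda>y. \<rho> y *\<^sub>R g x)"
      using \<rho>(4) by (rule integrable_scaleR_left)
    have "grad ?\<phi> x - g x = (\<integral>y. \<rho> y *\<^sub>R g (x - y) \<partial>lborel) - (\<integral>y. \<rho> y *\<^sub>R g x \<partial>lborel)"
      using GDERIV_imp_grad[OF G] \<rho>(4,5) by simp
    also have "\<dots> = (\<integral>y. \<rho> y *\<^sub>R g (x - y) - \<rho> y *\<^sub>R g x \<partial>lborel)"
      by (rule Bochner_Integration.integral_diff[OF I J, symmetric])
    finally have "norm (grad ?\<phi> x - g x) \<le> (\<integral>y. norm (\<rho> y *\<^sub>R g (x - y) - \<rho> y *\<^sub>R g x) \<partial>lborel)"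
      by simp
    also have "\<dots> \<le> (\<integral>y. e * \<rho> y \<partial>lborel)"
    proof (rule integral_mono)
      show "integrable lborel (\<lambda>y. norm (\<rho> y *\<^sub>R g (x - y) - \<rho> y *\<^sub>R g x))"
        by (intro integrable_norm Bochner_Integration.integrable_diff I J)
      show "integrable lborel (\<lambda>y. e * \<rho> y)" using \<rho>(4) by simp
      fix y
      have "norm (\<rho> y *\<^sub>R g (x - y) - \<rho> y *\<^sub>R g x) = \<rho> y * norm (g (x - y) - g x)"
        using \<rho>(2)[of y] by (simp add: scaleR_diff_right[symmetric])
      also have "\<dots> \<le> \<rho> y * e"
      proof (cases "norm y \<le> \<epsilon>")
        case True
        then show ?thesis using d1(2)[of y x] \<epsilon> \<rho>(2)[of y] by (intro mult_left_mono) auto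
      qed (use \<rho>(3) in simp)
      finally show "norm (\<rho> y *\<^sub>R g (x - y) - \<rho> y *\<^sub>R g x) \<le> e * \<rho> y"
        by (simp add: mult.commute)
    qed
    also have "\<dots> = e" using \<rho>(4,5) by simp
    finally show ?thesis .
  qed
  with test that show thesis by blast
qed

subsection \<open>Weak solutions tested with \<open>C\<^sup>1\<close> functions\<close>

lemma perp_inner: "perp v \<bullet> w = v $ 2 * w $ 1 - v $ 1 * w $ 2"
  by (simp add: perp_def inner_vec2)

lemma perp_self: "perp v \<bullet> v = 0"
  by (simp add: perp_inner)

lemma norm_perp: "norm (perp v) = norm v"
  by (simp add: perp_def norm_vec2 add.commute)

lemma perp_inner_perp: "perp v \<bullet> perp w = v \<bullet> w"
  by (simp add: perp_inner inner_vec2) (simp add: perp_def)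

lemma linear_perp: "linear perp"
  by (auto intro!: linearI simp: perp_def vec_eq_iff forall_2)

lemma continuous_on_perp: "continuous_on S f \<Longrightarrow> continuous_on S (\<lambda>x. perp (f x))"
  by (rule bounded_linear.continuous_on) (simp_all add: linear_perp linear_conv_bounded_linear[symmetric])

lemma C1cD:
  assumes "C1c f g K"
  shows "compact K" "GDERIV f x :> g x" "continuous_on UNIV g" "x \<notin> K \<Longrightarrow> f x = 0"
  using assms unfolding C1c_def by blast+

lemma test_function_C1c:
  assumes "test_function D \<phi>"
  shows "C1c \<phi> (grad \<phi>) (closure {x. \<phi> x \<noteq> 0})" "closure {x. \<phi> x \<noteq> 0} \<subseteq> D" "Ck_on 2 \<phi> UNIV"
proof -
  show 2: "Ck_on 2 \<phi> UNIV" and "closure {x. \<phi> x \<noteq> 0} \<subseteq> D"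
    using assms by (auto simp: test_function_def smooth_def)
  have 1: "Ck_on 1 \<phi> UNIV" using assms by (simp add: test_function_def smooth_def)
  have "continuous_on UNIV (grad \<phi>)"
    unfolding grad_def by (intro continuous_on_sum continuous_on_scaleR continuous_on_const) (use 1 in simp)
  moreover have "\<phi> x = 0" if "x \<notin> closure {x. \<phi> x \<noteq> 0}" for x
    using that closure_subset[of "{x. \<phi> x \<noteq> 0}"] by blast
  moreover have "GDERIV \<phi> x :> grad \<phi> x" for x
    using 1 by (intro GDERIV_grad) simp
  moreover have "compact (closure {x. \<phi> x \<noteq> 0})"
    using assms by (simp add: test_function_def)
  ultimately show "C1c \<phi> (grad \<phi>) (closure {x. \<phi> x \<noteq> 0})"
    unfolding C1c_def by blast
qed

definition pos2 :: "real \<Rightarrow> real" where "pos2 t = (max 0 t)\<^sup>2"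

lemma DERIV_pos2: "(pos2 has_real_derivative 2 * max 0 t) (at t)"
proof -
  consider "t < 0" | "t = 0" | "t > 0" by linarith
  then show ?thesis
  proof cases
    case 1
    have "((\<lambda>s. 0) has_real_derivative 0) (at t)" by simp
    then have "(pos2 has_real_derivative 0) (at t)"
      by (rule has_field_derivative_transform_within_open[of _ _ _ "{..<0}"]) (use 1 in \<open>auto simp: pos2_def\<close>)
    then show ?thesis using 1 by simp
  next
    case 2
    have "((\<lambda>h. max 0 h) \<longlongrightarrow> max 0 (0::real)) (at 0)" by (intro tendsto_intros)
    then have "((\<lambda>h. max 0 h) \<longlongrightarrow> (0::real)) (at 0)" by simp
    then have "((\<lambda>h. (pos2 (0 + h) - pos2 0) / h) \<longlongrightarrow> 0) (at 0)"
    proof (rule Lim_transform_eventually)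
      show "\<forall>\<^sub>F h in at 0. max 0 h = (pos2 (0 + h) - pos2 0) / h"
        by (intro always_eventually allI) (auto simp: pos2_def max_def power2_eq_square)
    qed
    then show ?thesis using 2 by (simp add: DERIV_def)
  next
    case 3
    have "((\<lambda>s. s\<^sup>2) has_real_derivative 2 * t) (at t)" by (auto intro!: derivative_eq_intros)
    then have "(pos2 has_real_derivative 2 * t) (at t)"
      by (rule has_field_derivative_transform_within_open[of _ _ _ "{0<..}"]) (use 3 in \<open>auto simp: pos2_def\<close>)
    then show ?thesis using 3 by simp
  qed
qed

lemma continuous_pos2: "continuous_on S f \<Longrightarrow> continuous_on S (\<lambda>x. pos2 (f x))"
  unfolding pos2_def by (intro continuous_intros)

text \<open>A linear function with gradient \<open>b\<close> times a radial cutoff. The normalised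
  squared distance \<open>s\<close> is at most 1 on the inner ball and at least 4 off the outer one;
  accordingly \<open>t\<close> equals 1 or is nonpositive, and \<open>pos2\<close> joins plateau and
  zero set in a C^1 way.\<close>

lemma cutoff_linear:
  fixes p b :: "'a::euclidean_space"
  assumes \<epsilon>: "\<epsilon> > 0"
  obtains \<tau> g where "\<And>x. GDERIV \<tau> x :> g x" "continuous_on UNIV g" "\<And>x. x \<in> ball p \<epsilon> \<Longrightarrow> g x = b"
    "\<And>x. x \<notin> ball p (2 * \<epsilon>) \<Longrightarrow> \<tau> x = 0 \<and> g x = 0"
proof -
  define c where "c = 1 / \<epsilon>\<^sup>2"
  have c: "c > 0" using \<epsilon> by (simp add: c_def)
  define s where "s x = c * ((x - p) \<bullet> (x - p))" for x
  define t where "t x = 1 - pos2 (s x - 1)" for x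
  define \<theta> where "\<theta> x = pos2 (t x)" for x
  define g\<theta> where "g\<theta> x = (2 * max 0 (t x)) *\<^sub>R ((- (2 * max 0 (s x - 1))) *\<^sub>R ((2 * c) *\<^sub>R (x - p)))" for x
  have ds: "GDERIV (\<lambda>x. s x - 1) x :> (2 * c) *\<^sub>R (x - p)" for x
    unfolding s_def gderiv_def
    by (auto intro!: derivative_eq_intros simp: inner_commute)
  have D: "((\<lambda>y. 1 - pos2 y) has_real_derivative - (2 * max 0 y)) (at y)" for y
    using DERIV_pos2[of y] by (auto intro!: derivative_eq_intros)
  have dt: "GDERIV t x :> (- (2 * max 0 (s x - 1))) *\<^sub>R ((2 * c) *\<^sub>R (x - p))" for x
    unfolding t_def[abs_def] by (rule GDERIV_DERIV_compose[OF ds D])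
  have d\<theta>: "GDERIV \<theta> x :> g\<theta> x" for x
    unfolding \<theta>_def[abs_def] g\<theta>_def by (rule GDERIV_DERIV_compose[OF dt DERIV_pos2])
  have cs: "continuous_on UNIV s"
    unfolding s_def[abs_def] by (intro continuous_intros)
  have ct: "continuous_on UNIV t"
    unfolding t_def[abs_def] by (intro continuous_intros continuous_pos2 cs)
  have c\<theta>: "continuous_on UNIV \<theta>"
    unfolding \<theta>_def[abs_def] by (intro continuous_pos2 ct)
  have cg: "continuous_on UNIV g\<theta>"
    unfolding g\<theta>_def[abs_def] by (intro continuous_intros cs ct)
  have in1: "\<theta> x = 1 \<and> g\<theta> x = 0" if "x \<in> ball p \<epsilon>" for x
  proof -
    have "(norm (x - p))\<^sup>2 \<le> \<epsilon>\<^sup>2"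
      using that \<epsilon> by (intro power_mono) (auto simp: dist_norm norm_minus_commute)
    then have "s x \<le> 1" using \<epsilon> by (simp add: s_def c_def power2_norm_eq_inner)
    then have "pos2 (s x - 1) = 0" "max 0 (s x - 1) = 0" by (auto simp: pos2_def max_def)
    then show ?thesis by (simp add: \<theta>_def t_def g\<theta>_def pos2_def)
  qed
  have out: "\<theta> x = 0 \<and> g\<theta> x = 0" if "x \<notin> ball p (2 * \<epsilon>)" for x
  proof -
    have "(2 * \<epsilon>)\<^sup>2 \<le> (norm (x - p))\<^sup>2"
      using that \<epsilon> by (intro power_mono) (auto simp: dist_norm norm_minus_commute)
    then have "s x \<ge> 4"
      using \<epsilon> by (simp add: s_def c_def power2_norm_eq_inner pos_le_divide_eq power_mult_distrib)
    then have "1 \<le> (max 0 (s x - 1))\<^sup>2" by (intro one_le_power) (auto simp: max_def)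
    then have "t x \<le> 0" by (simp add: t_def pos2_def)
    then show ?thesis by (simp add: \<theta>_def g\<theta>_def pos2_def max_def)
  qed
  have lin: "GDERIV (\<lambda>x. x \<bullet> b) x :> b" for x
    by (auto simp: gderiv_def intro!: derivative_eq_intros)
  show thesis
  proof (rule that[of "\<lambda>x. (x \<bullet> b) * \<theta> x" "\<lambda>x. (x \<bullet> b) *\<^sub>R g\<theta> x + \<theta> x *\<^sub>R b"])
    show "GDERIV (\<lambda>x. (x \<bullet> b) * \<theta> x) x :> (x \<bullet> b) *\<^sub>R g\<theta> x + \<theta> x *\<^sub>R b" for x
      by (rule GDERIV_mult[OF lin d\<theta>])
    show "continuous_on UNIV (\<lambda>x. (x \<bullet> b) *\<^sub>R g\<theta> x + \<theta> x *\<^sub>R b)"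
      by (intro continuous_intros cg c\<theta>)
  qed (use in1 out in auto)
qed

context green_domain
begin

lemma lmeasurable_D: "D \<in> lmeasurable"
  by (rule subset_lmeasurable[OF D_sets])

lemma bounded_integrable_D:
  fixes f :: "real^2 \<Rightarrow> real"
  assumes "(\<lambda>x. indicator D x *\<^sub>R f x) \<in> borel_measurable lebesgue" "\<And>x. x \<in> D \<Longrightarrow> \<bar>f x\<bar> \<le> M"
  shows "set_integrable lebesgue D f" "\<bar>LINT x:D|lebesgue. f x\<bar> \<le> M * measure lebesgue D"
proof -
  have e: "emeasure lebesgue D < \<infinity>" using lmeasurable_D unfolding fmeasurable_def by blast
  have w: "integrable lebesgue (\<lambda>x. M * indicator D x)"
    using D_sets e by (intro integrable_mult_right integrable_real_indicator)
  have b: "norm (indicator D x *\<^sub>R f x) \<le> M * indicator D x" for x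
    using assms(2) by (auto split: split_indicator)
  show i: "set_integrable lebesgue D f"
    unfolding set_integrable_def
    by (rule Bochner_Integration.integrable_bound[OF w assms(1)]) (intro AE_I2 order_trans[OF b], simp)
  have "norm (\<integral>x. indicator D x *\<^sub>R f x \<partial>lebesgue) \<le> (\<integral>x. M * indicator D x \<partial>lebesgue)"
    using integral_norm_bound[of lebesgue "\<lambda>x. indicator D x *\<^sub>R f x"]
      integral_mono[OF integrable_norm[OF i[unfolded set_integrable_def]] w b] by linarith
  also have "\<dots> = M * measure lebesgue D"
    by (subst integral_mult_right_zero) (simp add: D_sets)
  finally show "\<bar>LINT x:D|lebesgue. f x\<bar> \<le> M * measure lebesgue D"
    by (simp add: set_lebesgue_integral_def)
qed

text \<open>Replacing \<open>g\<close> by the gradient of a test function with uniform error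
  \<open>e\<close> changes the integral by at most \<open>M * e * measure lebesgue D\<close>, and
  \<open>e\<close> is arbitrary.\<close>

lemma weak_form_C1c:
  assumes W: "(\<lambda>x. indicator D x *\<^sub>R W x) \<in> borel_measurable lebesgue" "\<And>x. x \<in> D \<Longrightarrow> norm (W x) \<le> M"
    and weak: "\<And>\<phi>. test_function D \<phi> \<Longrightarrow> (LINT x:D|lebesgue. W x \<bullet> grad \<phi> x) = 0"
    and C: "C1c f g K" "K \<subseteq> D"
  shows "(LINT x:D|lebesgue. W x \<bullet> g x) = 0"
proof -
  have M: "M \<ge> 0" using W(2) nonempty_D by (metis norm_ge_zero order_trans all_not_in_conv)
  have bound: "\<bar>LINT x:D|lebesgue. W x \<bullet> g x\<bar> \<le> M * e * measure lebesgue D" if e: "e > 0" for e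
  proof -
    obtain \<phi> where \<phi>: "test_function D \<phi>" "\<And>x. norm (grad \<phi> x - g x) \<le> e"
      by (rule mollification[OF C(1) open_D C(2) e]) (rule that)
    have meas: "(\<lambda>x. indicator D x *\<^sub>R (W x \<bullet> k x)) \<in> borel_measurable lebesgue" if "continuous_on UNIV k" for k
    proof -
      have "(\<lambda>x. (indicator D x *\<^sub>R W x) \<bullet> k x) \<in> borel_measurable lebesgue"
        by (intro borel_measurable_inner W(1) measurable_lebesgueI borel_measurable_continuous_onI that)
      then show ?thesis by simp
    qed
    have cphi: "continuous_on UNIV (grad \<phi>)" and cg: "continuous_on UNIV g"
      by (rule C1cD(3)[OF test_function_C1c(1)[OF \<phi>(1)]], rule C1cD(3)[OF C(1)])
    obtain Mg where Mg: "\<And>x. norm (g x) \<le> Mg"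
      by (rule compact_support_bounded[OF C1cD(1,3)[OF C(1)]]) (erule C1c_grad_zero[OF C(1)], rule that)
    have b1: "\<bar>W x \<bullet> k x\<bar> \<le> M * N" if "x \<in> D" "norm (k x) \<le> N" for x k N
    proof -
      have "\<bar>W x \<bullet> k x\<bar> \<le> norm (W x) * norm (k x)" by (rule Cauchy_Schwarz_ineq2)
      also have "\<dots> \<le> M * N" using W(2)[OF that(1)] that(2) M by (intro mult_mono) auto
      finally show ?thesis .
    qed
    have i1: "set_integrable lebesgue D (\<lambda>x. W x \<bullet> g x)"
      by (rule bounded_integrable_D(1)[OF meas[OF cg]], erule b1) (rule Mg)
    have l: "\<bar>W x \<bullet> (g x - grad \<phi> x)\<bar> \<le> M * e" if "x \<in> D" for x
      using b1[of x "\<lambda>x. g x - grad \<phi> x" e, OF that] \<phi>(2)[of x] by (simp add: norm_minus_commute)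
    note i2 = bounded_integrable_D(1)[OF meas[OF continuous_on_diff[OF cg cphi]] l]
    note l2 = bounded_integrable_D(2)[OF meas[OF continuous_on_diff[OF cg cphi]] l]
    have "(LINT x:D|lebesgue. W x \<bullet> g x) - (LINT x:D|lebesgue. W x \<bullet> (g x - grad \<phi> x)) = (LINT x:D|lebesgue. W x \<bullet> g x - W x \<bullet> (g x - grad \<phi> x))"
      by (rule set_integral_diff(2)[OF i1 i2, symmetric])
    also have "\<dots> = (LINT x:D|lebesgue. W x \<bullet> grad \<phi> x)"
      by (simp add: inner_diff_right)
    also have "\<dots> = 0" by (rule weak[OF \<phi>(1)])
    finally show ?thesis using l2 by simp
  qed
  show ?thesis
  proof (rule ccontr)
    assume "\<not> ?thesis"
    then have pos: "\<bar>LINT x:D|lebesgue. W x \<bullet> g x\<bar> > 0" by simp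
    define c where "c = M * measure lebesgue D + 1"
    have c: "c > 0" using M by (simp add: c_def add_nonneg_pos)
    define J where "J = \<bar>LINT x:D|lebesgue. W x \<bullet> g x\<bar>"
    have J: "J > 0" using pos by (simp add: J_def)
    have "J \<le> M * (J / (2 * c)) * measure lebesgue D"
      unfolding J_def by (rule bound) (use pos c in simp)
    also have "\<dots> = (M * measure lebesgue D) * (J / (2 * c))" by simp
    also have "\<dots> \<le> c * (J / (2 * c))"
      using J c by (intro mult_right_mono) (auto simp: c_def)
    also have "\<dots> = J / 2" using c by simp
    finally show False using J by simp
  qed
qed

text \<open>A rotated C^1 gradient is weakly divergence-free: for smooth \<phi> the integrand is a
  difference of derivatives of products of \<psi> with first derivatives of \<phi>, in which the
  mixed derivatives of \<phi> cancel. This is the weak equation without the vorticity factor;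
  subtracting the given one leaves the factor of the patches.\<close>

lemma integral_perp_grad:
  assumes d: "\<And>x. x \<in> D \<Longrightarrow> GDERIV \<psi> x :> V x" and V: "continuous_on D V" "\<And>x. x \<in> D \<Longrightarrow> norm (V x) \<le> M"
    and C: "C1c f g K" "K \<subseteq> D"
  shows "(LINT x:D|lebesgue. perp (V x) \<bullet> g x) = 0"
proof (rule weak_form_C1c[OF _ _ _ C])
  show "(\<lambda>x. indicator D x *\<^sub>R perp (V x)) \<in> borel_measurable lebesgue"
    by (rule measurable_indicator_D[OF continuous_on_perp[OF V(1)] D_sets])
  show "norm (perp (V x)) \<le> M" if "x \<in> D" for x using V(2)[OF that] by (simp add: norm_perp)
  fix \<phi> :: "real^2 \<Rightarrow> real" assume test: "test_function D \<phi>"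
  define K0 where "K0 = closure {x. \<phi> x \<noteq> 0}"
  note t = test_function_C1c[OF test, folded K0_def]
  let ?e1 = "axis 1 1 :: real^2" and ?e2 = "axis 2 1 :: real^2"
  have cpsi: "continuous_on D \<psi>"
    using d unfolding gderiv_def by (meson continuous_at_imp_continuous_on has_derivative_continuous)
  have grad2: "grad h y $ 1 = partial ?e1 h y" "grad h y $ 2 = partial ?e2 h y" for h :: "real^2 \<Rightarrow> real" and y
    by (simp_all add: grad_def Basis_vec2 axis_eq_axis) (simp_all add: axis_def)
  have Kc: "compact K0" by (rule C1cD(1)[OF t(1)])
  have pd: "GDERIV (partial b \<phi>) x :> grad (partial b \<phi>) x" and pc: "continuous_on UNIV (partial b \<phi>)"
    and pgc: "continuous_on UNIV (grad (partial b \<phi>))" if "b \<in> Basis" for b x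
  proof -
    have dd: "partial b \<phi> differentiable (at x)" for x using t(3) that by (simp add: numeral_2_eq_2)
    then show "GDERIV (partial b \<phi>) x :> grad (partial b \<phi>) x" by (rule GDERIV_grad)
    show "continuous_on UNIV (partial b \<phi>)"
      using dd by (intro continuous_at_imp_continuous_on ballI differentiable_imp_continuous_within)
    show "continuous_on UNIV (grad (partial b \<phi>))"
      unfolding grad_def by (intro continuous_on_sum continuous_on_scaleR continuous_on_const)
        (use t(3) that in \<open>simp add: numeral_2_eq_2\<close>)
  qed
  have pz: "partial b \<phi> x = 0" if "x \<notin> K0" for b x
  proof -
    show ?thesis using GDERIV_partial[OF C1cD(2)[OF t(1)]] C1c_grad_zero[OF t(1) that] by simp
  qed
  have openK: "open (- K0)" using Kc by (simp add: compact_imp_closed open_Compl)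
  have cover: "D \<union> - K0 = UNIV" using t(2) by blast
  \<comment> \<open>The products are extended by zero outside \<open>D\<close>; they are C^1 because
    \<open>D\<close> and the complement of \<open>K0\<close> form an open cover of the
    plane.\<close>
  define F where "F b x = (if x \<in> D then \<psi> x * partial b \<phi> x else 0)" for b x
  define gF where "gF b x = (if x \<in> D then \<psi> x *\<^sub>R grad (partial b \<phi>) x + partial b \<phi> x *\<^sub>R V x else 0)" for b x
  have FC: "C1c (F b) (gF b) K0" if b: "b \<in> Basis" for b
    unfolding C1c_def
  proof (intro conjI allI impI Kc)
    have gz: "gF b x = 0" if "x \<notin> K0" for x
    proof -
      have "GDERIV (\<lambda>x. 0) x :> grad (partial b \<phi>) x"
        by (rule GDERIV_cong_open[OF pd[OF b] openK]) (use that pz in auto)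
      then have "grad (partial b \<phi>) x = 0" by (rule GDERIV_const_imp)
      then show ?thesis using pz[OF that] by (simp add: gF_def)
    qed
    show F0: "F b x = 0" if "x \<notin> K0" for x using pz[OF that] by (simp add: F_def)
    show "GDERIV (F b) x :> gF b x" for x
    proof (cases "x \<in> D")
      case True
      have "GDERIV (\<lambda>x. \<psi> x * partial b \<phi> x) x :> gF b x"
        using GDERIV_mult[OF d[OF True] pd[OF b]] True by (simp add: gF_def)
      then show ?thesis
        by (rule GDERIV_cong_open[OF _ open_D True]) (simp add: F_def)
    next
      case False
      then have xK: "x \<in> - K0" using t(2) by blast
      then have "GDERIV (\<lambda>x. 0) x :> gF b x" using gz GDERIV_const by auto
      then show ?thesis
        by (rule GDERIV_cong_open[OF _ openK xK]) (use F0 in auto)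
    qed
    have "continuous_on D (gF b)"
    proof (rule continuous_on_eq)
      show "continuous_on D (\<lambda>x. \<psi> x *\<^sub>R grad (partial b \<phi>) x + partial b \<phi> x *\<^sub>R V x)"
        by (intro continuous_intros cpsi V(1) continuous_on_subset[OF pc[OF b]] continuous_on_subset[OF pgc[OF b]]) auto
    qed (simp add: gF_def)
    moreover have "continuous_on (- K0) (gF b)"
      by (rule continuous_on_eq[OF continuous_on_const[of _ 0]]) (use gz in auto)
    ultimately show "continuous_on UNIV (gF b)"
      using continuous_on_open_Un[OF open_D openK] cover by metis
  qed
  have e: "?e1 \<in> Basis" "?e2 \<in> Basis" by (auto simp: Basis_vec2)
  have I: "integrable lborel (gF ?e1)" "integrable lborel (gF ?e2)" "(\<integral>x. gF ?e1 x \<partial>lborel) = 0" "(\<integral>x. gF ?e2 x \<partial>lborel) = 0"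
    using integral_C1c_grad[OF FC[OF e(1)]] integral_C1c_grad[OF FC[OF e(2)]] by auto
  have J: "integrable lborel (\<lambda>x. gF ?e1 x \<bullet> ?e2)" "integrable lborel (\<lambda>x. gF ?e2 x \<bullet> ?e1)"
    using I(1,2) by (auto intro: integrable_inner_left)
  have eq: "indicator D x *\<^sub>R (perp (V x) \<bullet> grad \<phi> x) = gF ?e1 x \<bullet> ?e2 - gF ?e2 x \<bullet> ?e1" for x
  proof (cases "x \<in> D")
    case True
    have "partial ?e1 (partial ?e2 \<phi>) x = partial ?e2 (partial ?e1 \<phi>) x"
      by (rule partial_commute[OF open_UNIV _ e t(3)]) simp
    then show ?thesis
      using True by (simp add: gF_def perp_inner inner_axis grad2 algebra_simps)
  qed (simp add: gF_def)
  have "(LINT x:D|lebesgue. perp (V x) \<bullet> grad \<phi> x) = (\<integral>x. gF ?e1 x \<bullet> ?e2 - gF ?e2 x \<bullet> ?e1 \<partial>lebesgue)"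
    unfolding set_lebesgue_integral_def eq ..
  also have "\<dots> = (\<integral>x. gF ?e1 x \<bullet> ?e2 - gF ?e2 x \<bullet> ?e1 \<partial>lborel)"
    using J by (intro integral_completion) auto
  also have "\<dots> = 0"
    using J I integral_inner_left[OF I(1), of ?e2] integral_inner_left[OF I(2), of ?e1] by simp
  finally show "(LINT x:D|lebesgue. perp (V x) \<bullet> grad \<phi> x) = 0" .
qed

text \<open>Testing with \<open>\<tau> \<chi>(\<psi>)\<close>, where \<open>\<psi>\<close> is the stream function itself, makes the cutoff \<open>\<chi>\<close>
  invisible to the flow, so that no information on the behaviour of \<open>\<nabla>\<psi>\<close> at the boundary is needed.\<close>

lemma no_patch_where_monotone:
  assumes A: "A1 \<in> sets lebesgue" "A2 \<in> sets lebesgue" "A1 \<subseteq> D" "A2 \<subseteq> D"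
    and loc: "A1 \<subseteq> ball p \<epsilon>" "A2 \<inter> ball p (2 * \<epsilon>) = {}" and \<epsilon>: "\<epsilon> > 0"
    and d: "\<And>x. x \<in> D \<Longrightarrow> GDERIV \<psi> x :> V x" and V: "continuous_on D V" "\<And>x. x \<in> D \<Longrightarrow> norm (V x) \<le> M"
    and \<psi>: "\<And>x. x \<in> D \<Longrightarrow> 0 \<le> \<psi> x" "\<And>x. x \<in> D \<Longrightarrow> \<psi> x \<le> C * bdist x" and C: "C > 0"
    and mono: "\<And>x. x \<in> D \<Longrightarrow> x \<in> ball p \<epsilon> \<Longrightarrow> V x \<bullet> e > 0"
    and weak: "\<And>\<phi>. test_function D \<phi> \<Longrightarrow>
      (LINT x:D|lebesgue. (1 - indicator (A1 \<union> A2) x) * (perp (V x) \<bullet> grad \<phi> x)) = 0"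
  shows "measure lebesgue A1 = 0"
proof -
  let ?A = "A1 \<union> A2"
  obtain \<tau> g\<tau> where \<tau>: "\<And>x. GDERIV \<tau> x :> g\<tau> x" "continuous_on UNIV g\<tau>" "\<And>x. x \<in> ball p \<epsilon> \<Longrightarrow> g\<tau> x = perp e"
    "\<And>x. x \<notin> ball p (2 * \<epsilon>) \<Longrightarrow> \<tau> x = 0 \<and> g\<tau> x = 0"
    by (rule cutoff_linear[OF \<epsilon>, of p "perp e"]) (rule that)
  have c\<tau>: "continuous_on UNIV \<tau>"
    using \<tau>(1) unfolding gderiv_def by (meson continuous_at_imp_continuous_on has_derivative_continuous)
  have cpsi: "continuous_on D \<psi>"
    using d unfolding gderiv_def by (meson continuous_at_imp_continuous_on has_derivative_continuous)
  have small: "AE x in lebesgue. x \<in> A1 \<longrightarrow> \<psi> x \<le> \<eta>" if \<eta>: "\<eta> > 0" for \<eta>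
  proof -
    \<comment> \<open>Where \<psi> reaches \<eta>, the boundary distance is at least
      \<open>\<eta> / C\<close>; truncation at the level \<eta> therefore has compact support in
      \<open>D\<close>, even if the patch comes arbitrarily close to the frontier.\<close>
    define K where "K = {x \<in> closure D. \<eta> / C \<le> bdist x}"
    have cbd: "continuous_on UNIV bdist" unfolding bdist_def[abs_def] by (intro continuous_intros)
    have "closed {x. \<eta> / C \<le> bdist x}" by (intro closed_Collect_le continuous_intros cbd)
    then have "closed K" unfolding K_def using closed_Int[OF closed_closure] by (simp add: Collect_conj_eq)
    moreover have "bounded K" using bounded_closure[OF bounded_D] by (rule bounded_subset) (auto simp: K_def)
    ultimately have Kc: "compact K" by (simp add: compact_eq_bounded_closed)
    have KD: "K \<subseteq> D"
    proof
      fix x assume x: "x \<in> K"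
      have "\<not> x \<in> frontier D"
      proof
        assume "x \<in> frontier D"
        then have "bdist x \<le> 0" using bdist_le[of x x] by simp
        moreover have "\<eta> / C > 0" using \<eta> C by simp
        ultimately show False using x by (simp add: K_def)
      qed
      then show "x \<in> D" using x open_D by (auto simp: K_def frontier_def interior_open)
    qed
    have outK: "\<psi> x < \<eta>" if "x \<in> D" "x \<notin> K" for x
    proof -
      have "x \<in> closure D" using that closure_subset by blast
      then have "bdist x < \<eta> / C" using that by (simp add: K_def)
      then have "C * bdist x < \<eta>" using C by (simp add: pos_less_divide_eq mult.commute)
      then show ?thesis using \<psi>(2)[OF that(1)] by simp
    qed
    have openK: "open (- K)" using Kc by (simp add: compact_imp_closed open_Compl)
    define f where "f x = (if x \<in> D then \<tau> x * pos2 (\<psi> x - \<eta>) else 0)" for x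
    define g where "g x = (if x \<in> D then \<tau> x *\<^sub>R ((2 * max 0 (\<psi> x - \<eta>)) *\<^sub>R V x) + pos2 (\<psi> x - \<eta>) *\<^sub>R g\<tau> x else 0)" for x
    have f0: "f x = 0" and g0: "g x = 0" if "x \<notin> K" for x
      using outK[of x] that by (auto simp: f_def g_def pos2_def max_def)
    have fd: "GDERIV f x :> g x" for x
    proof (cases "x \<in> D")
      case True
      have "GDERIV (\<lambda>x. \<psi> x - \<eta>) x :> V x"
        using GDERIV_diff[OF d[OF True] GDERIV_const[of \<eta>]] by simp
      from GDERIV_mult[OF \<tau>(1) GDERIV_DERIV_compose[OF this DERIV_pos2]]
      have "GDERIV (\<lambda>x. \<tau> x * pos2 (\<psi> x - \<eta>)) x :> g x"
        using True by (simp add: g_def)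
      then show ?thesis
        by (rule GDERIV_cong_open[OF _ open_D True]) (simp add: f_def)
    next
      case False
      then have xK: "x \<in> - K" using KD by blast
      then have "GDERIV (\<lambda>x. 0) x :> g x" using g0 GDERIV_const by auto
      then show ?thesis by (rule GDERIV_cong_open[OF _ openK xK]) (use f0 in auto)
    qed
    have "continuous_on D g"
    proof (rule continuous_on_eq)
      show "continuous_on D (\<lambda>x. \<tau> x *\<^sub>R ((2 * max 0 (\<psi> x - \<eta>)) *\<^sub>R V x) + pos2 (\<psi> x - \<eta>) *\<^sub>R g\<tau> x)"
        by (intro continuous_intros continuous_pos2 cpsi V(1) continuous_on_subset[OF c\<tau>] continuous_on_subset[OF \<tau>(2)]) auto
    qed (simp add: g_def)
    moreover have "continuous_on (- K) g"
      by (rule continuous_on_eq[OF continuous_on_const[of _ 0]]) (use g0 in auto)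
    moreover have "D \<union> - K = UNIV" using KD by blast
    ultimately have gc: "continuous_on UNIV g"
      using continuous_on_open_Un[OF open_D openK] by metis
    have Cf: "C1c f g K"
      unfolding C1c_def using Kc fd gc f0 by blast
    let ?W = "\<lambda>x. (1 - indicator ?A x) *\<^sub>R perp (V x)"
    have mV: "(\<lambda>x. indicator D x *\<^sub>R perp (V x)) \<in> borel_measurable lebesgue"
      by (rule measurable_indicator_D[OF continuous_on_perp[OF V(1)] D_sets])
    have As: "?A \<in> sets lebesgue" using A by auto
    have mW: "(\<lambda>x. indicator D x *\<^sub>R ?W x) \<in> borel_measurable lebesgue"
    proof -
      have "(\<lambda>x. (1 - indicator ?A x) *\<^sub>R (indicator D x *\<^sub>R perp (V x))) \<in> borel_measurable lebesgue"
        by (intro borel_measurable_scaleR borel_measurable_diff borel_measurable_const borel_measurable_indicator As mV)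
      then show ?thesis by (simp add: mult_ac)
    qed
    have w1: "(LINT x:D|lebesgue. ?W x \<bullet> g x) = 0"
    proof (rule weak_form_C1c[OF mW _ _ Cf KD])
      show "norm (?W x) \<le> M" if "x \<in> D" for x
        using V(2)[OF that] by (auto simp: norm_perp split: split_indicator intro: order_trans[OF norm_ge_zero])
      show "(LINT x:D|lebesgue. ?W x \<bullet> grad \<phi> x) = 0" if "test_function D \<phi>" for \<phi>
        using weak[OF that] by simp
    qed
    have w2: "(LINT x:D|lebesgue. perp (V x) \<bullet> g x) = 0"
      by (rule integral_perp_grad[OF d V Cf KD])
    obtain Mg where Mg: "Mg > 0" "\<And>x. norm (g x) \<le> Mg"
      by (rule compact_support_bounded[OF Kc gc]) (erule g0, rule that)
    have M0: "M \<ge> 0" using V(2) nonempty_D by (metis norm_ge_zero order_trans all_not_in_conv)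
    have bV: "\<bar>perp (V x) \<bullet> g x\<bar> \<le> M * Mg" if "x \<in> D" for x
    proof -
      have "\<bar>perp (V x) \<bullet> g x\<bar> \<le> norm (perp (V x)) * norm (g x)"
        by (rule Cauchy_Schwarz_ineq2)
      also have "\<dots> \<le> M * Mg" using V(2)[OF that] Mg M0 by (intro mult_mono) (auto simp: norm_perp)
      finally show ?thesis .
    qed
    have mg: "(\<lambda>x. indicator D x *\<^sub>R (perp (V x) \<bullet> g x)) \<in> borel_measurable lebesgue"
    proof -
      have "(\<lambda>x. (indicator D x *\<^sub>R perp (V x)) \<bullet> g x) \<in> borel_measurable lebesgue"
        by (intro borel_measurable_inner mV measurable_lebesgueI borel_measurable_continuous_onI gc)
      then show ?thesis by simp
    qed
    have mWg: "(\<lambda>x. indicator D x *\<^sub>R (?W x \<bullet> g x)) \<in> borel_measurable lebesgue"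
    proof -
      have "(\<lambda>x. (indicator D x *\<^sub>R ?W x) \<bullet> g x) \<in> borel_measurable lebesgue"
        by (intro borel_measurable_inner mW measurable_lebesgueI borel_measurable_continuous_onI gc)
      then show ?thesis by (simp only: inner_scaleR_left real_scaleR_def)
    qed
    have i1: "set_integrable lebesgue D (\<lambda>x. perp (V x) \<bullet> g x)"
      by (rule bounded_integrable_D(1)[OF mg bV])
    have i2: "set_integrable lebesgue D (\<lambda>x. ?W x \<bullet> g x)"
      by (rule bounded_integrable_D(1)[OF mWg, where M="M * Mg"]) (use bV M0 Mg in \<open>auto split: split_indicator\<close>)
    \<comment> \<open>What the difference of the two weak identities leaves: the part of
      \<open>g\<close> along \<open>V\<close> is orthogonal to \<open>perp (V x)\<close>,
      \<open>perp (V x) \<bullet> perp e\<close> equals \<open>V x \<bullet> e\<close>, and \<tau>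
      and its gradient vanish on \<open>A2\<close>.\<close>
    define q where "q x = indicator A1 x * (pos2 (\<psi> x - \<eta>) * (V x \<bullet> e))" for x
    have eq: "indicator D x *\<^sub>R (perp (V x) \<bullet> g x) - indicator D x *\<^sub>R (?W x \<bullet> g x) = q x" for x
    proof -
      consider "x \<in> A1" | "x \<in> A2" "x \<notin> A1" | "x \<notin> ?A" by blast
      then show ?thesis
      proof cases
        case 1
        then have x: "x \<in> D" "x \<in> ball p \<epsilon>" using A loc by auto
        have "perp (V x) \<bullet> g x = pos2 (\<psi> x - \<eta>) * (V x \<bullet> e)"
          using x \<tau>(3)[OF x(2)] by (simp add: g_def inner_add_right perp_self perp_inner_perp)
        then show ?thesis using 1 x by (simp add: q_def)
      next
        case 2
        then have "x \<notin> ball p (2 * \<epsilon>)" using loc by blast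
        then have "g x = 0" using \<tau>(4)[of x] by (simp add: g_def)
        then show ?thesis using 2 by (simp add: q_def)
      next
        case 3
        then show ?thesis by (simp add: q_def)
      qed
    qed
    have iq: "integrable lebesgue q"
      using Bochner_Integration.integrable_diff[OF i1[unfolded set_integrable_def] i2[unfolded set_integrable_def]]
      by (simp only: eq)
    have "(\<integral>x. q x \<partial>lebesgue) = 0"
      using Bochner_Integration.integral_diff[OF i1[unfolded set_integrable_def] i2[unfolded set_integrable_def]] w1 w2
      unfolding set_lebesgue_integral_def eq by simp
    moreover have qn: "q x \<ge> 0" for x
    proof (cases "x \<in> A1")
      case True
      then have "V x \<bullet> e > 0" using A loc by (intro mono) auto
      then show ?thesis by (simp add: q_def pos2_def)
    qed (simp add: q_def)
    ultimately have "AE x in lebesgue. q x = 0"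
      using integral_nonneg_eq_0_iff_AE[OF iq] by simp
    then show ?thesis
    proof eventually_elim
      case (elim x)
      show ?case
      proof
        assume x: "x \<in> A1"
        then have "V x \<bullet> e > 0" using A loc by (intro mono) auto
        then have "pos2 (\<psi> x - \<eta>) = 0" using elim x by (simp add: q_def)
        then show "\<psi> x \<le> \<eta>" by (simp add: pos2_def max_def split: if_splits)
      qed
    qed
  qed
  \<comment> \<open>A zero of the nonnegative \<psi> would be a minimum, but \<psi> increases
    strictly along \<open>e\<close> and would be negative just behind that point.\<close>
  have pos: "\<psi> x > 0" if x: "x \<in> D" "x \<in> ball p \<epsilon>" for x
  proof (rule ccontr)
    assume "\<not> \<psi> x > 0"
    then have z: "\<psi> x = 0" using \<psi>(1)[OF x(1)] by simp
    have "((\<lambda>t. \<psi> (x + t *\<^sub>R e)) has_real_derivative e \<bullet> V x) (at 0)"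
      using d[OF x(1)] by (intro GDERIV_line) simp
    from DERIV_pos_inc_left[OF this] obtain s where s: "s > 0" "\<And>h. 0 < h \<Longrightarrow> h < s \<Longrightarrow> \<psi> (x + (0 - h) *\<^sub>R e) < \<psi> (x + 0 *\<^sub>R e)"
      using mono[OF x] by (auto simp: inner_commute)
    obtain r where r: "r > 0" "ball x r \<subseteq> D" using open_D x(1) open_contains_ball by blast
    define N where "N = norm e + 1"
    have N: "N > 0" "norm e \<le> N" by (auto simp: N_def add_nonneg_pos)
    define h where "h = min (s / 2) (r / (2 * N))"
    have h: "0 < h" "h < s" using s r N by (auto simp: h_def)
    have "h * norm e \<le> r / (2 * N) * N"
      using h r N by (intro mult_mono) (auto simp: h_def)
    also have "\<dots> = r / 2" using N by simp
    finally have "x + (0 - h) *\<^sub>R e \<in> ball x r" using r h by (simp add: dist_norm)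
    then have "\<psi> (x + (0 - h) *\<^sub>R e) \<ge> 0" using r \<psi>(1) by blast
    then show False using s(2)[OF h] z by simp
  qed
  \<comment> \<open>Countably many levels exclude every positive value of \<psi>, and their null
    sets can be united.\<close>
  have "AE x in lebesgue. \<forall>n. x \<in> A1 \<longrightarrow> \<psi> x \<le> 1 / real (Suc n)"
    unfolding AE_all_countable by (intro allI small) simp
  then have "AE x in lebesgue. x \<notin> A1"
  proof eventually_elim
    case (elim x)
    show ?case
    proof
      assume x: "x \<in> A1"
      then have "\<psi> x > 0" using A loc by (intro pos) auto
      then obtain n where n: "1 / real (Suc n) < \<psi> x" using nat_approx_posE by metis
      have "\<psi> x \<le> 1 / real (Suc n)" using elim x by blast
      then show False using n by linarith
    qed
  qed
  then have "A1 \<in> null_sets lebesgue"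
    using AE_iff_null_sets[OF A(1)] by blast
  then show ?thesis by (rule measure_eq_0_null_sets)
qed

end

subsection \<open>The torsion function near the boundary\<close>

locale torsion_domain = green_domain +
  fixes \<psi>\<^sub>0 :: "real^2 \<Rightarrow> real"
  assumes torsion: "torsion_function D \<psi>\<^sub>0"
begin

lemma cont_psi: "continuous_on (closure D) \<psi>\<^sub>0"
  and Ck_psi: "Ck_on 2 \<psi>\<^sub>0 D"
  and laplacian_psi: "x \<in> D \<Longrightarrow> laplacian \<psi>\<^sub>0 x = -1"
  and psi_frontier: "x \<in> frontier D \<Longrightarrow> \<psi>\<^sub>0 x = 0"
  using torsion unfolding torsion_function_def by force+

lemma GDERIV_psi: "x \<in> D \<Longrightarrow> GDERIV \<psi>\<^sub>0 x :> grad \<psi>\<^sub>0 x"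
  using Ck_psi by (intro GDERIV_grad) (simp add: numeral_2_eq_2)

lemma gpotD_eq:
  assumes x: "x \<in> D"
  shows "gpot D x = C0 *\<^sub>R grad \<psi>\<^sub>0 x"
proof -
  have "GDERIV (\<lambda>x. C0 * \<psi>\<^sub>0 x) x :> C0 *\<^sub>R grad \<psi>\<^sub>0 x"
    using GDERIV_mult[OF GDERIV_const[of C0] GDERIV_psi[OF x]] by simp
  then have "GDERIV (pot D) x :> C0 *\<^sub>R grad \<psi>\<^sub>0 x"
    by (rule GDERIV_cong_open[OF _ open_D x]) (simp add: potD_eq_torsion[OF torsion])
  then show ?thesis
    using GDERIV_imp_grad GDERIV_pot[OF x D_sets] by metis
qed

lemma psi_nonneg:
  assumes "x \<in> closure D"
  shows "\<psi>\<^sub>0 x \<ge> 0"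
proof (cases "x \<in> D")
  case True
  then show ?thesis
    using pot_nonneg[OF True D_sets] potD_eq_torsion[OF torsion True] C0_pos by (simp add: zero_le_mult_iff)
next
  case False
  then have "x \<in> frontier D" using assms open_D by (simp add: frontier_def interior_open)
  then show ?thesis by (simp add: psi_frontier)
qed

text \<open>Boundedness up to the frontier is inherited from the potential of \<open>D\<close>,
  whose gradient bound is uniform.\<close>

lemma grad_psi_bounded:
  obtains L where "L > 0" "\<And>x. x \<in> D \<Longrightarrow> norm (grad \<psi>\<^sub>0 x) \<le> L"
proof -
  define L where "L = CG * (14 * sqrt (measure lebesgue D)) / C0 + 1"
  have "norm (grad \<psi>\<^sub>0 x) \<le> L" if x: "x \<in> D" for x
  proof -
    have "C0 * norm (grad \<psi>\<^sub>0 x) \<le> CG * (14 * sqrt (measure lebesgue D))"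
      using norm_gpot_le[OF x D_sets] C0_pos by (simp add: gpotD_eq[OF x])
    then have "norm (grad \<psi>\<^sub>0 x) \<le> CG * (14 * sqrt (measure lebesgue D)) / C0"
      using C0_pos by (simp add: pos_le_divide_eq mult.commute)
    then show ?thesis by (simp add: L_def)
  qed
  moreover have "L > 0" using CG_pos C0_pos by (simp add: L_def add_nonneg_pos)
  ultimately show thesis using that by blast
qed

text \<open>The left-hand side is the torsion function of the disc. Adding \<bar>q - y\<bar>^2 / 4
  makes \<open>\<psi>\<^sub>0\<close> harmonic, and on the circle only its nonnegativity is
  used.\<close>

lemma psi_ge_ball:
  assumes R: "R > 0" and sub: "ball q R \<subseteq> D" and y: "y \<in> ball q R"
  shows "(R\<^sup>2 - (dist q y)\<^sup>2) / 4 \<le> \<psi>\<^sub>0 y"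
proof -
  have cl: "closure (ball q R) \<subseteq> closure D" using sub by (rule closure_mono)
  have "R\<^sup>2 / 4 \<le> \<psi>\<^sub>0 y + (dist q y)\<^sup>2 / 4"
  proof (rule harmonic_minimum_principle[where U="ball q R" and h="\<lambda>z. \<psi>\<^sub>0 z + (dist q z)\<^sup>2 / 4"])
    show "continuous_on (closure (ball q R)) (\<lambda>z. \<psi>\<^sub>0 z + (dist q z)\<^sup>2 / 4)"
      by (intro continuous_on_add continuous_on_divide continuous_on_power continuous_on_dist
          continuous_on_const continuous_on_id continuous_on_subset[OF cont_psi cl]) auto
    show "harmonic_on (\<lambda>z. \<psi>\<^sub>0 z + (dist q z)\<^sup>2 / 4) (ball q R)"
      by (rule harmonic_on_subset[OF harmonic_on_torsion[OF open_D Ck_psi laplacian_psi] sub])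
    show "y \<in> closure (ball q R)" using y closure_subset by blast
    fix x assume x: "x \<in> frontier (ball q R)"
    then have "dist q x = R" using R by (simp add: frontier_ball)
    moreover have "\<psi>\<^sub>0 x \<ge> 0" using x cl by (intro psi_nonneg) (auto simp: frontier_def)
    ultimately show "R\<^sup>2 / 4 \<le> \<psi>\<^sub>0 x + (dist q x)\<^sup>2 / 4" by simp
  qed auto
  then show ?thesis by simp
qed

text \<open>Boundary regularity of \<open>\<psi>\<^sub>0\<close> is avoided: the difference quotients of \<open>\<psi>\<^sub>0\<close> in the
  direction \<open>e\<close> are harmonic up to an affine term, bounded below by a positive constant on the boundary
  (interior tangent balls), and the logarithm of the distance to an exterior tangent ball
  at \<open>p\<close> is a barrier that carries this lower bound inside, uniformly in the step size.\<close>

lemma derivative_positive_near_frontier: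
  assumes p: "p \<in> frontier D"
  obtains e c \<rho> where "c > 0" "\<rho> > 0" "\<And>x. x \<in> D \<Longrightarrow> x \<in> ball p \<rho> \<Longrightarrow> c \<le> grad \<psi>\<^sub>0 x \<bullet> e"
proof -
  obtain \<rho> R0 c e where \<rho>: "\<rho> > 0" and R0: "R0 > 0" and c: "c > 0" and e: "norm e = 1"
    and balls: "\<And>\<xi>. \<xi> \<in> frontier D \<Longrightarrow> \<xi> \<in> ball p \<rho> \<Longrightarrow> \<exists>n. norm n = 1 \<and> c \<le> n \<bullet> e \<and>
       (\<forall>R. 0 < R \<longrightarrow> R \<le> R0 \<longrightarrow> ball (\<xi> - R *\<^sub>R n) R \<inter> D = {} \<and> ball (\<xi> + R *\<^sub>R n) R \<subseteq> D)"
    and up: "\<And>x t. x \<in> closure D \<Longrightarrow> x \<in> ball p \<rho> \<Longrightarrow> 0 < t \<Longrightarrow> t < \<rho> \<Longrightarrow> x + t *\<^sub>R e \<in> D"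
    by (rule graph_tangent_balls[OF open_D boundary_D p]) (rule that)
  obtain L where L: "L > 0" "\<And>x. x \<in> D \<Longrightarrow> norm (grad \<psi>\<^sub>0 x) \<le> L"
    by (rule grad_psi_bounded) (rule that)
  have pcl: "p \<in> closure D" using p by (simp add: frontier_def)
  obtain n where n: "norm n = 1" "ball (p - R0 *\<^sub>R n) R0 \<inter> D = {}"
    using balls[OF p] \<rho> R0 by auto
  \<comment> \<open>Halving the radius makes the exterior disc touch \<open>closure D\<close> at
    \<open>p\<close> alone, so the barrier is strictly positive at all other points.\<close>
  define q where "q = p - (R0 / 2) *\<^sub>R n"
  have qp: "dist p q = R0 / 2" using n R0 by (simp add: q_def dist_norm)
  have far: "R0 / 2 < dist x q" if x: "x \<in> closure D" "x \<noteq> p" for x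
  proof (rule ccontr)
    assume le: "\<not> R0 / 2 < dist x q"
    define z where "z = x - p"
    have z: "z \<noteq> 0" using x by (simp add: z_def)
    have nn: "n \<bullet> n = 1" using n by (simp add: norm_eq_1)
    have "x - q = z + (R0 / 2) *\<^sub>R n" by (simp add: z_def q_def)
    then have "norm (z + (R0 / 2) *\<^sub>R n) \<le> R0 / 2" using le by (simp add: dist_norm)
    then have "(norm (z + (R0 / 2) *\<^sub>R n))\<^sup>2 \<le> (R0 / 2)\<^sup>2" by (intro power_mono) auto
    moreover have sq: "(norm (z + a *\<^sub>R n))\<^sup>2 = z \<bullet> z + 2 * a * (z \<bullet> n) + a\<^sup>2" for a
      unfolding power2_norm_eq_inner by (simp add: inner_add_left inner_add_right inner_commute nn power2_eq_square)
    ultimately have 1: "z \<bullet> z + R0 * (z \<bullet> n) \<le> 0" by simp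
    have "z \<bullet> z > 0" using z by simp
    then have "z \<bullet> z + 2 * R0 * (z \<bullet> n) + R0\<^sup>2 < R0\<^sup>2" using 1 by linarith
    then have "(norm (z + R0 *\<^sub>R n))\<^sup>2 < R0\<^sup>2" unfolding sq .
    then have "norm (z + R0 *\<^sub>R n) < R0" using R0 by (simp add: power2_less_imp_less)
    then have "x \<in> ball (p - R0 *\<^sub>R n) R0"
      by (simp add: dist_norm z_def norm_minus_commute algebra_simps)
    then show False
      using n(2) x(1) open_Int_closure_eq_empty[OF open_ball, of "p - R0 *\<^sub>R n" R0 D] by blast
  qed
  have qcl: "R0 / 2 \<le> dist x q" if "x \<in> closure D" for x
    using far[OF that] qp by (cases "x = p") auto
  then have qne: "x \<noteq> q" if "x \<in> closure D" for x using that R0 by force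
  define h where "h x = ln (dist x q) - ln (R0 / 2)" for x
  have hc: "continuous_on (closure D) h"
    unfolding h_def[abs_def] by (intro continuous_intros) (use qne in auto)
  have hn: "h x \<ge> 0" if "x \<in> closure D" for x
    using qcl[OF that] R0 unfolding h_def by (simp add: ln_mono)
  have hp: "h p = 0" by (simp add: h_def qp)
  have hpos: "h x > 0" if "x \<in> closure D" "x \<noteq> p" for x
    unfolding h_def diff_gt_0_iff_gt
    by (rule iffD2[OF ln_less_cancel_iff]) (use far[OF that] R0 in auto)
  define \<rho>2 where "\<rho>2 = \<rho> / 2"
  have \<rho>2: "\<rho>2 > 0" "\<rho>2 < \<rho>" using \<rho> by (auto simp: \<rho>2_def)
  define U where "U = D \<inter> ball p \<rho>2"
  have U: "open U" "bounded U" using open_D by (auto simp: U_def intro: bounded_subset[OF bounded_ball])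
  have "U \<subseteq> D" "U \<subseteq> cball p \<rho>2" by (auto simp: U_def)
  then have clU: "closure U \<subseteq> closure D" "closure U \<subseteq> cball p \<rho>2"
    by (simp_all add: closure_mono closure_minimal)
  have frU: "x \<in> frontier D \<or> x \<in> D \<and> dist p x = \<rho>2" if x: "x \<in> frontier U" for x
  proof -
    have xc: "x \<in> closure D" "dist p x \<le> \<rho>2" "x \<notin> U"
      using x clU U by (auto simp: frontier_def interior_open)
    then show ?thesis using open_D by (auto simp: U_def frontier_def interior_open)
  qed
  \<comment> \<open>A positive lower bound for the barrier on the circular part of the boundary of
    \<open>U\<close>, where only the Lipschitz bound for \<open>\<psi>\<^sub>0\<close> is at
    hand.\<close>
  obtain m where m: "m > 0" "\<And>x. x \<in> closure D \<Longrightarrow> dist p x = \<rho>2 \<Longrightarrow> m \<le> h x"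
  proof (cases "closure D \<inter> sphere p \<rho>2 = {}")
    case True
    then show thesis by (intro that[of 1]) auto
  next
    case False
    have "compact (closure D \<inter> sphere p \<rho>2)"
      using bounded_D by (intro compact_Int) (auto simp: compact_closure)
    moreover have "continuous_on (closure D \<inter> sphere p \<rho>2) h"
      by (rule continuous_on_subset[OF hc]) auto
    ultimately obtain y where y: "y \<in> closure D \<inter> sphere p \<rho>2" "\<And>x. x \<in> closure D \<inter> sphere p \<rho>2 \<Longrightarrow> h y \<le> h x"
      using continuous_attains_inf[of "closure D \<inter> sphere p \<rho>2" h] False by blast
    have "h y > 0" using y(1) \<rho>2 by (intro hpos) auto
    then show thesis using y(2) by (intro that[of "h y"]) auto
  qed
  \<comment> \<open>At a frontier point \<open>y\<close> the inner tangent disc gives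
    \<open>\<psi>\<^sub>0 (y + t *\<^sub>R e) \<ge> (2 * R0 * t * c - t\<^sup>2) / 4\<close>, which
    is at least \<open>c3 * t\<close> as long as \<open>t \<le> R0 * c\<close>.\<close>
  define c3 where "c3 = R0 * c / 4"
  have c3: "c3 > 0" using R0 c by (simp add: c3_def)
  \<comment> \<open>On the circular part \<open>M * h\<close> is then at least \<open>c3 + L\<close>
    and outweighs a difference quotient as low as \<open>- L\<close>.\<close>
  define M where "M = (c3 + L) / m"
  have M: "M > 0" "M * m = c3 + L" using c3 L m by (auto simp: M_def)
  have quot: "c3 - M * h x \<le> (\<psi>\<^sub>0 (x + t *\<^sub>R e) - \<psi>\<^sub>0 x) / t"
    if x: "x \<in> U" and t: "0 < t" "t < \<rho>2" "t \<le> R0 * c" for x t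
  proof -
    have inD: "y + t *\<^sub>R e \<in> D" if "y \<in> closure U" for y
      using that clU \<rho>2 t by (intro up) auto
    let ?w = "\<lambda>x. (1 / t) * (\<psi>\<^sub>0 (x + t *\<^sub>R e) - \<psi>\<^sub>0 x) + M * h x"
    have "c3 \<le> ?w x"
    proof (rule harmonic_minimum_principle[OF U, where h="?w"])
      show "continuous_on (closure U) ?w"
        by (intro continuous_intros continuous_on_subset[OF hc clU(1)] continuous_on_subset[OF cont_psi clU(1)]
            continuous_on_compose2[OF cont_psi]) (use inD closure_subset in auto)
      show "x \<in> closure U" using x closure_subset by blast
      \<comment> \<open>The quadratic corrections at \<open>z\<close> and at the shifted point
        differ by an affine function of \<open>z\<close>, so the difference quotient itself is
        harmonic.\<close>
      let ?k = "\<lambda>z. \<psi>\<^sub>0 z + (dist p z)\<^sup>2 / 4"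
      have hk: "harmonic_on ?k D" by (rule harmonic_on_torsion[OF open_D Ck_psi laplacian_psi])
      have hk2: "harmonic_on (\<lambda>z. ?k (z + t *\<^sub>R e)) U"
        by (rule harmonic_on_subset[OF harmonic_on_translate[OF hk]]) (use inD closure_subset in auto)
      have hh: "harmonic_on h U"
        unfolding h_def[abs_def]
        by (intro harmonic_on_diff harmonic_on_const harmonic_on_subset[OF harmonic_on_ln_dist])
          (use qne clU closure_subset in blast)
      have "harmonic_on (\<lambda>z. (1 / t) * ((?k (z + t *\<^sub>R e) - ?k z) - (1 / 4) * (2 * t * (z \<bullet> e) + (t\<^sup>2 - 2 * t * (p \<bullet> e)))) + M * h z) U"
        by (intro harmonic_on_add harmonic_on_cmult harmonic_on_diff hk2 hh harmonic_on_inner harmonic_on_const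
            harmonic_on_subset[OF hk]) (auto simp: U_def)
      moreover have "(\<lambda>z. (1 / t) * ((?k (z + t *\<^sub>R e) - ?k z) - (1 / 4) * (2 * t * (z \<bullet> e) + (t\<^sup>2 - 2 * t * (p \<bullet> e)))) + M * h z) = ?w"
      proof
        fix z
        have ee: "e \<bullet> e = 1" using e by (simp add: norm_eq_1)
        have cancel: "P + a / 4 - (Q + b / 4) - 1 / 4 * c = P - Q" if "a = b + c" for a b c P Q :: real
          using that by (simp add: add_divide_distrib)
        have "(dist p (z + t *\<^sub>R e))\<^sup>2 = (dist p z)\<^sup>2 + (2 * t * (z \<bullet> e) + (t\<^sup>2 - 2 * t * (p \<bullet> e)))"
          unfolding dist_norm power2_norm_eq_inner
          by (simp add: inner_diff_left inner_diff_right inner_add_left inner_add_right inner_commute ee power2_eq_square algebra_simps)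
        then have "(?k (z + t *\<^sub>R e) - ?k z) - (1 / 4) * (2 * t * (z \<bullet> e) + (t\<^sup>2 - 2 * t * (p \<bullet> e))) = \<psi>\<^sub>0 (z + t *\<^sub>R e) - \<psi>\<^sub>0 z"
          by (rule cancel)
        then show "(1 / t) * ((?k (z + t *\<^sub>R e) - ?k z) - (1 / 4) * (2 * t * (z \<bullet> e) + (t\<^sup>2 - 2 * t * (p \<bullet> e)))) + M * h z = ?w z"
          by (simp only:)
      qed
      ultimately show "harmonic_on ?w U" by (simp only:)
      fix y assume y: "y \<in> frontier U"
      have ycl: "y \<in> closure U" using y by (simp add: frontier_def)
      then have ycD: "y \<in> closure D" and yp: "dist p y \<le> \<rho>2" using clU by auto
      consider "y \<in> frontier D" | "y \<in> D" "dist p y = \<rho>2" using frU[OF y] by blast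
      then show "c3 \<le> ?w y"
      proof cases
        case 1
        obtain n where n: "norm n = 1" "c \<le> n \<bullet> e" "ball (y + R0 *\<^sub>R n) R0 \<subseteq> D"
          using balls[OF 1] yp \<rho>2 R0 by auto
        have nn: "n \<bullet> n = 1" "e \<bullet> e = 1" using n e by (simp_all add: norm_eq_1)
        have "(dist (y + R0 *\<^sub>R n) (y + t *\<^sub>R e))\<^sup>2 = R0\<^sup>2 - 2 * R0 * t * (n \<bullet> e) + t\<^sup>2"
          unfolding dist_norm power2_norm_eq_inner
          by (simp add: inner_diff_left inner_diff_right inner_commute nn power2_eq_square algebra_simps)
        moreover have "R0 * t * c \<le> R0 * t * (n \<bullet> e)"
          using n(2) R0 t by (intro mult_left_mono) auto
        moreover have "t * t \<le> t * (R0 * c)" using t by (intro mult_left_mono) auto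
        moreover have "t * (R0 * c) > 0" using t R0 c by simp
        ultimately have d: "(dist (y + R0 *\<^sub>R n) (y + t *\<^sub>R e))\<^sup>2 \<le> R0\<^sup>2 - t * (R0 * c)" and dl: "t * (R0 * c) > 0"
          by (auto simp: power2_eq_square algebra_simps)
        then have "(dist (y + R0 *\<^sub>R n) (y + t *\<^sub>R e))\<^sup>2 < R0\<^sup>2" by linarith
        then have "dist (y + R0 *\<^sub>R n) (y + t *\<^sub>R e) < R0"
          using R0 by (simp add: power2_less_imp_less)
        then have "(R0\<^sup>2 - (dist (y + R0 *\<^sub>R n) (y + t *\<^sub>R e))\<^sup>2) / 4 \<le> \<psi>\<^sub>0 (y + t *\<^sub>R e)"
          by (intro psi_ge_ball R0 n(3)) simp
        then have "t * c3 \<le> \<psi>\<^sub>0 (y + t *\<^sub>R e)" using d by (simp add: c3_def)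
        then have "c3 \<le> \<psi>\<^sub>0 (y + t *\<^sub>R e) / t"
          using t by (simp add: pos_le_divide_eq mult.commute)
        moreover have "0 \<le> M * h y" using M hn[OF ycD] by simp
        ultimately show ?thesis using psi_frontier[OF 1] by simp
      next
        case 2
        have seg: "closed_segment y (y + t *\<^sub>R e) \<subseteq> D"
        proof
          fix z assume "z \<in> closed_segment y (y + t *\<^sub>R e)"
          then obtain u where u: "0 \<le> u" "u \<le> 1" "z = y + (u * t) *\<^sub>R e"
            by (auto simp: in_segment algebra_simps)
          show "z \<in> D"
          proof (cases "u = 0")
            case False
            have "u * t \<le> 1 * t" using u t by (intro mult_right_mono) auto
            then have "u * t < \<rho>" using t \<rho>2 by linarith
            then show ?thesis unfolding u(3) using u False t \<rho>2 yp by (intro up ycD) auto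
          qed (use u 2 in simp)
        qed
        have "\<bar>\<psi>\<^sub>0 (y + t *\<^sub>R e) - \<psi>\<^sub>0 y\<bar> \<le> L * norm ((y + t *\<^sub>R e) - y)"
          by (rule GDERIV_lipschitz[OF convex_closed_segment, of y "y + t *\<^sub>R e" \<psi>\<^sub>0 "grad \<psi>\<^sub>0"])
            (use seg GDERIV_psi L in auto)
        then have "- (L * t) \<le> \<psi>\<^sub>0 (y + t *\<^sub>R e) - \<psi>\<^sub>0 y"
          using e t by (simp add: abs_le_iff)
        then have "(1 / t) * (- (L * t)) \<le> (1 / t) * (\<psi>\<^sub>0 (y + t *\<^sub>R e) - \<psi>\<^sub>0 y)"
          using t by (intro mult_left_mono) auto
        moreover have "(1 / t) * (- (L * t)) = - L" using t by simp
        moreover have "M * m \<le> M * h y" using M m(2)[OF ycD 2(2)] by (intro mult_left_mono) auto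
        ultimately show ?thesis using M(2) by linarith
      qed
    qed
    then show ?thesis by simp
  qed
  have lower: "c3 - M * h x \<le> grad \<psi>\<^sub>0 x \<bullet> e" if x: "x \<in> U" for x
  proof -
    have xD: "x \<in> D" using x by (simp add: U_def)
    \<comment> \<open>Admissible steps tending to 0; the bound \<open>quot\<close> is independent of
      the step and passes to the derivative.\<close>
    define s where "s k = min \<rho>2 (R0 * c) / (real k + 2)" for k :: nat
    have mp: "min \<rho>2 (R0 * c) > 0" using \<rho>2 R0 c by simp
    have s: "0 < s k" "s k < \<rho>2" "s k \<le> R0 * c" for k
    proof -
      show "0 < s k" using mp by (simp add: s_def)
      have "min \<rho>2 (R0 * c) * 1 < min \<rho>2 (R0 * c) * (real k + 2)"
        using mp by (intro mult_strict_left_mono) auto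
      then have "min \<rho>2 (R0 * c) / (real k + 2) < min \<rho>2 (R0 * c)"
        by (simp only: pos_divide_less_eq mult_1_right)
      then show "s k < \<rho>2" "s k \<le> R0 * c" by (simp_all add: s_def)
    qed
    have s0: "s \<longlonglongrightarrow> 0" unfolding s_def by real_asymp
    have "((\<lambda>t. \<psi>\<^sub>0 (x + t *\<^sub>R e)) has_real_derivative e \<bullet> grad \<psi>\<^sub>0 x) (at 0)"
      using GDERIV_psi[OF xD] by (intro GDERIV_line) simp
    then have "((\<lambda>t. (\<psi>\<^sub>0 (x + t *\<^sub>R e) - \<psi>\<^sub>0 x) / t) \<longlongrightarrow> e \<bullet> grad \<psi>\<^sub>0 x) (at 0)"
      by (simp add: DERIV_def)
    moreover have "\<forall>k. s k \<in> UNIV - {0}" using s(1) by (auto simp: less_imp_neq[symmetric])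
    ultimately have "(\<lambda>k. (\<psi>\<^sub>0 (x + s k *\<^sub>R e) - \<psi>\<^sub>0 x) / s k) \<longlonglongrightarrow> e \<bullet> grad \<psi>\<^sub>0 x"
      using s0 unfolding tendsto_at_iff_sequentially o_def by blast
    then have "c3 - M * h x \<le> e \<bullet> grad \<psi>\<^sub>0 x"
      by (rule Lim_bounded2[where N=0]) (use quot[OF x s] in blast)
    then show ?thesis by (simp add: inner_commute)
  qed
  have "\<exists>d>0. \<forall>x\<in>closure D. dist x p < d \<longrightarrow> dist (h x) (h p) < c3 / (2 * M)"
    using hc pcl c3 M unfolding continuous_on_iff by simp
  then obtain d where d: "d > 0" "\<And>x. x \<in> closure D \<Longrightarrow> dist x p < d \<Longrightarrow> dist (h x) (h p) < c3 / (2 * M)"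
    by blast
  show thesis
  proof (rule that[of "c3 / 2" "min d \<rho>2" e])
    show "c3 / 2 > 0" "min d \<rho>2 > 0" using c3 d \<rho>2 by auto
    fix x assume x: "x \<in> D" "x \<in> ball p (min d \<rho>2)"
    have "h x < c3 / (2 * M)"
      using d(2)[of x] x closure_subset[of D] hp by (auto simp: dist_commute dist_real_def abs_less_iff)
    then have "M * h x \<le> M * (c3 / (2 * M))" using M by (intro mult_left_mono) auto
    also have "\<dots> = c3 / 2" using M by simp
    finally show "c3 / 2 \<le> grad \<psi>\<^sub>0 x \<bullet> e" using lower[of x] x by (auto simp: U_def)
  qed
qed

text \<open>At an interior point the gradient itself is a suitable direction, by continuity. On the
  frontier the condition on the gradient is void, and the barrier argument provides the
  direction.\<close>

lemma derivative_positive_near: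
  assumes p: "p \<in> closure D" and crit: "p \<in> D \<Longrightarrow> grad \<psi>\<^sub>0 p \<noteq> 0"
  obtains e c \<rho> where "c > 0" "\<rho> > 0" "\<And>x. x \<in> D \<Longrightarrow> x \<in> ball p \<rho> \<Longrightarrow> c \<le> grad \<psi>\<^sub>0 x \<bullet> e"
proof (cases "p \<in> D")
  case False
  then have "p \<in> frontier D" using p open_D by (simp add: frontier_def interior_open)
  then show thesis by (rule derivative_positive_near_frontier) (rule that)
next
  case True
  define e where "e = grad \<psi>\<^sub>0 p"
  \<comment> \<open>At \<open>p\<close> the derivative along \<open>e\<close> is
    \<open>2 * c\<close>; half of it survives nearby.\<close>
  define c where "c = (e \<bullet> e) / 2"
  have c: "c > 0" using crit[OF True] by (simp add: c_def e_def)
  have "continuous_on D (\<lambda>x. (1 / C0) *\<^sub>R gpot D x)"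
    by (intro continuous_intros continuous_gpot D_sets)
  then have "continuous_on D (grad \<psi>\<^sub>0)"
    by (rule continuous_on_eq) (use C0_pos in \<open>simp add: gpotD_eq\<close>)
  then have "continuous_on D (\<lambda>x. grad \<psi>\<^sub>0 x \<bullet> e)" by (intro continuous_intros)
  then have "\<exists>d>0. \<forall>x\<in>D. dist x p < d \<longrightarrow> dist (grad \<psi>\<^sub>0 x \<bullet> e) (grad \<psi>\<^sub>0 p \<bullet> e) < c"
    using True c unfolding continuous_on_iff by blast
  then obtain d where d: "d > 0" "\<And>x. x \<in> D \<Longrightarrow> dist x p < d \<Longrightarrow> dist (grad \<psi>\<^sub>0 x \<bullet> e) (grad \<psi>\<^sub>0 p \<bullet> e) < c"
    by blast
  have "c \<le> grad \<psi>\<^sub>0 x \<bullet> e" if "x \<in> D" "x \<in> ball p d" for x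
  proof -
    have "dist (grad \<psi>\<^sub>0 x \<bullet> e) (e \<bullet> e) < c"
      using d(2)[OF that(1)] that(2) by (simp add: dist_commute e_def)
    then have "\<bar>grad \<psi>\<^sub>0 x \<bullet> e - 2 * c\<bar> < c" by (simp add: dist_real_def c_def)
    then show ?thesis by linarith
  qed
  with c d(1) that show thesis by blast
qed

end

subsection \<open>Concentrating patches\<close>

text \<open>All ratios equal 1, so there are admissible mass vectors of arbitrarily small total
  mass.\<close>

lemma const_in_K_set:
  fixes t \<alpha> :: real
  assumes "t > 0" "\<alpha> \<ge> 1"
  shows "(\<chi> i::'k::finite. t) \<in> K_set \<alpha>"
proof -
  have "range (\<lambda>(i, j). (\<chi> i::'k. t) $ i / (\<chi> i::'k. t) $ j) = {1}"
    using assms by auto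
  then show ?thesis using assms by (simp add: K_set_def)
qed

theorem theorem2p3:
  fixes D :: "(real^2) set"
    and G :: "real^2 \<Rightarrow> real^2 \<Rightarrow> real"
    and \<psi>\<^sub>0 :: "real^2 \<Rightarrow> real"
    and x :: "'k::finite \<Rightarrow> real^2"
    and \<alpha> \<delta> :: real
    and r :: "real^'k \<Rightarrow> 'k \<Rightarrow> real"
  assumes "smooth_sc_domain D"
    and "green_function D G"
    and "torsion_function D \<psi>\<^sub>0"
    and "1 \<le> \<alpha>"
    and "inj x" and "\<And>i. x i \<in> closure D"
    and "0 < \<delta>"
    and radii_vanish: "\<And>\<epsilon>. 0 < \<epsilon> \<Longrightarrow>
      \<exists>\<eta>>0. \<forall>\<kappa>\<in>K_set \<alpha>. mass \<kappa> < \<eta> \<longrightarrow> (\<forall>i. \<bar>r \<kappa> i\<bar> < \<epsilon>)"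
    and patches: "\<And>\<kappa>. \<kappa> \<in> K_set \<alpha> \<Longrightarrow> mass \<kappa> < \<delta> \<Longrightarrow>
      \<exists>\<omega> A. weak_vorticity_solution D G \<omega> \<and>
        (\<forall>y\<in>D. \<omega> y = 1 - indicator (\<Union>i. A i) y) \<and>
        (\<forall>i. A i \<in> sets lebesgue \<and> A i \<subseteq> D \<and> measure lebesgue (A i) = \<kappa> $ i \<and>
             A i \<subseteq> ball (x i) (r \<kappa> i))"
  shows "\<forall>i. x i \<in> D \<and> GDERIV \<psi>\<^sub>0 (x i) :> 0"
proof (rule ccontr)
  assume "\<not> ?thesis"
  then obtain i where i: "x i \<in> D \<Longrightarrow> \<not> GDERIV \<psi>\<^sub>0 (x i) :> 0" by blast
  interpret torsion_domain D G \<psi>\<^sub>0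
    using assms(1-3) by unfold_locales (auto simp: smooth_sc_domain_def)
  define p where "p = x i"
  have "grad \<psi>\<^sub>0 p \<noteq> 0" if "p \<in> D"
    using i GDERIV_psi[of p] that by (auto simp: p_def)
  then obtain e c \<rho> where c: "c > 0" and \<rho>: "\<rho> > 0"
    and mono: "\<And>y. y \<in> D \<Longrightarrow> y \<in> ball p \<rho> \<Longrightarrow> c \<le> grad \<psi>\<^sub>0 y \<bullet> e"
    by (rule derivative_positive_near[OF assms(6)[of i, folded p_def]]) (auto intro: that)
  \<comment> \<open>A third of the distances: patches in discs of radius \<epsilon> about the other
    points then stay off \<open>ball p (2 * \<epsilon>)\<close>, outside which the cutoff
    vanishes.\<close>
  define \<epsilon> where "\<epsilon> = Min (insert \<rho> ((\<lambda>j. dist p (x j) / 3) ` (UNIV - {i})))"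
  have \<epsilon>: "\<epsilon> > 0" "\<epsilon> \<le> \<rho>" and sep: "j \<noteq> i \<Longrightarrow> 3 * \<epsilon> \<le> dist p (x j)" for j
  proof -
    have fin: "finite (insert \<rho> ((\<lambda>j. dist p (x j) / 3) ` (UNIV - {i})))" by simp
    show "\<epsilon> \<le> \<rho>" unfolding \<epsilon>_def by (rule Min_le[OF fin]) simp
    have "j \<noteq> i \<Longrightarrow> \<epsilon> \<le> dist p (x j) / 3"
      unfolding \<epsilon>_def by (rule Min_le[OF fin]) simp
    then show "j \<noteq> i \<Longrightarrow> 3 * \<epsilon> \<le> dist p (x j)" by simp
    have "dist p (x j) > 0" if "j \<noteq> i" for j
      using assms(5) that by (auto simp: p_def inj_eq)
    then show "\<epsilon> > 0" unfolding \<epsilon>_def using fin \<rho> by (subst Min_gr_iff) auto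
  qed
  obtain \<eta> where \<eta>: "\<eta> > 0" "\<And>\<kappa>. \<kappa> \<in> K_set \<alpha> \<Longrightarrow> mass \<kappa> < \<eta> \<Longrightarrow> \<forall>i. \<bar>r \<kappa> i\<bar> < \<epsilon>"
    using radii_vanish[OF \<epsilon>(1)] by blast
  define E where "E = norm e + 1"
  have E: "E > 0" "norm e \<le> E" by (auto simp: E_def add_nonneg_pos)
  \<comment> \<open>The gradient of the patch potential in direction \<open>e\<close> is at most
    \<open>CG * (14 * a) * E\<close>, which this choice makes half of \<open>C0 * c\<close>.\<close>
  define a where "a = C0 * c / (28 * CG * E)"
  have a: "a > 0" using C0_pos c CG_pos E by (simp add: a_def)
  define k where "k = real CARD('k)"
  have k: "k > 0" by (simp add: k_def)
  \<comment> \<open>Total mass below \<delta> for the patches to exist, below \<eta> for radii under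
    \<epsilon>, and at most \<open>a\<^sup>2\<close> for the gradient estimate.\<close>
  define t where "t = min (min (\<delta> / 2) (\<eta> / 2)) (a\<^sup>2) / k"
  have t: "t > 0" using assms(7) \<eta> a k by (simp add: t_def)
  have kt: "k * t < \<delta>" "k * t < \<eta>" "k * t \<le> a\<^sup>2"
    using k assms(7) \<eta>(1) by (auto simp: t_def)
  define \<kappa> where "\<kappa> = (\<chi> i::'k. t)"
  have \<kappa>: "\<kappa> \<in> K_set \<alpha>"
    unfolding \<kappa>_def by (rule const_in_K_set[OF t assms(4)])
  have mass: "mass \<kappa> = k * t" by (simp add: mass_def \<kappa>_def k_def)
  obtain \<omega> A where weak: "weak_vorticity_solution D G \<omega>"
    and \<omega>: "\<And>y. y \<in> D \<Longrightarrow> \<omega> y = 1 - indicator (\<Union>i. A i) y"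
    and A: "\<And>i. A i \<in> sets lebesgue" "\<And>i. A i \<subseteq> D" "\<And>i. measure lebesgue (A i) = t" "\<And>i. A i \<subseteq> ball (x i) (r \<kappa> i)"
    using patches[OF \<kappa>] kt(1) mass by (auto simp: \<kappa>_def)
  have r\<epsilon>: "A j \<subseteq> ball (x j) \<epsilon>" for j
  proof -
    have "\<bar>r \<kappa> j\<bar> < \<epsilon>" using \<eta>(2)[OF \<kappa>] kt(2) mass by simp
    then have "ball (x j) (r \<kappa> j) \<subseteq> ball (x j) \<epsilon>" by (intro subset_ball) linarith
    with A(4)[of j] show ?thesis by blast
  qed
  define A1 where "A1 = A i"
  define A2 where "A2 = (\<Union>j\<in>UNIV - {i}. A j)"
  have Aun: "(\<Union>i. A i) = A1 \<union> A2" by (auto simp: A1_def A2_def)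
  have As: "A1 \<in> sets lebesgue" "A2 \<in> sets lebesgue" "A1 \<subseteq> D" "A2 \<subseteq> D"
    using A by (auto simp: A1_def A2_def)
  define B where "B = A1 \<union> A2"
  have B: "B \<in> sets lebesgue" "B \<subseteq> D" using As by (auto simp: B_def)
  have mB: "measure lebesgue B \<le> a\<^sup>2"
  proof -
    have "measure lebesgue (\<Union>i\<in>UNIV. A i) \<le> (\<Sum>i\<in>UNIV. measure lebesgue (A i))"
      by (rule measure_UNION_le) (use A in auto)
    also have "\<dots> = k * t" by (simp add: A k_def)
    finally show ?thesis using kt(3) by (simp add: B_def Aun)
  qed
  define \<psi> where "\<psi> y = pot D y - pot B y" for y
  define V where "V y = gpot D y - gpot B y" for y
  have d: "GDERIV \<psi> y :> V y" if "y \<in> D" for y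
    unfolding \<psi>_def[abs_def] V_def by (intro GDERIV_diff GDERIV_pot that D_sets B)
  have Vc: "continuous_on D V"
    unfolding V_def[abs_def] by (intro continuous_intros continuous_gpot D_sets B)
  have Vb: "norm (V y) \<le> CG * (14 * sqrt (measure lebesgue D)) + CG * (14 * sqrt (measure lebesgue B))" if "y \<in> D" for y
    unfolding V_def using norm_triangle_ineq4[of "gpot D y" "gpot B y"] norm_gpot_le[OF that D_sets] norm_gpot_le[OF that B]
    by linarith
  \<comment> \<open>On \<open>D\<close> the vorticity is the indicator of \<open>D - B\<close>, so
    the stream function is a potential with nonnegative density.\<close>
  have \<psi>_eq: "\<psi> y = pot (D - B) y" if "y \<in> D" for y
  proof -
    have "(\<integral>z. indicator D z *\<^sub>R G y z \<partial>lebesgue) - (\<integral>z. indicator B z *\<^sub>R G y z \<partial>lebesgue) = (\<integral>z. indicator D z *\<^sub>R G y z - indicator B z *\<^sub>R G y z \<partial>lebesgue)"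
      using integrable_G[OF that D_sets] integrable_G[OF that B] unfolding set_integrable_def
      by (rule Bochner_Integration.integral_diff[symmetric])
    also have "\<dots> = (\<integral>z. indicator (D - B) z *\<^sub>R G y z \<partial>lebesgue)"
      using B(2) by (intro Bochner_Integration.integral_cong) (auto split: split_indicator)
    finally show ?thesis by (simp add: \<psi>_def pot_def set_lebesgue_integral_def)
  qed
  have \<psi>0: "0 \<le> \<psi> y" if "y \<in> D" for y
    unfolding \<psi>_eq[OF that] by (rule pot_nonneg[OF that]) (use D_sets B in auto)
  define C where "C = CG * (14 * sqrt (measure lebesgue D)) + 1"
  have C: "C > 0" using CG_pos by (simp add: C_def add_nonneg_pos)
  \<comment> \<open>Dropping the nonnegative patch potential leaves the linear decay of
    \<open>pot D\<close>, the input for truncating at positive levels.\<close>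
  have \<psi>C: "\<psi> y \<le> C * bdist y" if "y \<in> D" for y
    using pot_le[OF that D_sets] pot_nonneg[OF that B] bdist_nonneg[of y]
    by (simp add: \<psi>_def C_def algebra_simps abs_le_iff)
  have gop: "green_op D G \<omega> y = \<psi> y" if "y \<in> D" for y
  proof -
    have "green_op D G \<omega> y = (\<integral>z. indicator (D - B) z *\<^sub>R G y z \<partial>lebesgue)"
      unfolding green_op_def set_lebesgue_integral_def
      by (intro Bochner_Integration.integral_cong) (auto simp: \<omega> Aun B_def split: split_indicator)
    then show ?thesis by (simp add: \<psi>_eq[OF that] pot_def set_lebesgue_integral_def)
  qed
  \<comment> \<open>Equality with \<psi> holds on the open set \<open>D\<close>, which determines
    the gradient there.\<close>
  have gradop: "grad (green_op D G \<omega>) y = V y" if "y \<in> D" for y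
    by (rule GDERIV_imp_grad, rule GDERIV_cong_open[OF d[OF that] open_D that]) (simp add: gop)
  have pos: "V y \<bullet> e > 0" if y: "y \<in> D" "y \<in> ball p \<epsilon>" for y
  proof -
    have "C0 * c \<le> C0 * (grad \<psi>\<^sub>0 y \<bullet> e)"
      using mono[OF y(1)] y(2) \<epsilon>(2) C0_pos by (intro mult_left_mono) auto
    moreover have "\<bar>gpot B y \<bullet> e\<bar> \<le> C0 * c / 2"
    proof -
      have "sqrt (measure lebesgue B) \<le> a" using mB a by (simp add: real_le_lsqrt)
      then have "CG * (14 * sqrt (measure lebesgue B)) \<le> CG * (14 * a)"
        using CG_pos by (intro mult_left_mono) auto
      then have "norm (gpot B y) \<le> CG * (14 * a)" using norm_gpot_le[OF y(1) B] by linarith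
      then have "norm (gpot B y) * norm e \<le> CG * (14 * a) * E"
        using E CG_pos a by (intro mult_mono) auto
      also have "\<dots> = C0 * c / 2" using CG_pos E by (simp add: a_def)
      finally show ?thesis using Cauchy_Schwarz_ineq2[of "gpot B y" e] by linarith
    qed
    moreover have "C0 * c > 0" using C0_pos c by simp
    ultimately show ?thesis by (simp add: V_def gpotD_eq[OF y(1)] inner_diff_left abs_le_iff)
  qed
  have loc: "A1 \<subseteq> ball p \<epsilon>" using r\<epsilon>[of i] by (simp add: A1_def p_def)
  have loc2: "A2 \<inter> ball p (2 * \<epsilon>) = {}"
  proof -
    have "y \<notin> ball p (2 * \<epsilon>)" if "y \<in> A j" "j \<noteq> i" for y j
      using r\<epsilon>[of j] that sep[OF that(2)] dist_triangle[of p "x j" y] by (auto simp: dist_commute)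
    then show ?thesis unfolding A2_def by blast
  qed
  have wk: "(LINT y:D|lebesgue. (1 - indicator (A1 \<union> A2) y) * (perp (V y) \<bullet> grad \<phi> y)) = 0" if "test_function D \<phi>" for \<phi>
  proof -
    have "(LINT y:D|lebesgue. (1 - indicator (A1 \<union> A2) y) * (perp (V y) \<bullet> grad \<phi> y))
       = (LINT y:D|lebesgue. \<omega> y * (perp (grad (green_op D G \<omega>) y) \<bullet> grad \<phi> y))"
      unfolding set_lebesgue_integral_def
      by (intro Bochner_Integration.integral_cong) (auto simp: \<omega> Aun gradop split: split_indicator)
    then show ?thesis using weak that by (simp add: weak_vorticity_solution_def)
  qed
  have "measure lebesgue A1 = 0"
    by (rule no_patch_where_monotone[OF As loc loc2 \<epsilon>(1) d Vc Vb \<psi>0 \<psi>C C pos wk])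
  then show False using A(3)[of i] t by (simp add: A1_def)
qed

end
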